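(* Let $\mathcal{A}$ be an abelian von Neumann subalgebra of a type $II_1$ factor $\mathcal{M}$. If $\mathbb{E}_{\mathcal{A}}$ is an asymptotic homomorphism, then $\mathcal{A}$ is a strongly singular masa in $\mathcal{M}$ with Popa invariant $\delta(\mathcal{A})=1$.
   Context: Let $\mathcal{M}$ be a type $II_1$ factor with normalized trace $\mathrm{tr}$; $\|\cdot\|$ is the operator norm and $\|x\|_2=(\mathrm{tr}(x^*x))^{1/2}$. For a von Neumann subalgebra $\mathcal{N}\subseteq\mathcal{M}$ (containing the identity of $\mathcal M$), $\mathbb{E}_{\mathcal{N}}:\mathcal{M}\to\mathcal{N}$ is the unique trace preserving conditional expectation. For a linear map $\phi:\mathcal{M}\to\mathcal{M}$, $\|\phi\|_{\infty,2}=\sup\{\|\phi(x)\|_2: x\in\mathcal{M},\ \|x\|\le 1\}$. A masa is a maximal abelian self-adjoint subalgebra. For an abelian von Neumann subalgebra $\mathcal{A}\subseteq\mathcal{M}$, $\mathbb{E}_{\mathcal{A}}$ is an asymptotic homomorphism if there is a unitary $u\in\mathcal{A}$ such that $\lim_{|k|\to\infty}\|\mathbb{E}_{\mathcal{A}}(xu^ky)-\mathbb{E}_{\mathcal{A}}(x)\mathbb{E}_{\mathcal{A}}(y)u^k\|_2=0$ for all $x,y\in\mathcal{M}$ (here $k\in\mathbb{Z}$). A masa $\mathcal{A}\subseteq\mathcal{M}$ is strongly singular if $\|\mathbb{E}_{u\mathcal{A}u^*}-\mathbb{E}_{\mathcal{A}}\|_{\infty,2}\ge\|u-\mathbb{E}_{\mathcal{A}}(u)\|_2$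 for all unitaries $u\in\mathcal{M}$. Popa invariant: for a masa $\mathcal{A}\subseteq\mathcal{M}$ and a non-zero partial isometry $v\in\mathcal{M}$ such that $vv^*$ and $v^*v$ are orthogonal projections in $\mathcal{A}$, put $\delta(v\mathcal{A}v^*,\mathcal{A})=\sup\{\|x-\mathbb{E}_{\mathcal{A}}(x)\|_2: x\in v\mathcal{A}v^*,\ \|x\|\le1\}$. Then $\delta(\mathcal{A})$ is the largest $\lambda$ for which $\delta(v\mathcal{A}v^*,\mathcal{A})\ge\lambda\|v^*v\|_2$ holds for all such $v$. *)

theory Defs
  imports "HOL-Analysis.Analysis"
begin

section \<open>Complex Hilbert spaces and bounded operators\<close>

text \<open>
  A complex Hilbert space is presented on top of its underlying real Hilbert space, whose real
  inner product is the real part of the complex one; in particular the norm is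
  \<open>sqrt (Re (cinner x x))\<close>. The inner product is linear in the first argument.
\<close>

class complex_hilbert_space = real_inner + complete_space +
  fixes scaleC :: "complex \<Rightarrow> 'a \<Rightarrow> 'a" (infixr "*\<^sub>C" 75)
    and cinner :: "'a \<Rightarrow> 'a \<Rightarrow> complex"
  assumes scaleC_add_right: "c *\<^sub>C (x + y) = c *\<^sub>C x + c *\<^sub>C y"
    and scaleC_add_left: "(c + d) *\<^sub>C x = c *\<^sub>C x + d *\<^sub>C x"
    and scaleC_scaleC: "c *\<^sub>C d *\<^sub>C x = (c * d) *\<^sub>C x"
    and scaleC_of_real: "complex_of_real r *\<^sub>C x = r *\<^sub>R x"
    and cinner_add_left: "cinner (x + y) z = cinner x z + cinner y z"
    and cinner_scaleC_left: "cinner (c *\<^sub>C x) y = c * cinner x y"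
    and cinner_commute: "cinner x y = cnj (cinner y x)"
    and Re_cinner: "Re (cinner x y) = inner x y"

lemma norm_scaleC: "norm (c *\<^sub>C x) = cmod c * norm x"
  for x :: "'h::complex_hilbert_space"
proof -
  have "cinner (c *\<^sub>C x) (c *\<^sub>C x) = c * cnj (c * cinner x x)"
    by (metis cinner_scaleC_left cinner_commute)
  also have "\<dots> = (c * cnj c) * cnj (cinner x x)"
    by simp
  also have "\<dots> = of_real ((cmod c)\<^sup>2) * cinner x x"
    by (metis cinner_commute complex_norm_square)
  finally have "inner (c *\<^sub>C x) (c *\<^sub>C x) = (cmod c)\<^sup>2 * inner x x"
    by (simp flip: Re_cinner)
  then show ?thesis
    by (simp add: norm_eq_sqrt_inner real_sqrt_mult)
qed

text \<open>
  Bounded operators are the complex-linear elements of the library type of bounded real-linear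
  maps. The norm of that type is the operator norm and \<open>o\<^sub>L\<close> is the product.
\<close>

type_synonym 'h op = "'h \<Rightarrow>\<^sub>L 'h"

abbreviation one_op :: "'h::complex_hilbert_space op" ("\<one>") where
  "\<one> \<equiv> id_blinfun"

definition bounded_operators :: "'h::complex_hilbert_space op set" where
  "bounded_operators = {T. \<forall>c x. blinfun_apply T (c *\<^sub>C x) = c *\<^sub>C blinfun_apply T x}"

lift_definition scaleC_op :: "complex \<Rightarrow> 'h::complex_hilbert_space op \<Rightarrow> 'h op"
  is "\<lambda>c T x. c *\<^sub>C T x"
proof -
  fix c :: complex and T :: "'h \<Rightarrow> 'h"
  assume T: "bounded_linear T"
  have "bounded_linear (\<lambda>x::'h. c *\<^sub>C x)"
  proof (rule bounded_linear_intro[where K = "cmod c"])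
    fix r :: real and x :: 'h
    show "c *\<^sub>C r *\<^sub>R x = r *\<^sub>R c *\<^sub>C x"
      by (metis scaleC_of_real scaleC_scaleC mult.commute)
  qed (simp_all add: scaleC_add_right norm_scaleC)
  from bounded_linear_compose[OF this T] show "bounded_linear (\<lambda>x. c *\<^sub>C T x)" .
qed

definition adj :: "'h::complex_hilbert_space op \<Rightarrow> 'h op" ("_\<^sup>\<dagger>" [1000] 999) where
  "T\<^sup>\<dagger> = (THE S. \<forall>x y. cinner (blinfun_apply T x) y = cinner x (blinfun_apply S y))"

definition positive_op :: "'h::complex_hilbert_space op \<Rightarrow> bool" where
  "positive_op T \<longleftrightarrow>
     T \<in> bounded_operators \<and> (\<forall>x. cinner (blinfun_apply T x) x \<in> \<real>\<^sub>\<ge>\<^sub>0)"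

definition projection :: "'h::complex_hilbert_space op \<Rightarrow> bool" where
  "projection p \<longleftrightarrow> p \<in> bounded_operators \<and> p\<^sup>\<dagger> = p \<and> p o\<^sub>L p = p"

definition partial_isometry :: "'h::complex_hilbert_space op \<Rightarrow> bool" where
  "partial_isometry v \<longleftrightarrow> v \<in> bounded_operators \<and> projection (v\<^sup>\<dagger> o\<^sub>L v)"

definition unitary :: "'h::complex_hilbert_space op \<Rightarrow> bool" where
  "unitary u \<longleftrightarrow> u \<in> bounded_operators \<and> u\<^sup>\<dagger> o\<^sub>L u = \<one> \<and> u o\<^sub>L u\<^sup>\<dagger> = \<one>"

text \<open>Integer powers of a unitary, whose inverse is its adjoint.\<close>

definition unitary_power :: "'h::complex_hilbert_space op \<Rightarrow> int \<Rightarrow> 'h op" where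
  "unitary_power u k =
     (if k \<ge> 0 then ((\<lambda>T. u o\<^sub>L T) ^^ nat k) \<one> else ((\<lambda>T. u\<^sup>\<dagger> o\<^sub>L T) ^^ nat (- k)) \<one>)"

text \<open>The set \<open>v S v\<^sup>\<dagger>\<close>.\<close>

definition conjugate :: "'h::complex_hilbert_space op \<Rightarrow> 'h op set \<Rightarrow> 'h op set" where
  "conjugate v S = (\<lambda>x. v o\<^sub>L x o\<^sub>L v\<^sup>\<dagger>) ` S"


section \<open>Von Neumann algebras\<close>

definition commutant :: "'h::complex_hilbert_space op set \<Rightarrow> 'h op set" where
  "commutant S = {T \<in> bounded_operators. \<forall>x\<in>S. T o\<^sub>L x = x o\<^sub>L T}"

text \<open>
  Such a set is automatically a unital algebra. A von Neumann subalgebra of \<open>M\<close> containing the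
  identity of \<open>M\<close> is a von Neumann algebra on the same Hilbert space that is a subset of \<open>M\<close>.
\<close>

definition von_neumann_algebra :: "'h::complex_hilbert_space op set \<Rightarrow> bool" where
  "von_neumann_algebra M \<longleftrightarrow>
     M \<subseteq> bounded_operators \<and> (\<forall>x\<in>M. x\<^sup>\<dagger> \<in> M) \<and> commutant (commutant M) = M"

definition abelian :: "'h::complex_hilbert_space op set \<Rightarrow> bool" where
  "abelian S \<longleftrightarrow> (\<forall>x\<in>S. \<forall>y\<in>S. x o\<^sub>L y = y o\<^sub>L x)"

definition factor :: "'h::complex_hilbert_space op set \<Rightarrow> bool" where
  "factor M \<longleftrightarrow> von_neumann_algebra M \<and> M \<inter> commutant M = range (\<lambda>c. scaleC_op c \<one>)"

text \<open>
  Type \<open>II\<^sub>1\<close> in the sense of Murray and von Neumann: the identity is a finite projection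
  and no non-zero projection \<open>p\<close> is abelian, i.e. has a commutative corner \<open>pMp\<close>.
\<close>

definition type_II1_factor :: "'h::complex_hilbert_space op set \<Rightarrow> bool" where
  "type_II1_factor M \<longleftrightarrow>
     factor M \<and>
     (\<forall>v\<in>M. v\<^sup>\<dagger> o\<^sub>L v = \<one> \<longrightarrow> v o\<^sub>L v\<^sup>\<dagger> = \<one>) \<and>
     (\<forall>p\<in>M. projection p \<longrightarrow> abelian ((\<lambda>x. p o\<^sub>L x o\<^sub>L p) ` M) \<longrightarrow> p = 0)"

definition self_adjoint_subalgebra ::
    "'h::complex_hilbert_space op set \<Rightarrow> 'h op set \<Rightarrow> bool" where
  "self_adjoint_subalgebra M B \<longleftrightarrow>
     B \<subseteq> M \<and> 0 \<in> B \<and>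
     (\<forall>x\<in>B. \<forall>y\<in>B. x + y \<in> B) \<and>
     (\<forall>c. \<forall>x\<in>B. scaleC_op c x \<in> B) \<and>
     (\<forall>x\<in>B. \<forall>y\<in>B. x o\<^sub>L y \<in> B) \<and>
     (\<forall>x\<in>B. x\<^sup>\<dagger> \<in> B)"

definition masa :: "'h::complex_hilbert_space op set \<Rightarrow> 'h op set \<Rightarrow> bool" where
  "masa M A \<longleftrightarrow>
     self_adjoint_subalgebra M A \<and> abelian A \<and>
     (\<forall>B. self_adjoint_subalgebra M B \<and> abelian B \<and> A \<subseteq> B \<longrightarrow> B = A)"


section \<open>The trace and conditional expectations\<close>

definition linear_functional_on ::
    "'h::complex_hilbert_space op set \<Rightarrow> ('h op \<Rightarrow> complex) \<Rightarrow> bool" where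
  "linear_functional_on M \<tau> \<longleftrightarrow>
     (\<forall>x\<in>M. \<forall>y\<in>M. \<tau> (x + y) = \<tau> x + \<tau> y) \<and>
     (\<forall>c. \<forall>x\<in>M. \<tau> (scaleC_op c x) = c * \<tau> x)"

text \<open>Normality of a functional: it is ultraweakly continuous, i.e. it belongs to the predual.\<close>

definition normal_on ::
    "'h::complex_hilbert_space op set \<Rightarrow> ('h op \<Rightarrow> complex) \<Rightarrow> bool" where
  "normal_on M \<tau> \<longleftrightarrow>
     (\<exists>\<xi> \<eta> :: nat \<Rightarrow> 'h.
        summable (\<lambda>n. (norm (\<xi> n))\<^sup>2) \<and> summable (\<lambda>n. (norm (\<eta> n))\<^sup>2) \<and>
        (\<forall>x\<in>M. (\<lambda>n. cinner (blinfun_apply x (\<xi> n)) (\<eta> n)) sums \<tau> x))"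

text \<open>
  The normalized trace of a \<open>II\<^sub>1\<close> factor is its unique faithful normal tracial state. Only the
  values of \<open>\<tau>\<close> on \<open>M\<close> matter.
\<close>

definition normalized_trace ::
    "'h::complex_hilbert_space op set \<Rightarrow> ('h op \<Rightarrow> complex) \<Rightarrow> bool" where
  "normalized_trace M \<tau> \<longleftrightarrow>
     linear_functional_on M \<tau> \<and> \<tau> \<one> = 1 \<and>
     (\<forall>x\<in>M. \<tau> (x\<^sup>\<dagger> o\<^sub>L x) \<in> \<real>\<^sub>\<ge>\<^sub>0) \<and>
     (\<forall>x\<in>M. \<tau> (x\<^sup>\<dagger> o\<^sub>L x) = 0 \<longrightarrow> x = 0) \<and>
     (\<forall>x\<in>M. \<forall>y\<in>M. \<tau> (x o\<^sub>L y) = \<tau> (y o\<^sub>L x)) \<and>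
     normal_on M \<tau>"

definition norm2 ::
    "('h::complex_hilbert_space op \<Rightarrow> complex) \<Rightarrow> 'h op \<Rightarrow> real" where
  "norm2 \<tau> x = sqrt (Re (\<tau> (x\<^sup>\<dagger> o\<^sub>L x)))"

text \<open>The supremum is taken in the reals, so this is meaningful only when it is finite.\<close>

definition norm_inf2 ::
    "'h::complex_hilbert_space op set \<Rightarrow> ('h op \<Rightarrow> complex) \<Rightarrow> ('h op \<Rightarrow> 'h op) \<Rightarrow> real" where
  "norm_inf2 M \<tau> \<phi> = (SUP x\<in>{x \<in> M. norm x \<le> 1}. norm2 \<tau> (\<phi> x))"

text \<open>
  A conditional expectation is a map on \<open>M\<close> only; it is taken extensional outside \<open>M\<close>, so that
  the trace preserving one is unique as a total function.
\<close>

definition conditional_expectation ::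
    "'h::complex_hilbert_space op set \<Rightarrow> 'h op set \<Rightarrow> ('h op \<Rightarrow> 'h op) \<Rightarrow> bool" where
  "conditional_expectation M N E \<longleftrightarrow>
     E \<in> M \<rightarrow>\<^sub>E N \<and>
     (\<forall>x\<in>M. \<forall>y\<in>M. E (x + y) = E x + E y) \<and>
     (\<forall>c. \<forall>x\<in>M. E (scaleC_op c x) = scaleC_op c (E x)) \<and>
     (\<forall>x\<in>M. positive_op x \<longrightarrow> positive_op (E x)) \<and>
     (\<forall>x\<in>N. E x = x) \<and>
     (\<forall>a\<in>N. \<forall>b\<in>N. \<forall>x\<in>M. E (a o\<^sub>L x o\<^sub>L b) = a o\<^sub>L E x o\<^sub>L b)"

definition cond_exp ::
    "'h::complex_hilbert_space op set \<Rightarrow> ('h op \<Rightarrow> complex) \<Rightarrow> 'h op set \<Rightarrow> 'h op \<Rightarrow> 'h op" where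
  "cond_exp M \<tau> N =
     (THE E. conditional_expectation M N E \<and> (\<forall>x\<in>M. \<tau> (E x) = \<tau> x))"


section \<open>Asymptotic homomorphisms, strong singularity and the Popa invariant\<close>

definition asymptotic_homomorphism ::
    "'h::complex_hilbert_space op set \<Rightarrow> ('h op \<Rightarrow> complex) \<Rightarrow> 'h op set \<Rightarrow> bool" where
  "asymptotic_homomorphism M \<tau> A \<longleftrightarrow>
     (\<exists>u\<in>A. unitary u \<and>
        (\<forall>x\<in>M. \<forall>y\<in>M.
           ((\<lambda>k::int. norm2 \<tau>
               (cond_exp M \<tau> A (x o\<^sub>L unitary_power u k o\<^sub>L y) -
                (cond_exp M \<tau> A x o\<^sub>L cond_exp M \<tau> A y o\<^sub>L unitary_power u k)))
            \<longlongrightarrow> 0) (filtercomap abs at_top)))"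

definition strongly_singular_masa ::
    "'h::complex_hilbert_space op set \<Rightarrow> ('h op \<Rightarrow> complex) \<Rightarrow> 'h op set \<Rightarrow> bool" where
  "strongly_singular_masa M \<tau> A \<longleftrightarrow>
     masa M A \<and>
     (\<forall>u\<in>M. unitary u \<longrightarrow>
        norm_inf2 M \<tau> (\<lambda>x. cond_exp M \<tau> (conjugate u A) x - cond_exp M \<tau> A x)
          \<ge> norm2 \<tau> (u - cond_exp M \<tau> A u))"

text \<open>Popa's \<open>\<delta>(B, A)\<close>.\<close>

definition popa_distance ::
    "'h::complex_hilbert_space op set \<Rightarrow> ('h op \<Rightarrow> complex) \<Rightarrow> 'h op set \<Rightarrow> 'h op set \<Rightarrow> real" where
  "popa_distance M \<tau> B A =
     (SUP x\<in>{x \<in> B. norm x \<le> 1}. norm2 \<tau> (x - cond_exp M \<tau> A x))"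

text \<open>
  The range and source projections of \<open>v\<close> lie in \<open>A\<close> and are orthogonal to each other. (Without
  mutual orthogonality \<open>v = \<one>\<close> would be admissible and the invariant would always vanish.)
\<close>

definition popa_partial_isometries ::
    "'h::complex_hilbert_space op set \<Rightarrow> 'h op set \<Rightarrow> 'h op set" where
  "popa_partial_isometries M A =
     {v \<in> M. v \<noteq> 0 \<and> partial_isometry v \<and>
        v o\<^sub>L v\<^sup>\<dagger> \<in> A \<and> v\<^sup>\<dagger> o\<^sub>L v \<in> A \<and> (v o\<^sub>L v\<^sup>\<dagger>) o\<^sub>L (v\<^sup>\<dagger> o\<^sub>L v) = 0}"

definition popa_invariant ::
    "'h::complex_hilbert_space op set \<Rightarrow> ('h op \<Rightarrow> complex) \<Rightarrow> 'h op set \<Rightarrow> real" where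
  "popa_invariant M \<tau> A =
     (GREATEST l. \<forall>v\<in>popa_partial_isometries M A.
        popa_distance M \<tau> (conjugate v A) A \<ge> l * norm2 \<tau> (v\<^sup>\<dagger> o\<^sub>L v))"

end

theory Submission
  imports Defs
begin

text \<open>
  Let \<open>u \<in> A\<close> be the unitary of the asymptotic homomorphism. If \<open>x\<close> commutes with \<open>A\<close>, then
  \<open>E(x u\<^sup>k y) = E(x y) u\<^sup>k\<close>, so \<open>E(x y) = E(x) E(y)\<close>, and \<open>y = x\<^sup>*\<close> gives \<open>x = E(x)\<close>: \<open>A\<close> is a masa.
  The other two claims test the suprema on \<open>w u\<^sup>k w\<^sup>*\<close> (\<open>w\<close> a unitary or a partial isometry), since
  \<open>\<parallel>E(w u\<^sup>k w\<^sup>*)\<parallel>\<^sub>2\<close> tends to \<open>\<parallel>E(w) E(w\<^sup>*)\<parallel>\<^sub>2\<close>, which is at most \<open>\<parallel>E(w)\<parallel>\<^sub>2\<close> for a unitary and zero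
  for the partial isometries of the Popa invariant.

  For \<open>\<delta>(A) = 1\<close> one also needs that such partial isometries exist, and everything rests on the
  existence of \<open>E\<close>. Both follow from the \<open>\<parallel>\<cdot>\<parallel>\<^sub>2\<close>-completeness of the unit ball of \<open>M\<close>: \<open>E\<close> is obtained by
  minimising \<open>\<parallel>x - a\<parallel>\<^sub>2\<close>, and extreme points of suitable complete sets provide a projection
  \<open>p \<in> A\<close> of trace 1/2 and a partial isometry from \<open>1 - p\<close> onto \<open>p\<close>.
\<close>

section \<open>Minimising sequences and the Riesz representation\<close>

text \<open>\<open>M\<close> acts on an arbitrary Hilbert space, where \<open>\<tau>\<close> need
  not be given by a single vector, so trace-norm completeness has to be earned. Normality gives
  square-summable vectors that dominate \<open>\<tau>\<close>; from them comes a nonzero vector at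
  which \<open>x\<close> is bounded by its trace norm; as \<open>M\<close> is a factor, such vectors
  are dense, and trace-norm Cauchy sequences in a ball converge strongly. Only norm-bounded sets are
  complete in this way. Hence \<open>E x\<close> for 0 <= x <= 1 is sought among the elements of the
  abelian algebra between 0 and 1, and a minimiser there satisfies only one-sided inequalities.
  Turning them into equations is the delicate point. Square roots and spectral projections are
  avoided: the recursion h_(n+1) = h_n - h_n^2 writes a positive element as a sum of squares up to a
  remainder of order 1/n. Without an admissible partial isometry every real would satisfy the
  condition in \<open>popa_invariant\<close>, and \<open>GREATEST\<close> would be undetermined.
  Trace 1/2 is chosen because \<open>p\<close> and \<open>1 - p\<close> then have equal
  trace.\<close>

lemma minimizing_sequence:
  fixes Q :: "'a::real_vector \<Rightarrow> real"
  assumes ne: "C \<noteq> {}"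
    and mid: "\<And>x y. x \<in> C \<Longrightarrow> y \<in> C \<Longrightarrow> (1/2) *\<^sub>R (x + y) \<in> C"
    and conv: "\<And>x y. x \<in> C \<Longrightarrow> y \<in> C \<Longrightarrow>
      Q ((1/2) *\<^sub>R (x + y)) \<le> (Q x + Q y) / 2 - d x y / 4"
    and low: "\<And>x. x \<in> C \<Longrightarrow> m \<le> Q x"
  obtains X where "\<And>n. X n \<in> C"
    and "\<And>n x. x \<in> C \<Longrightarrow> Q (X n) \<le> Q x + 1 / Suc n"
    and "\<And>i j. d (X i) (X j) \<le> 2 / Suc i + 2 / Suc j"
proof -
  define I where "I = Inf (Q ` C)"
  have bdd: "bdd_below (Q ` C)"
    using low by (meson bdd_below.I2)
  have I_le: "I \<le> Q x" if "x \<in> C" for x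
    unfolding I_def using bdd that by (simp add: cInf_lower)
  have "\<exists>x\<in>C. Q x < I + 1 / Suc n" for n
  proof -
    have "\<exists>y\<in>Q ` C. y < I + 1 / Suc n"
      unfolding I_def by (rule cInf_lessD) (use ne in auto)
    then show ?thesis by auto
  qed
  then obtain X where X: "\<And>n. X n \<in> C" "\<And>n. Q (X n) < I + 1 / Suc n"
    by metis
  have "Q (X n) \<le> Q x + 1 / Suc n" if "x \<in> C" for n x
    using X(2)[of n] I_le[OF that] by linarith
  \<comment> \<open>The midpoint of \<open>X i\<close> and \<open>X j\<close> stays in
    \<open>C\<close>, so its value is at least the infimum; both values exceed the infimum by at
    most 1/(n+1) with n the index, which leaves little room for the convexity defect
    \<open>d / 4\<close>.\<close>
  moreover have "d (X i) (X j) \<le> 2 / Suc i + 2 / Suc j" for i j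
  proof -
    have "I \<le> (Q (X i) + Q (X j)) / 2 - d (X i) (X j) / 4"
      using I_le[OF mid[OF X(1) X(1)]] conv[OF X(1) X(1)] by (rule order_trans)
    then have "d (X i) (X j) \<le> 2 * (1 / Suc i) + 2 * (1 / Suc j)"
      using X(2)[of i] X(2)[of j] by argo
    then show ?thesis by simp
  qed
  ultimately show ?thesis
    using that X(1) by blast
qed

lemma inverse_Suc_sum_small:
  assumes "(e::real) > 0"
  obtains N where "\<And>i j. i \<ge> N \<Longrightarrow> j \<ge> N \<Longrightarrow> 2 / real (Suc i) + 2 / real (Suc j) < e"
proof -
  obtain N where N: "1 / real (Suc N) < e / 4"
    using assms nat_approx_posE[of "e/4"] by auto
  have "2 / real (Suc i) < e / 2" if "i \<ge> N" for i
  proof -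
    have "1 / real (Suc i) \<le> 1 / real (Suc N)"
      using that by (simp add: frac_le)
    then show ?thesis using N by simp
  qed
  then have "2 / real (Suc i) + 2 / real (Suc j) < e" if "i \<ge> N" "j \<ge> N" for i j
    using that by (smt (verit) field_sum_of_halves)
  then show ?thesis using that by blast
qed

lemma le_of_self_mult_le:
  fixes a c :: real
  assumes "a * a \<le> a * c" "0 \<le> a" "0 \<le> c"
  shows "a \<le> c"
  using assms by (cases "a = 0") auto

text \<open>The minimiser of \<open>Q x = (norm x)^2 - 2 * f x\<close> on \<open>L\<close> is the
  representing vector. \<open>L = UNIV\<close> gives adjoints; a general closed \<open>L\<close>
  with \<open>f = inner \<xi>\<close> gives the orthogonal projection onto \<open>L\<close>.\<close>

lemma riesz_on_subspace:
  fixes f :: "'h::{real_inner, complete_space} \<Rightarrow> real"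
  assumes L: "subspace L" "closed L" and f: "bounded_linear f"
  obtains z where "z \<in> L" and "\<And>y. y \<in> L \<Longrightarrow> f y = inner z y"
proof -
  interpret f: bounded_linear f by fact
  obtain K where K: "\<And>x. norm (f x) \<le> norm x * K" "K \<ge> 0"
    using f.nonneg_bounded by auto
  define Q where "Q x = (norm x)\<^sup>2 - 2 * f x" for x
  have Qmid: "Q ((1/2) *\<^sub>R (x + y)) \<le> (Q x + Q y) / 2 - (norm (x - y))\<^sup>2 / 4" for x y
  proof -
    have "Q ((1/2) *\<^sub>R (x + y)) = (Q x + Q y) / 2 - (norm (x - y))\<^sup>2 / 4"
      by (simp add: Q_def power2_norm_eq_inner f.add f.scaleR inner_add inner_diff
          inner_commute[of y x] field_simps)
    then show ?thesis by simp
  qed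
  have low: "- K\<^sup>2 \<le> Q x" for x
  proof -
    have "f x \<le> norm x * K" using K(1)[of x] by simp
    moreover have "0 \<le> (norm x - K)\<^sup>2" by simp
    ultimately show ?thesis by (simp add: Q_def power2_eq_square algebra_simps)
  qed
  obtain X where X: "\<And>n. X n \<in> L" "\<And>n x. x \<in> L \<Longrightarrow> Q (X n) \<le> Q x + 1 / Suc n"
    "\<And>i j. (norm (X i - X j))\<^sup>2 \<le> 2 / Suc i + 2 / Suc j"
    by (rule minimizing_sequence[of L Q "\<lambda>x y. (norm (x - y))\<^sup>2" "- K\<^sup>2"])
      (use L Qmid low in \<open>auto simp: subspace_add subspace_mul dest: subspace_0\<close>)
  have "Cauchy X"
  proof (rule metric_CauchyI)
    fix e :: real assume e: "e > 0"
    then obtain N where N: "\<And>i j. i \<ge> N \<Longrightarrow> j \<ge> N \<Longrightarrow> 2 / real (Suc i) + 2 / real (Suc j) < e\<^sup>2"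
      using inverse_Suc_sum_small[of "e\<^sup>2"] by auto
    show "\<exists>M. \<forall>m\<ge>M. \<forall>n\<ge>M. dist (X m) (X n) < e"
    proof (intro exI[of _ N] allI impI)
      fix m n assume "m \<ge> N" "n \<ge> N"
      then have "(norm (X m - X n))\<^sup>2 < e\<^sup>2"
        using N X(3) by (meson order.strict_trans1)
      then show "dist (X m) (X n) < e"
        using e by (simp add: dist_norm power_less_imp_less_base)
    qed
  qed
  then obtain z where z: "X \<longlonglongrightarrow> z" using Cauchy_convergent_iff convergent_def by blast
  have zL: "z \<in> L" using closed_sequentially[OF L(2)] X(1) z by blast
  have "(\<lambda>n. Q (X n)) \<longlonglongrightarrow> Q z"
    unfolding Q_def by (intro tendsto_intros f.tendsto z)
  have Qz: "Q z \<le> Q x" if "x \<in> L" for x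
  proof (rule LIMSEQ_le[OF \<open>(\<lambda>n. Q (X n)) \<longlonglongrightarrow> Q z\<close>])
    show "(\<lambda>n. Q x + 1 / Suc n) \<longlonglongrightarrow> Q x"
      using tendsto_add[OF tendsto_const LIMSEQ_Suc[OF lim_1_over_n]] by simp
  qed (use X(2) that in auto)
  have "f y = inner z y" if y: "y \<in> L" for y
  proof -
    define a where "a = inner z y - f y"
    have q: "0 \<le> 2 * t * a + t\<^sup>2 * (norm y)\<^sup>2" for t
    proof -
      have "z + t *\<^sub>R y \<in> L" using L zL y by (simp add: subspace_add subspace_mul)
      from Qz[OF this] show ?thesis
        by (simp add: Q_def a_def power2_norm_eq_inner f.add f.scaleR inner_add
            inner_commute) (simp add: power2_eq_square algebra_simps)
    qed
    have "a = 0"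
    proof (cases "y = 0")
      case True then show ?thesis by (simp add: a_def f.zero)
    next
      case False
      then have n: "(norm y)\<^sup>2 > 0" by simp
      \<comment> \<open>This \<open>t\<close> minimises the quadratic of \<open>q\<close>.\<close>
      have "0 \<le> 2 * (- a / (norm y)\<^sup>2) * a + (- a / (norm y)\<^sup>2)\<^sup>2 * (norm y)\<^sup>2" by (rule q)
      also have "\<dots> = - (a\<^sup>2) / (norm y)\<^sup>2"
        using n by (simp add: power2_eq_square field_simps)
      finally have "a\<^sup>2 \<le> 0" using n by (simp add: divide_le_0_iff zero_le_divide_iff)
      then show ?thesis by simp
    qed
    then show ?thesis by (simp add: a_def)
  qed
  then show ?thesis using that zL by blast
qed

section \<open>Operators and adjoints\<close>

abbreviation op_times :: "'h::complex_hilbert_space op \<Rightarrow> 'h op \<Rightarrow> 'h op" (infixl "\<cdot>" 70)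
  where "x \<cdot> y \<equiv> x o\<^sub>L y"

interpretation op_times: bounded_bilinear "op_times :: 'h::complex_hilbert_space op \<Rightarrow> _"
  by (rule bounded_bilinear_blinfun_compose)

lemma op_times_assoc: "(x \<cdot> y) \<cdot> z = x \<cdot> (y \<cdot> z)"
  by (rule blinfun_eqI) simp

lemma op_times_one [simp]: "\<one> \<cdot> x = x" "x \<cdot> \<one> = x"
  by (auto intro: blinfun_eqI)

text \<open>The imaginary part is the real inner product against \<open>\<i> *\<^sub>C y\<close>, so
  identities and limits for \<open>inner\<close> that are compatible with \<open>\<i>\<close>
  transfer to \<open>cinner\<close>.\<close>

lemma cinner_eq_Complex: "cinner x y = Complex (inner x y) (inner x (\<i> *\<^sub>C y))"
proof -
  have "cinner x (\<i> *\<^sub>C y) = cnj (\<i> * cinner y x)"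
    by (metis cinner_commute cinner_scaleC_left)
  also have "\<dots> = - \<i> * cinner x y"
    by (simp, metis cinner_commute)
  finally have "inner x (\<i> *\<^sub>C y) = Im (cinner x y)"
    by (simp flip: Re_cinner)
  then show ?thesis
    by (simp add: complex_eq_iff Re_cinner)
qed

lemma cinner_add_right: "cinner x (y + z) = cinner x y + cinner x z"
  by (metis cinner_commute cinner_add_left complex_cnj_add)

lemma cinner_scaleC_right: "cinner x (c *\<^sub>C y) = cnj c * cinner x y"
  by (metis cinner_commute cinner_scaleC_left complex_cnj_mult)

lemma cinner_scaleR_left: "cinner (r *\<^sub>R x) y = r * cinner x y"
  by (metis cinner_scaleC_left scaleC_of_real)

lemma cinner_scaleR_right: "cinner x (r *\<^sub>R y) = r * cinner x y"
  by (metis cinner_scaleC_right scaleC_of_real complex_cnj_complex_of_real)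

lemma cinner_minus_left: "cinner (- x) y = - cinner x y"
  using cinner_scaleR_left[of "-1" x y] by simp

lemma cinner_minus_right: "cinner x (- y) = - cinner x y"
  using cinner_scaleR_right[of x "-1" y] by simp

lemma cinner_diff_left: "cinner (x - y) z = cinner x z - cinner y z"
  using cinner_add_left[of x "-y" z] by (simp add: cinner_minus_left)

lemma cinner_diff_right: "cinner z (x - y) = cinner z x - cinner z y"
  using cinner_add_right[of z x "-y"] by (simp add: cinner_minus_right)

lemma cmod_cinner_le: "cmod (cinner x y) \<le> norm x * norm y"
proof (cases "cinner x y = 0")
  case False
  define c where "c = cnj (cinner x y) / cmod (cinner x y)"
  have c: "cmod c = 1" using False by (simp add: c_def norm_divide)
  have "c * cinner x y = cmod (cinner x y)"
    using False by (simp add: c_def mult.commute complex_norm_square[symmetric] power2_eq_square)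
  then have "cmod (cinner x y) = inner (c *\<^sub>C x) y"
    by (metis Re_cinner Re_complex_of_real cinner_scaleC_left)
  also have "\<dots> \<le> norm (c *\<^sub>C x) * norm y" by (rule norm_cauchy_schwarz)
  finally show ?thesis by (simp add: norm_scaleC c)
qed simp

lemma scaleC_left_diff: "c *\<^sub>C (x - y) = c *\<^sub>C x - c *\<^sub>C (y::'h::complex_hilbert_space)"
  by (metis add_diff_cancel_right' diff_add_cancel scaleC_add_right)

lemma scaleC_minus_left: "(- c) *\<^sub>C x = - (c *\<^sub>C (x::'h::complex_hilbert_space))"
proof -
  have "(- c) *\<^sub>C x + c *\<^sub>C x = 0"
    using scaleC_add_left[of "- c" c x] scaleC_of_real[of 0 x] by simp
  then show ?thesis by (rule eq_neg_iff_add_eq_0[THEN iffD2])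
qed

lemma scaleC_scaleR: "c *\<^sub>C r *\<^sub>R (x::'h::complex_hilbert_space) = r *\<^sub>R c *\<^sub>C x"
  by (metis scaleC_of_real scaleC_scaleC mult.commute)

lemma scaleC_one [simp]: "1 *\<^sub>C (x::'h::complex_hilbert_space) = x"
  using scaleC_of_real[of 1 x] by simp

lemma scaleC_zero_right [simp]: "c *\<^sub>C (0::'h::complex_hilbert_space) = 0"
  using scaleC_scaleR[of c 0 0] by simp

lemma bounded_operatorsD:
  "T \<in> bounded_operators \<Longrightarrow> blinfun_apply T (c *\<^sub>C x) = c *\<^sub>C blinfun_apply T x"
  by (simp add: bounded_operators_def)

lemma scaleC_op_of_real: "scaleC_op (complex_of_real r) T = r *\<^sub>R T"
  by (rule blinfun_eqI) (simp add: scaleC_op.rep_eq scaleC_of_real blinfun.bilinear_simps)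

lemma scaleC_op_apply: "blinfun_apply (scaleC_op c T) x = c *\<^sub>C blinfun_apply T x"
  by (simp add: scaleC_op.rep_eq)

lemmas op_simps = blinfun.bilinear_simps blinfun_apply_blinfun_compose blinfun_apply_id_blinfun

lemma bounded_operators_closed:
  fixes S T :: "'h::complex_hilbert_space op"
  shows "S \<in> bounded_operators \<Longrightarrow> T \<in> bounded_operators \<Longrightarrow> S + T \<in> bounded_operators"
    "S \<in> bounded_operators \<Longrightarrow> T \<in> bounded_operators \<Longrightarrow> S - T \<in> bounded_operators"
    "S \<in> bounded_operators \<Longrightarrow> T \<in> bounded_operators \<Longrightarrow> S \<cdot> T \<in> bounded_operators"
    "T \<in> bounded_operators \<Longrightarrow> scaleC_op c T \<in> bounded_operators"
    "T \<in> bounded_operators \<Longrightarrow> r *\<^sub>R T \<in> bounded_operators"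
    "T \<in> bounded_operators \<Longrightarrow> - T \<in> bounded_operators"
    "(0::'h op) \<in> bounded_operators" "(\<one>::'h op) \<in> bounded_operators"
  by (auto simp: bounded_operators_def op_simps scaleC_add_right scaleC_left_diff scaleC_op_apply
      scaleC_scaleC scaleC_scaleR mult.commute)
    (metis diff_0 scaleC_left_diff scaleC_zero_right)

text \<open>Riesz on the underlying real space gives \<open>s\<close> with
  \<open>inner (T x) y = inner x (s y)\<close>; since \<open>T\<close> commutes with
  \<open>\<i>\<close>, so does \<open>s\<close>, which lifts the identity to \<open>cinner\<close>.
  As \<open>adj\<close> is a definite description, all its properties rest on this
  existence.\<close>

lemma adj_exists:
  fixes T :: "'h::complex_hilbert_space op"
  assumes T: "T \<in> bounded_operators"
  obtains S where "\<And>x y. cinner (blinfun_apply T x) y = cinner x (blinfun_apply S y)"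
proof -
  have "\<exists>z. \<forall>x. inner (T x) y = inner x z" for y
  proof -
    have "bounded_linear (\<lambda>x. inner (T x) y)"
      by (intro bounded_linear_intros)
    then obtain z where "\<And>x. x \<in> UNIV \<Longrightarrow> inner (T x) y = inner z x"
      using riesz_on_subspace[of UNIV "\<lambda>x. inner (T x) y"] by auto
    then show ?thesis by (auto simp: inner_commute)
  qed
  then obtain s where s: "\<And>x y. inner (T x) y = inner x (s y)" by metis
  have eq: "a = b" if "\<And>x. inner x a = inner x b" for a b :: 'h
    using that by (metis inner_commute vector_eq_rdot)
  have "bounded_linear s"
  proof (rule bounded_linear_intro[where K = "norm T"])
    fix a b :: 'h and r :: real
    show "s (a + b) = s a + s b" by (rule eq) (metis inner_add_right s)
    show "s (r *\<^sub>R a) = r *\<^sub>R s a" by (rule eq) (metis inner_scaleR_right s)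
    have "(norm (s a))\<^sup>2 = inner (T (s a)) a" by (simp add: power2_norm_eq_inner s)
    also have "\<dots> \<le> norm (T (s a)) * norm a" by (rule norm_cauchy_schwarz)
    also have "\<dots> \<le> (norm T * norm (s a)) * norm a"
      by (intro mult_right_mono norm_blinfun) simp
    finally have "norm (s a) * norm (s a) \<le> norm (s a) * (norm a * norm T)"
      by (simp add: power2_eq_square mult_ac)
    then show "norm (s a) \<le> norm a * norm T"
      by (rule le_of_self_mult_le) simp_all
  qed
  then have app: "Blinfun s y = s y" for y by (simp add: bounded_linear_Blinfun_apply)
  have i: "s (\<i> *\<^sub>C y) = \<i> *\<^sub>C s y" for y
  proof (rule eq)
    fix x
    have i1: "inner x (\<i> *\<^sub>C y) = - inner (\<i> *\<^sub>C x) y" for x y :: 'h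
      by (simp add: Re_cinner[symmetric] cinner_scaleC_left cinner_scaleC_right)
    show "inner x (s (\<i> *\<^sub>C y)) = inner x (\<i> *\<^sub>C s y)"
      by (metis bounded_operatorsD[OF T] i1 s)
  qed
  have "cinner (T x) y = cinner x (Blinfun s y)" for x y
    by (simp add: app cinner_eq_Complex s i)
  then show ?thesis using that by blast
qed

lemma cinner_right_eqI: "(\<And>x. cinner x a = cinner x b) \<Longrightarrow> a = b"
  by (metis Re_cinner inner_commute vector_eq_rdot)

lemma adj_unique:
  assumes "\<And>x y. cinner (blinfun_apply T x) y = cinner x (blinfun_apply S y)"
  shows "T\<^sup>\<dagger> = S"
  unfolding adj_def
proof (rule the_equality)
  fix R assume "\<forall>x y. cinner (blinfun_apply T x) y = cinner x (blinfun_apply R y)"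
  then show "R = S" by (intro blinfun_eqI cinner_right_eqI) (metis assms)
qed (use assms in simp)

lemma cinner_adj:
  assumes "T \<in> bounded_operators"
  shows "cinner (blinfun_apply T x) y = cinner x (blinfun_apply (T\<^sup>\<dagger>) y)"
proof -
  obtain S where S: "\<And>x y. cinner (T x) y = cinner x (blinfun_apply S y)"
    by (rule adj_exists[OF assms]) (rule that)
  have "T\<^sup>\<dagger> = S" by (rule adj_unique) (rule S)
  then show ?thesis using S by metis
qed

lemma cinner_adj':
  assumes "T \<in> bounded_operators"
  shows "cinner (blinfun_apply (T\<^sup>\<dagger>) x) y = cinner x (blinfun_apply T y)"
  by (metis assms cinner_adj cinner_commute)

lemma inner_adj:
  assumes "T \<in> bounded_operators"
  shows "inner (blinfun_apply T x) y = inner x (blinfun_apply (T\<^sup>\<dagger>) y)"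
  using cinner_adj[OF assms] by (metis Re_cinner)

lemma adj_bounded: "T \<in> bounded_operators \<Longrightarrow> T\<^sup>\<dagger> \<in> bounded_operators"
  unfolding bounded_operators_def mem_Collect_eq
proof (intro allI cinner_right_eqI)
  fix c and x y :: 'a
  assume "\<forall>c x. T (c *\<^sub>C x) = c *\<^sub>C T x"
  then have T: "T \<in> bounded_operators" by (simp add: bounded_operators_def)
  show "cinner y ((T\<^sup>\<dagger>) (c *\<^sub>C x)) = cinner y (c *\<^sub>C (T\<^sup>\<dagger>) x)"
    by (simp add: cinner_scaleC_right flip: cinner_adj[OF T])
qed

lemma adj_adj: "T \<in> bounded_operators \<Longrightarrow> (T\<^sup>\<dagger>)\<^sup>\<dagger> = T"
  by (rule adj_unique) (rule cinner_adj')

lemma adj_add: "S \<in> bounded_operators \<Longrightarrow> T \<in> bounded_operators \<Longrightarrow> (S + T)\<^sup>\<dagger> = S\<^sup>\<dagger> + T\<^sup>\<dagger>"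
  by (rule adj_unique) (simp add: op_simps cinner_add_left cinner_add_right cinner_adj)

lemma adj_diff: "S \<in> bounded_operators \<Longrightarrow> T \<in> bounded_operators \<Longrightarrow> (S - T)\<^sup>\<dagger> = S\<^sup>\<dagger> - T\<^sup>\<dagger>"
  by (rule adj_unique) (simp add: op_simps cinner_diff_left cinner_diff_right cinner_adj)

lemma adj_times: "S \<in> bounded_operators \<Longrightarrow> T \<in> bounded_operators \<Longrightarrow> (S \<cdot> T)\<^sup>\<dagger> = T\<^sup>\<dagger> \<cdot> S\<^sup>\<dagger>"
  by (rule adj_unique) (simp add: op_simps cinner_adj)

lemma adj_scaleC: "T \<in> bounded_operators \<Longrightarrow> (scaleC_op c T)\<^sup>\<dagger> = scaleC_op (cnj c) (T\<^sup>\<dagger>)"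
  by (rule adj_unique) (simp add: scaleC_op_apply cinner_scaleC_left cinner_scaleC_right cinner_adj)

lemma adj_scaleR: "T \<in> bounded_operators \<Longrightarrow> (r *\<^sub>R T)\<^sup>\<dagger> = r *\<^sub>R T\<^sup>\<dagger>"
  using adj_scaleC[of T "of_real r"] by (simp add: scaleC_op_of_real)

lemma adj_one [simp]: "(\<one>::'h::complex_hilbert_space op)\<^sup>\<dagger> = \<one>"
  by (rule adj_unique) simp

lemma adj_zero [simp]: "(0::'h::complex_hilbert_space op)\<^sup>\<dagger> = 0"
  using adj_diff[of \<one> "\<one>::'h op"] by (simp add: bounded_operators_closed)

lemmas adj_simps = adj_adj adj_add adj_diff adj_times adj_scaleC adj_scaleR adj_bounded
  bounded_operators_closed

lemma norm_adj_le:
  fixes T :: "'h::complex_hilbert_space op"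
  assumes "T \<in> bounded_operators"
  shows "norm (T\<^sup>\<dagger>) \<le> norm T"
proof (rule norm_blinfun_bound)
  fix x
  have "(norm ((T\<^sup>\<dagger>) x))\<^sup>2 = inner (T ((T\<^sup>\<dagger>) x)) x"
    by (metis inner_adj[OF assms] power2_norm_eq_inner)
  also have "\<dots> \<le> norm (T ((T\<^sup>\<dagger>) x)) * norm x" by (rule norm_cauchy_schwarz)
  also have "\<dots> \<le> (norm T * norm ((T\<^sup>\<dagger>) x)) * norm x"
    by (intro mult_right_mono norm_blinfun) simp
  finally have "norm ((T\<^sup>\<dagger>) x) * norm ((T\<^sup>\<dagger>) x) \<le> norm ((T\<^sup>\<dagger>) x) * (norm T * norm x)"
    by (simp add: power2_eq_square mult_ac)
  then show "norm ((T\<^sup>\<dagger>) x) \<le> norm T * norm x"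
    by (rule le_of_self_mult_le) simp_all
qed simp

section \<open>Positive operators\<close>

definition hermitian :: "'h::complex_hilbert_space op \<Rightarrow> bool" where
  "hermitian T \<longleftrightarrow> T \<in> bounded_operators \<and> T\<^sup>\<dagger> = T"

lemma hermitian_inner: "hermitian T \<Longrightarrow> inner (blinfun_apply T x) y = inner x (blinfun_apply T y)"
  unfolding hermitian_def by (metis inner_adj)

lemma hermitianD: "hermitian T \<Longrightarrow> T \<in> bounded_operators"
  by (simp add: hermitian_def)

lemma hermitian_closed:
  fixes S T :: "'h::complex_hilbert_space op"
  shows "hermitian S \<Longrightarrow> hermitian T \<Longrightarrow> hermitian (S + T)"
    "hermitian S \<Longrightarrow> hermitian T \<Longrightarrow> hermitian (S - T)"
    "hermitian T \<Longrightarrow> hermitian (r *\<^sub>R T)"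
    "hermitian (0 :: 'h op)" "hermitian (\<one> :: 'h op)"
    "hermitian T \<Longrightarrow> hermitian (T \<cdot> T)"
  by (auto simp: hermitian_def adj_simps)

text \<open>Polarisation: expanding at \<open>x + z\<close> and comparing \<open>z = y\<close> with
  \<open>z = \<i> *\<^sub>C y\<close> isolates \<open>cinner (S x) y\<close>. This is where complex
  scalars make a positive operator self-adjoint.\<close>

lemma quadratic_form_zero:
  fixes S :: "'h::complex_hilbert_space op"
  assumes S: "S \<in> bounded_operators" and 0: "\<And>x. cinner (blinfun_apply S x) x = 0"
  shows "S = 0"
proof (rule blinfun_eqI)
  fix x
  have "cinner (S x) y = 0" for y
  proof -
    have *: "cinner (S x) z + cinner (S z) x = 0" for z
      using 0[of "x + z"] 0[of x] 0[of z]
      by (simp add: op_simps cinner_add_left cinner_add_right add.commute)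
    have "\<i> * cinner (S y) x = \<i> * cinner (S x) y"
      using *[of "\<i> *\<^sub>C y"] by (simp add: bounded_operatorsD[OF S] cinner_scaleC_left cinner_scaleC_right)
    then show ?thesis using *[of y] by simp
  qed
  then show "S x = blinfun_apply 0 x"
    by (metis Re_cinner inner_eq_zero_iff zero_complex.simps(1) zero_blinfun.rep_eq)
qed

lemma positive_op_iff:
  "positive_op T \<longleftrightarrow> hermitian T \<and> (\<forall>x. 0 \<le> inner (blinfun_apply T x) x)"
proof
  assume p: "positive_op T"
  then have T: "T \<in> bounded_operators" and nn: "\<And>x. cinner (T x) x \<in> \<real>\<^sub>\<ge>\<^sub>0"
    by (auto simp: positive_op_def)
  have "T - T\<^sup>\<dagger> = 0"
  proof (rule quadratic_form_zero)
    fix x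
    have "cinner (T x) x = cnj (cinner (T x) x)"
      using nn[of x] by (metis Reals_cnj_iff nonneg_Reals_subset_Reals subsetD)
    also have "\<dots> = cinner ((T\<^sup>\<dagger>) x) x"
      by (metis T cinner_adj' cinner_commute)
    finally show "cinner ((T - T\<^sup>\<dagger>) x) x = 0"
      by (simp add: op_simps cinner_diff_left)
  qed (use T in \<open>simp add: adj_simps\<close>)
  moreover have "0 \<le> inner (T x) x" for x
    using nn[of x] by (metis Re_cinner complex_nonneg_Reals_iff)
  ultimately show "hermitian T \<and> (\<forall>x. 0 \<le> inner (T x) x)"
    using T by (simp add: hermitian_def)
next
  assume h: "hermitian T \<and> (\<forall>x. 0 \<le> inner (T x) x)"
  have "Im (cinner (T x) x) = 0" for x
  proof -
    have "cinner (T x) x = cnj (cinner (T x) x)"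
      by (metis cinner_adj cinner_commute h hermitian_def)
    then show ?thesis by (metis Reals_cnj_iff complex_is_Real_iff)
  qed
  then show "positive_op T"
    using h by (simp add: positive_op_def hermitianD complex_nonneg_Reals_iff Re_cinner)
qed

lemma positive_hermitian: "positive_op T \<Longrightarrow> hermitian T"
  and positive_inner: "positive_op T \<Longrightarrow> 0 \<le> inner (blinfun_apply T x) x"
  by (simp_all add: positive_op_iff)

lemma positive_bounded: "positive_op T \<Longrightarrow> T \<in> bounded_operators"
  by (simp add: positive_op_def)

lemma positive_closed:
  fixes S T :: "'h::complex_hilbert_space op"
  shows "positive_op S \<Longrightarrow> positive_op T \<Longrightarrow> positive_op (S + T)"
    "positive_op T \<Longrightarrow> r \<ge> 0 \<Longrightarrow> positive_op (r *\<^sub>R T)"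
    "positive_op (0 :: 'h op)" "positive_op (\<one> :: 'h op)"
  by (auto simp: positive_op_iff hermitian_closed op_simps inner_add_left)

lemma positive_sandwich:
  assumes "positive_op T" "b \<in> bounded_operators"
  shows "positive_op (b\<^sup>\<dagger> \<cdot> T \<cdot> b)"
proof -
  have "hermitian (b\<^sup>\<dagger> \<cdot> T \<cdot> b)"
    using assms by (simp add: positive_op_iff hermitian_def adj_simps op_times_assoc)
  moreover have "inner ((b\<^sup>\<dagger> \<cdot> T \<cdot> b) x) x = inner (T (b x)) (b x)" for x
    using inner_adj[of "b\<^sup>\<dagger>" "T (b x)" x] assms by (simp add: adj_simps)
  ultimately show ?thesis using assms by (simp add: positive_op_iff)
qed

lemma positive_adj_times: "b \<in> bounded_operators \<Longrightarrow> positive_op (b\<^sup>\<dagger> \<cdot> b)"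
  using positive_sandwich[OF positive_closed(4), of b] by simp

lemma positive_norm_minus:
  assumes "hermitian h" "norm h \<le> c"
  shows "positive_op (c *\<^sub>R \<one> - h)"
proof -
  have "inner (h x) x \<le> c * inner x x" for x
  proof -
    have "inner (h x) x \<le> norm (h x) * norm x" by (rule norm_cauchy_schwarz)
    also have "\<dots> \<le> (norm h * norm x) * norm x" by (intro mult_right_mono norm_blinfun) simp
    also have "\<dots> \<le> (c * norm x) * norm x" by (intro mult_right_mono assms) simp_all
    finally show ?thesis by (simp add: power2_norm_eq_inner[symmetric] power2_eq_square mult_ac)
  qed
  then show ?thesis
    using assms by (auto simp: positive_op_iff hermitian_closed op_simps inner_diff_left)
qed

text \<open>This is g^2 <= c g for 0 <= g <= c. It comes from c^2 g - c g^2 = g (c - g) g + (c - g)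
  g (c - g); the two inequalities of the proof are the two summands evaluated at
  \<open>x\<close>.\<close>

lemma positive_norm_square_le:
  assumes g: "positive_op g" and u: "positive_op (c *\<^sub>R \<one> - g)" and c: "c > 0"
  shows "(norm (blinfun_apply g x))\<^sup>2 \<le> c * inner (blinfun_apply g x) x"
proof -
  note h = hermitian_inner[OF positive_hermitian[OF g]]
  have "0 \<le> c * inner (g x) (g x) - inner (g (g x)) (g x)"
    using positive_inner[OF u, of "g x"] by (simp add: op_simps inner_diff_left)
  moreover have "0 \<le> c * c * inner (g x) x - 2 * c * inner (g x) (g x) + inner (g (g x)) (g x)"
    using positive_inner[OF g, of "c *\<^sub>R x - g x"]
    using h[of x "g x"]
    by (simp add: op_simps inner_diff_left inner_diff_right h[of "g x"] algebra_simps
        inner_commute[of _ x])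
  ultimately have "c * inner (g x) (g x) \<le> c * (c * inner (g x) x)"
    by (simp add: algebra_simps)
  then show ?thesis using c by (simp add: power2_norm_eq_inner)
qed

lemma positive_norm_le:
  assumes g: "positive_op g" and u: "positive_op (c *\<^sub>R \<one> - g)" and c: "c > 0"
  shows "norm g \<le> c"
proof (rule norm_blinfun_bound)
  fix x
  have "inner (g x) x \<le> c * (norm x)\<^sup>2"
    using positive_inner[OF u, of x] by (simp add: op_simps inner_diff_left power2_norm_eq_inner)
  then have "c * inner (g x) x \<le> c * (c * (norm x)\<^sup>2)" using c by simp
  then have "(norm (g x))\<^sup>2 \<le> (c * norm x)\<^sup>2"
    using positive_norm_square_le[OF assms, of x] by (simp add: power2_eq_square mult_ac)
  then show "norm (g x) \<le> c * norm x"
    using c by (simp add: power2_le_iff_abs_le)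
qed (use c in simp)

text \<open>Stands in for a square root: h is the sum of the squares h_k^2 for k < n plus h_n. Each
  h_k is a polynomial in h without constant term, so it stays in every algebra that contains h and
  commutes with whatever commutes with h.\<close>

primrec square_remainder :: "'h::complex_hilbert_space op \<Rightarrow> nat \<Rightarrow> 'h op" where
  "square_remainder h 0 = h"
| "square_remainder h (Suc n) = square_remainder h n - square_remainder h n \<cdot> square_remainder h n"

text \<open>The function t - t^2 increases on [0, 1/2] and maps c = 1/(n+2) to c - c^2 <= 1/(n+3),
  so the bound propagates from its initial value 1/2.\<close>

lemma square_remainder_bounds:
  assumes "positive_op h" "positive_op ((1/2) *\<^sub>R \<one> - h)"
  shows "positive_op (square_remainder h n) \<and>
    positive_op ((1 / real (n + 2)) *\<^sub>R \<one> - square_remainder h n)"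
proof (induction n)
  case 0 then show ?case using assms by simp
next
  case (Suc n)
  define g c where "g = square_remainder h n" and "c = 1 / real (n + 2)"
  have g: "positive_op g" and u: "positive_op (c *\<^sub>R \<one> - g)"
    using Suc by (auto simp: g_def c_def)
  have c: "c > 0" "c \<le> 1/2" by (auto simp: c_def field_simps)
  note h = positive_hermitian[OF g]
  have lo: "positive_op (g - g \<cdot> g)"
    unfolding positive_op_iff
  proof (intro conjI allI)
    fix x
    have "(norm (g x))\<^sup>2 \<le> c * inner (g x) x" by (rule positive_norm_square_le[OF g u c(1)])
    also have "\<dots> \<le> 1 * inner (g x) x"
      using c positive_inner[OF g] by (intro mult_right_mono) auto
    finally show "0 \<le> inner ((g - g \<cdot> g) x) x"
      by (simp add: op_simps inner_diff_left power2_norm_eq_inner hermitian_inner[OF h, of "g x"])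
  qed (simp add: h hermitian_closed)
  \<comment> \<open>Monotonicity of t - t^2 in operator form: c - c^2 - (g - g^2) = (c - g)^2 + (1 -
    2c) (c - g), where 1 - 2c >= 0.\<close>
  have "positive_op ((c *\<^sub>R \<one> - g)\<^sup>\<dagger> \<cdot> (c *\<^sub>R \<one> - g) + (1 - 2 * c) *\<^sub>R (c *\<^sub>R \<one> - g))"
    using c u by (intro positive_closed positive_adj_times positive_bounded) auto
  also have "(c *\<^sub>R \<one> - g)\<^sup>\<dagger> = c *\<^sub>R \<one> - g"
    using positive_hermitian[OF u] by (simp add: hermitian_def)
  also have "(c *\<^sub>R \<one> - g) \<cdot> (c *\<^sub>R \<one> - g) + (1 - 2 * c) *\<^sub>R (c *\<^sub>R \<one> - g)
      = (c - c\<^sup>2) *\<^sub>R \<one> - (g - g \<cdot> g)"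
  proof -
    have double: "(r * 2) *\<^sub>R v = r *\<^sub>R v + r *\<^sub>R v" "(r * (s * 2)) *\<^sub>R v = (r * s) *\<^sub>R v + (r * s) *\<^sub>R v"
      for r s :: real and v :: 'a
      by (simp_all flip: scaleR_add_left)
    show ?thesis
      by (rule blinfun_eqI) (simp add: op_simps algebra_simps power2_eq_square double)
  qed
  finally have 1: "positive_op ((c - c\<^sup>2) *\<^sub>R \<one> - (g - g \<cdot> g))" .
  define m where "m = real n + 2"
  have m: "m > 0" and cm: "c = 1 / m" by (simp_all add: m_def c_def)
  have "c - c\<^sup>2 = (m - 1) / m\<^sup>2"
    unfolding cm using m by (simp add: power2_eq_square field_simps)
  also have "\<dots> \<le> 1 / (m + 1)"
    using m by (simp add: pos_divide_le_eq pos_le_divide_eq power2_eq_square algebra_simps)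
  also have "\<dots> = 1 / real (Suc n + 2)" by (simp add: m_def)
  finally have "positive_op (((c - c\<^sup>2) *\<^sub>R \<one> - (g - g \<cdot> g)) + (1 / real (Suc n + 2) - (c - c\<^sup>2)) *\<^sub>R \<one>)"
    using 1 by (intro positive_closed) auto
  also have "((c - c\<^sup>2) *\<^sub>R \<one> - (g - g \<cdot> g)) + (1 / real (Suc n + 2) - (c - c\<^sup>2)) *\<^sub>R \<one>
     = (1 / real (Suc n + 2)) *\<^sub>R \<one> - (g - g \<cdot> g)"
    by (rule blinfun_eqI) (simp add: op_simps algebra_simps)
  finally show ?case using lo by (simp add: g_def)
qed

lemma norm_square_remainder_le:
  assumes "positive_op h" "positive_op ((1/2) *\<^sub>R \<one> - h)"
  shows "norm (square_remainder h n) \<le> 1 / real (n + 2)"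
  using square_remainder_bounds[OF assms, of n] by (intro positive_norm_le) auto

lemma square_remainder_sum:
  "h = (\<Sum>k<n. square_remainder h k \<cdot> square_remainder h k) + square_remainder h n"
  by (induction n) (simp_all add: algebra_simps)

lemma square_remainder_in:
  assumes "h \<in> S" "\<And>x y. x \<in> S \<Longrightarrow> y \<in> S \<Longrightarrow> x - y \<in> S" "\<And>x y. x \<in> S \<Longrightarrow> y \<in> S \<Longrightarrow> x \<cdot> y \<in> S"
  shows "square_remainder h n \<in> S"
  by (induction n) (use assms in auto)

text \<open>The denominator n + 2 is the one in the norm bound of
  \<open>square_remainder\<close>.\<close>

lemma nonneg_from_remainder:
  fixes a K :: real
  assumes "\<And>n::nat. a \<ge> - K / real (n + 2)"
  shows "a \<ge> 0"
proof (rule LIMSEQ_le_const2[where X = "\<lambda>n. - K / real (n + 2)"])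
  have "(\<lambda>n. - K * (1 / real (n + 2))) \<longlonglongrightarrow> - K * 0"
    by (intro tendsto_mult tendsto_const) (use LIMSEQ_ignore_initial_segment[OF lim_1_over_n, of 2] in simp)
  then show "(\<lambda>n. - K / real (n + 2)) \<longlonglongrightarrow> 0" by simp
qed (use assms in auto)

lemma scaled_below_half:
  assumes "positive_op h"
  obtains t where "t > 0" "positive_op (t *\<^sub>R h)" "positive_op ((1/2) *\<^sub>R \<one> - t *\<^sub>R h)"
proof
  define t where "t = 1 / (2 * (norm h + 1))"
  have n: "norm h + 1 > 0" using norm_ge_zero[of h] by linarith
  show t: "t > 0" using n by (simp add: t_def)
  show th: "positive_op (t *\<^sub>R h)" using t assms by (simp add: positive_closed)
  have "norm (t *\<^sub>R h) \<le> 1/2"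
    using n t by (simp add: t_def field_simps)
  then show "positive_op ((1/2) *\<^sub>R \<one> - t *\<^sub>R h)"
    using th by (intro positive_norm_minus positive_hermitian)
qed

text \<open>Up to scaling, k h is the sum of the g_i k g_i plus k g_n, with self-adjoint g_i that
  commute with k. The sum is positive and the last term tends to 0 in norm.\<close>

lemma positive_commuting_times:
  assumes h: "positive_op h" and k: "positive_op k" and comm: "h \<cdot> k = k \<cdot> h"
  shows "positive_op (h \<cdot> k)"
proof -
  obtain t where t: "t > 0" "positive_op (t *\<^sub>R h)" "positive_op ((1/2) *\<^sub>R \<one> - t *\<^sub>R h)"
    using scaled_below_half[OF h] by blast
  define g where "g = square_remainder (t *\<^sub>R h)"
  have gh: "hermitian (g n)" for n
    using square_remainder_bounds[OF t(2,3)] by (simp add: g_def positive_hermitian)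
  have gk: "k \<cdot> g n = g n \<cdot> k" for n
  proof -
    have "g n \<in> {x. k \<cdot> x = x \<cdot> k}"
      unfolding g_def
    proof (rule square_remainder_in)
      show "t *\<^sub>R h \<in> {x. k \<cdot> x = x \<cdot> k}"
        using comm by (simp add: op_times.scaleR_left op_times.scaleR_right)
    next
      fix x y assume "x \<in> {x. k \<cdot> x = x \<cdot> k}" "y \<in> {x. k \<cdot> x = x \<cdot> k}"
      then show "x - y \<in> {x. k \<cdot> x = x \<cdot> k}"
        by (simp add: op_times.diff_left op_times.diff_right)
    next
      fix x y assume xy: "x \<in> {x. k \<cdot> x = x \<cdot> k}" "y \<in> {x. k \<cdot> x = x \<cdot> k}"
      then show "x \<cdot> y \<in> {x. k \<cdot> x = x \<cdot> k}"
        by simp (metis op_times_assoc)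
    qed
    then show ?thesis by simp
  qed
  have "0 \<le> inner (k (t *\<^sub>R h x)) x" for x
  proof (rule nonneg_from_remainder)
    fix n :: nat
    have "t *\<^sub>R h x = (\<Sum>i<n. g i (g i x)) + g n x"
      using arg_cong[OF square_remainder_sum[of "t *\<^sub>R h" n], of "\<lambda>z. blinfun_apply z x"]
      by (simp add: g_def op_simps blinfun.sum_left)
    then have "inner (k (t *\<^sub>R h x)) x = (\<Sum>i<n. inner (k (g i (g i x))) x) + inner (k (g n x)) x"
      by (simp only: blinfun.add_right blinfun.sum_right inner_add_left inner_sum_left)
    moreover have "inner (k (g i (g i x))) x = inner (k (g i x)) (g i x)" for i
      using arg_cong[OF gk[of i], of "\<lambda>z. blinfun_apply z (g i x)"]
      by (simp add: hermitian_inner[OF gh])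
    ultimately have "inner (k (t *\<^sub>R h x)) x = (\<Sum>i<n. inner (k (g i x)) (g i x)) + inner (k (g n x)) x"
      by simp
    moreover have "(\<Sum>i<n. inner (k (g i x)) (g i x)) \<ge> 0"
      by (intro sum_nonneg positive_inner k)
    moreover have "inner (k (g n x)) x \<ge> - (norm k * (norm x)\<^sup>2) / real (n + 2)"
    proof -
      have "\<bar>inner (k (g n x)) x\<bar> \<le> norm (k (g n x)) * norm x" by (rule Cauchy_Schwarz_ineq2)
      also have "\<dots> \<le> (norm k * (norm (g n) * norm x)) * norm x"
        by (intro mult_right_mono order_trans[OF norm_blinfun] mult_left_mono norm_blinfun) auto
      also have "\<dots> \<le> (norm k * (1 / real (n + 2) * norm x)) * norm x"
        unfolding g_def
        by (intro mult_right_mono mult_left_mono norm_square_remainder_le t) auto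
      finally have "\<bar>inner (k (g n x)) x\<bar> \<le> (norm k * (norm x)\<^sup>2) / real (n + 2)"
        by (simp add: power2_eq_square)
      then show ?thesis by linarith
    qed
    ultimately show "- (norm k * (norm x)\<^sup>2) / real (n + 2) \<le> inner (k (t *\<^sub>R h x)) x" by linarith
  qed
  then have "0 \<le> inner (k (h x)) x" for x
    using t(1) by (simp add: op_simps zero_le_mult_iff)
  moreover have "hermitian (h \<cdot> k)"
    using h k comm by (simp add: positive_op_iff hermitian_def adj_simps)
  moreover have "(h \<cdot> k) x = k (h x)" for x by (simp add: comm)
  ultimately show ?thesis by (simp add: positive_op_iff)
qed

lemma hermitian_lower_bound:
  assumes "hermitian h"
  shows "positive_op (norm h *\<^sub>R \<one> + h)"
proof -
  have "hermitian (- h)" using hermitian_closed(3)[OF assms, of "-1"] by simp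
  then show ?thesis using positive_norm_minus[of "- h" "norm h"] by simp
qed

text \<open>Moves operator norm bounds into the order, which conditional expectations preserve and
  in which perturbations of a contraction can be computed algebraically.\<close>

lemma norm_le_iff_positive:
  assumes "b \<in> bounded_operators" "c \<ge> 0"
  shows "norm b \<le> c \<longleftrightarrow> positive_op (c\<^sup>2 *\<^sub>R \<one> - b\<^sup>\<dagger> \<cdot> b)"
proof -
  have herm: "hermitian (c\<^sup>2 *\<^sub>R \<one> - b\<^sup>\<dagger> \<cdot> b)"
    using positive_hermitian[OF positive_adj_times[OF assms(1)]] by (simp add: hermitian_closed)
  have "inner ((b\<^sup>\<dagger> \<cdot> b) x) x = (norm (b x))\<^sup>2" for x
    using inner_adj[OF adj_bounded[OF assms(1)], of "b x" x] assms
    by (simp add: adj_simps power2_norm_eq_inner)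
  then have eq: "inner ((c\<^sup>2 *\<^sub>R \<one> - b\<^sup>\<dagger> \<cdot> b) x) x = (c * norm x)\<^sup>2 - (norm (b x))\<^sup>2" for x
    by (simp add: op_simps inner_diff_left power_mult_distrib power2_norm_eq_inner)
  have "positive_op (c\<^sup>2 *\<^sub>R \<one> - b\<^sup>\<dagger> \<cdot> b) \<longleftrightarrow> (\<forall>x. (norm (b x))\<^sup>2 \<le> (c * norm x)\<^sup>2)"
    by (simp add: positive_op_iff herm eq)
  also have "\<dots> \<longleftrightarrow> (\<forall>x. norm (b x) \<le> c * norm x)"
    using assms(2) by (simp add: power2_le_iff_abs_le)
  also have "\<dots> \<longleftrightarrow> norm b \<le> c"
  proof
    assume "norm b \<le> c"
    then show "\<forall>x. norm (b x) \<le> c * norm x"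
      by (meson mult_right_mono norm_blinfun norm_ge_zero order_trans)
  qed (use assms norm_blinfun_bound in blast)
  finally show ?thesis by simp
qed

section \<open>Von Neumann algebras and factors\<close>

lemma commutant_closed:
  fixes S :: "'h::complex_hilbert_space op set"
  shows "x \<in> commutant S \<Longrightarrow> y \<in> commutant S \<Longrightarrow> x + y \<in> commutant S"
    "x \<in> commutant S \<Longrightarrow> y \<in> commutant S \<Longrightarrow> x - y \<in> commutant S"
    "x \<in> commutant S \<Longrightarrow> y \<in> commutant S \<Longrightarrow> x \<cdot> y \<in> commutant S"
    "x \<in> commutant S \<Longrightarrow> r *\<^sub>R x \<in> commutant S"
    "0 \<in> commutant S" "\<one> \<in> commutant S"
  by (auto simp: commutant_def bounded_operators_closed op_times.add_left op_times.add_right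
      op_times.diff_left op_times.diff_right op_times.scaleR_left op_times.scaleR_right)
    (metis op_times_assoc)

lemma commutant_scaleC:
  assumes "S \<subseteq> bounded_operators" "x \<in> commutant S"
  shows "scaleC_op c x \<in> commutant S"
proof -
  have "scaleC_op c x \<cdot> y = y \<cdot> scaleC_op c x" if "y \<in> S" for y
  proof (rule blinfun_eqI)
    fix \<xi>
    have y: "y \<in> bounded_operators" using that assms by auto
    have "x \<cdot> y = y \<cdot> x" using that assms by (simp add: commutant_def)
    then have "x (y \<xi>) = y (x \<xi>)" by (metis blinfun_apply_blinfun_compose)
    then show "(scaleC_op c x \<cdot> y) \<xi> = (y \<cdot> scaleC_op c x) \<xi>"
      by (simp add: scaleC_op_apply bounded_operatorsD[OF y])
  qed
  then show ?thesis using assms by (simp add: commutant_def bounded_operators_closed)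
qed

lemma commutant_adj:
  assumes "S \<subseteq> bounded_operators" "\<And>s. s \<in> S \<Longrightarrow> s\<^sup>\<dagger> \<in> S" "x \<in> commutant S"
  shows "x\<^sup>\<dagger> \<in> commutant S"
proof -
  have x: "x \<in> bounded_operators" using assms by (simp add: commutant_def)
  have "x\<^sup>\<dagger> \<cdot> s = s \<cdot> x\<^sup>\<dagger>" if s: "s \<in> S" for s
  proof -
    have sb: "s \<in> bounded_operators" using s assms(1) by auto
    have "x \<cdot> s\<^sup>\<dagger> = s\<^sup>\<dagger> \<cdot> x" using assms s by (simp add: commutant_def)
    then have "(x \<cdot> s\<^sup>\<dagger>)\<^sup>\<dagger> = (s\<^sup>\<dagger> \<cdot> x)\<^sup>\<dagger>" by simp
    then show ?thesis using x sb by (simp add: adj_times adj_adj adj_bounded)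
  qed
  then show ?thesis using x by (simp add: commutant_def adj_bounded)
qed

lemma commutant_strong_limit:
  assumes X: "\<And>n. X n \<in> commutant S"
    and lim: "\<And>\<xi>. (\<lambda>n. blinfun_apply (X n) \<xi>) \<longlonglongrightarrow> blinfun_apply x \<xi>"
  shows "x \<in> commutant S"
proof -
  have "x (c *\<^sub>C \<xi>) = c *\<^sub>C x \<xi>" for c \<xi>
  proof (rule LIMSEQ_unique[OF lim])
    have "bounded_linear (\<lambda>v::'a. c *\<^sub>C v)"
      by (rule bounded_linear_intro[where K = "cmod c"])
        (simp_all add: scaleC_add_right norm_scaleC scaleC_scaleR)
    then have "(\<lambda>n. c *\<^sub>C X n \<xi>) \<longlonglongrightarrow> c *\<^sub>C x \<xi>"
      using lim by (rule bounded_linear.tendsto)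
    moreover have "X n (c *\<^sub>C \<xi>) = c *\<^sub>C X n \<xi>" for n
      using X by (simp add: commutant_def bounded_operatorsD)
    ultimately show "(\<lambda>n. X n (c *\<^sub>C \<xi>)) \<longlonglongrightarrow> c *\<^sub>C x \<xi>" by simp
  qed
  moreover have "x \<cdot> s = s \<cdot> x" if "s \<in> S" for s
  proof (rule blinfun_eqI, rule LIMSEQ_unique)
    fix \<xi>
    show "(\<lambda>n. X n (s \<xi>)) \<longlonglongrightarrow> (x \<cdot> s) \<xi>" using lim by simp
    have "(\<lambda>n. s (X n \<xi>)) \<longlonglongrightarrow> s (x \<xi>)"
      using blinfun.bounded_linear_right lim by (rule bounded_linear.tendsto)
    moreover have "s (X n \<xi>) = X n (s \<xi>)" for n
      using X that by (simp add: commutant_def) (metis blinfun_apply_blinfun_compose)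
    ultimately show "(\<lambda>n. X n (s \<xi>)) \<longlonglongrightarrow> (s \<cdot> x) \<xi>" by simp
  qed
  ultimately show ?thesis by (simp add: commutant_def bounded_operators_def)
qed

section \<open>Strong limits of norm-bounded sequences\<close>

lemma strong_limit_exists:
  fixes X :: "nat \<Rightarrow> 'h::complex_hilbert_space op"
  assumes bd: "\<And>n. norm (X n) \<le> R"
    and C: "\<And>\<xi>. Cauchy (\<lambda>n. blinfun_apply (X n) \<xi>)"
  obtains x where "norm x \<le> R"
    and "\<And>\<xi>. (\<lambda>n. blinfun_apply (X n) \<xi>) \<longlonglongrightarrow> blinfun_apply x \<xi>"
proof -
  have R: "0 \<le> R" using bd[of 0] norm_ge_zero order_trans by blast
  have "\<exists>l. (\<lambda>n. X n \<xi>) \<longlonglongrightarrow> l" for \<xi>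
    using C Cauchy_convergent_iff convergent_def by blast
  then obtain s where s: "\<And>\<xi>. (\<lambda>n. X n \<xi>) \<longlonglongrightarrow> s \<xi>" by metis
  have nb: "norm (s \<xi>) \<le> R * norm \<xi>" for \<xi>
  proof (rule LIMSEQ_le_const2[OF tendsto_norm[OF s]])
    show "\<exists>N. \<forall>n\<ge>N. norm (X n \<xi>) \<le> R * norm \<xi>"
      using bd by (meson mult_right_mono norm_blinfun norm_ge_zero order_trans)
  qed
  have "bounded_linear s"
  proof (rule bounded_linear_intro[where K = R])
    fix a b :: 'h and r :: real
    have "(\<lambda>n. X n (a + b)) \<longlonglongrightarrow> s a + s b"
      by (simp add: blinfun.add_right) (intro tendsto_add s)
    then show "s (a + b) = s a + s b" using s LIMSEQ_unique by blast
    have "(\<lambda>n. X n (r *\<^sub>R a)) \<longlonglongrightarrow> r *\<^sub>R s a"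
      by (simp add: blinfun.scaleR_right) (intro tendsto_scaleR tendsto_const s)
    then show "s (r *\<^sub>R a) = r *\<^sub>R s a" using s LIMSEQ_unique by blast
    show "norm (s a) \<le> norm a * R" using nb by (simp add: mult.commute)
  qed
  then have app: "Blinfun s \<xi> = s \<xi>" for \<xi> by (simp add: bounded_linear_Blinfun_apply)
  show ?thesis
  proof (rule that)
    show "norm (Blinfun s) \<le> R" by (rule norm_blinfun_bound) (simp_all add: R app nb)
  qed (simp add: app s)
qed

text \<open>An e/3 argument: the uniform bound \<open>R\<close> controls the change from a vector to
  a nearby one. It is applied to a dense set of vectors.\<close>

lemma Cauchy_on_closure:
  fixes X :: "nat \<Rightarrow> 'h::complex_hilbert_space op"
  assumes bd: "\<And>n. norm (X n) \<le> R"
    and C: "\<And>\<xi>. \<xi> \<in> S \<Longrightarrow> Cauchy (\<lambda>n. blinfun_apply (X n) \<xi>)"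
    and \<xi>: "\<xi> \<in> closure S"
  shows "Cauchy (\<lambda>n. blinfun_apply (X n) \<xi>)"
proof (rule metric_CauchyI)
  fix e :: real assume e: "e > 0"
  have R: "0 \<le> R" using bd[of 0] norm_ge_zero order_trans by blast
  obtain \<eta> where \<eta>: "\<eta> \<in> S" "dist \<eta> \<xi> < e / (3 * (R + 1))"
    using \<xi> e R by (metis closure_approachable divide_pos_pos add_nonneg_pos zero_less_one
        mult_pos_pos zero_less_numeral)
  have near: "dist (X n \<xi>) (X n \<eta>) < e / 3" for n
  proof -
    have "dist (X n \<xi>) (X n \<eta>) = norm (X n (\<xi> - \<eta>))" by (simp add: dist_norm blinfun.diff_right)
    also have "\<dots> \<le> R * norm (\<xi> - \<eta>)"
      using bd by (meson mult_right_mono norm_blinfun norm_ge_zero order_trans)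
    also have "\<dots> \<le> (R + 1) * dist \<eta> \<xi>" by (simp add: dist_norm norm_minus_commute mult_right_mono)
    also have "\<dots> < (R + 1) * (e / (3 * (R + 1)))"
      using \<eta>(2) R by (intro mult_strict_left_mono) auto
    also have "\<dots> = e / 3" using R by (simp add: field_simps)
    finally show ?thesis .
  qed
  obtain N where N: "\<And>m n. m \<ge> N \<Longrightarrow> n \<ge> N \<Longrightarrow> dist (X m \<eta>) (X n \<eta>) < e / 3"
    using metric_CauchyD[OF C[OF \<eta>(1)], of "e/3"] e by auto
  have "dist (X m \<xi>) (X n \<xi>) < e" if "m \<ge> N" "n \<ge> N" for m n
  proof -
    have "dist (X m \<xi>) (X n \<xi>) \<le> dist (X m \<xi>) (X m \<eta>) + dist (X m \<eta>) (X n \<xi>)"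
      by (rule dist_triangle)
    also have "dist (X m \<eta>) (X n \<xi>) \<le> dist (X m \<eta>) (X n \<eta>) + dist (X n \<eta>) (X n \<xi>)"
      by (rule dist_triangle)
    finally show ?thesis
      using near[of m] near[of n] N[OF that] by (simp add: dist_commute)
  qed
  then show "\<exists>M. \<forall>m\<ge>M. \<forall>n\<ge>M. dist (X m \<xi>) (X n \<xi>) < e" by blast
qed

locale von_neumann =
  fixes M :: "'h::complex_hilbert_space op set"
  assumes vN: "von_neumann_algebra M"
begin

lemma in_bounded: "x \<in> M \<Longrightarrow> x \<in> bounded_operators"
  and adj_in: "x \<in> M \<Longrightarrow> x\<^sup>\<dagger> \<in> M"
  and bicommutant: "commutant (commutant M) = M"
  using vN by (auto simp: von_neumann_algebra_def)

lemma commutant_bounded: "commutant M \<subseteq> bounded_operators"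
  by (auto simp: commutant_def)

lemma add_in: "x \<in> M \<Longrightarrow> y \<in> M \<Longrightarrow> x + y \<in> M"
  and diff_in: "x \<in> M \<Longrightarrow> y \<in> M \<Longrightarrow> x - y \<in> M"
  and times_in: "x \<in> M \<Longrightarrow> y \<in> M \<Longrightarrow> x \<cdot> y \<in> M"
  and scaleR_in: "x \<in> M \<Longrightarrow> r *\<^sub>R x \<in> M"
  and zero_in: "0 \<in> M"
  and one_in: "\<one> \<in> M"
  using commutant_closed[where S = "commutant M"] bicommutant by auto

lemma scaleC_in: "x \<in> M \<Longrightarrow> scaleC_op c x \<in> M"
  using commutant_scaleC[OF commutant_bounded] bicommutant by auto

lemma strong_limit_in:
  assumes "\<And>n. X n \<in> M"
    and "\<And>\<xi>. (\<lambda>n. blinfun_apply (X n) \<xi>) \<longlonglongrightarrow> blinfun_apply x \<xi>"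
  shows "x \<in> M"
  using commutant_strong_limit[of X "commutant M" x] assms bicommutant by auto

lemmas closed_in = adj_in add_in diff_in times_in scaleR_in zero_in one_in scaleC_in

lemma commutant_adj_in: "x \<in> commutant M \<Longrightarrow> x\<^sup>\<dagger> \<in> commutant M"
  using commutant_adj[of M x] in_bounded adj_in by auto

end

locale vn_factor = von_neumann +
  assumes center: "M \<inter> commutant M = range (\<lambda>c. scaleC_op c \<one>)"
begin

text \<open>The projection onto such a subspace is central.\<close>

lemma invariant_subspace_trivial:
  assumes L: "subspace L" "closed L"
    and inv: "\<And>x \<xi>. x \<in> M \<union> commutant M \<Longrightarrow> \<xi> \<in> L \<Longrightarrow> blinfun_apply x \<xi> \<in> L"
  shows "L = {0} \<or> L = UNIV"
proof -
  have "\<exists>z\<in>L. \<forall>y\<in>L. inner \<xi> y = inner z y" for \<xi>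
    using riesz_on_subspace[OF L bounded_linear_inner_right] by metis
  then obtain z where z: "\<And>\<xi>. z \<xi> \<in> L" "\<And>\<xi> y. y \<in> L \<Longrightarrow> inner \<xi> y = inner (z \<xi>) y"
    by metis
  have zeq: "z \<xi> = a" if "a \<in> L" "\<And>y. y \<in> L \<Longrightarrow> inner \<xi> y = inner a y" for \<xi> a
  proof -
    have d: "z \<xi> - a \<in> L" using L(1) z(1) that(1) by (simp add: subspace_diff)
    have "inner (z \<xi> - a) (z \<xi> - a) = 0"
      using z(2)[OF d, of \<xi>] that(2)[OF d] by (simp add: inner_diff_left)
    then show ?thesis by simp
  qed
  have bl: "bounded_linear z"
  proof (rule bounded_linear_intro[where K = 1])
    fix a b :: 'a and r :: real
    show "z (a + b) = z a + z b"
      by (rule zeq) (use L(1) z(1) in \<open>simp_all add: subspace_add inner_add_left z(2)[symmetric]\<close>)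
    show "z (r *\<^sub>R a) = r *\<^sub>R z a"
      by (rule zeq) (use L(1) z(1) in \<open>simp_all add: subspace_mul z(2)[symmetric]\<close>)
    have "norm (z a) * norm (z a) = inner a (z a)"
      using z(2)[OF z(1), of a a] power2_norm_eq_inner[of "z a"] by (simp only: power2_eq_square)
    also have "\<dots> \<le> norm (z a) * norm a" using norm_cauchy_schwarz[of a "z a"] by (simp add: mult.commute)
    finally show "norm (z a) \<le> norm a * 1" using le_of_self_mult_le[of "norm (z a)" "norm a"] by simp
  qed
  define p where "p = Blinfun z"
  have p: "p \<xi> = z \<xi>" for \<xi> using bl by (simp add: p_def bounded_linear_Blinfun_apply)
  have comm: "z (x \<xi>) = x (z \<xi>)" if x: "x \<in> M \<union> commutant M" for x \<xi>
  proof (rule zeq)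
    show "x (z \<xi>) \<in> L" using inv x z by auto
    fix y assume y: "y \<in> L"
    have xb: "x \<in> bounded_operators" using x in_bounded commutant_bounded by auto
    have "x\<^sup>\<dagger> \<in> M \<union> commutant M" using x adj_in commutant_adj_in by auto
    then have "(x\<^sup>\<dagger>) y \<in> L" using inv y by auto
    then show "inner (x \<xi>) y = inner (x (z \<xi>)) y"
      by (simp add: inner_adj[OF xb] z(2)[symmetric])
  qed
  \<comment> \<open>\<open>L\<close> is only a real subspace, so complex linearity of its projection
    is not automatic; it follows from commuting with the scalars, which belong to
    \<open>M\<close>.\<close>
  have pb: "p \<in> bounded_operators"
  proof -
    have "z (c *\<^sub>C \<xi>) = c *\<^sub>C z \<xi>" for c \<xi>
      using comm[of "scaleC_op c \<one>" \<xi>] scaleC_in[OF one_in] by (simp add: scaleC_op_apply)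
    then show ?thesis by (simp add: bounded_operators_def p)
  qed
  have "p \<cdot> x = x \<cdot> p" if "x \<in> M \<union> commutant M" for x
    using comm[OF that] by (intro blinfun_eqI) (simp add: p)
  then have "p \<in> commutant M" "p \<in> commutant (commutant M)"
    using pb by (auto simp: commutant_def)
  then have "p \<in> range (\<lambda>c. scaleC_op c \<one>)" using center bicommutant by auto
  then obtain c where c: "p = scaleC_op c \<one>" by auto
  have id: "z y = y" if "y \<in> L" for y using that by (intro zeq) auto
  have zc: "z \<xi> = c *\<^sub>C \<xi>" for \<xi> by (metis c p scaleC_op_apply blinfun_apply_id_blinfun)
  show ?thesis
  proof (cases "c = 0")
    case True
    have "z \<xi> = 0" for \<xi>
      using zc[of \<xi>] True scaleC_of_real[of 0 \<xi>] by simp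
    then show ?thesis using id subspace_0[OF L(1)] by auto
  next
    case False
    have "\<xi> \<in> L" for \<xi>
    proof -
      have "z ((1/c) *\<^sub>C \<xi>) = \<xi>" using False by (simp add: zc scaleC_scaleC)
      then show ?thesis using z(1) by metis
    qed
    then show ?thesis by auto
  qed
qed

text \<open>The vectors killed by all \<open>a \<cdot> x\<close> with x in \<open>M\<close> form a
  closed subspace invariant under \<open>M\<close> and its commutant. If it is 0, then b = 0,
  because the range of b lies in it; if it is everything, then a = 0. This takes the place of
  comparison theory for projections.\<close>

lemma factor_prime:
  assumes a: "a \<in> M" and b: "b \<in> M" and 0: "\<And>x. x \<in> M \<Longrightarrow> a \<cdot> x \<cdot> b = 0"
  shows "a = 0 \<or> b = 0"
proof -
  define L where "L = {\<zeta>. \<forall>x\<in>M. a (x \<zeta>) = 0}"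
  have "subspace L"
    by (auto simp: L_def subspace_def blinfun.bilinear_simps)
  moreover have "closed L"
  proof -
    have "L = (\<Inter>x\<in>M. {\<zeta>. (a \<cdot> x) \<zeta> = 0})" by (auto simp: L_def)
    moreover have "closed {\<zeta>. (a \<cdot> x) \<zeta> = 0}" for x
      by (intro closed_Collect_eq continuous_intros)
    ultimately show ?thesis by auto
  qed
  moreover have "y \<zeta> \<in> L" if y: "y \<in> M \<union> commutant M" and \<zeta>: "\<zeta> \<in> L" for y \<zeta>
  proof -
    have "a (x (y \<zeta>)) = 0" if x: "x \<in> M" for x
    proof (cases "y \<in> M")
      case True
      then have "x \<cdot> y \<in> M" using x times_in by auto
      then have "a ((x \<cdot> y) \<zeta>) = 0" using \<zeta> unfolding L_def by blast
      then show ?thesis by simp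
    next
      case False
      then have "y \<cdot> (a \<cdot> x) = (a \<cdot> x) \<cdot> y"
        using y times_in[OF a x] by (simp add: commutant_def)
      then have "a (x (y \<zeta>)) = y (a (x \<zeta>))" by (metis blinfun_apply_blinfun_compose)
      then show ?thesis using \<zeta> x by (simp add: L_def)
    qed
    then show ?thesis by (simp add: L_def)
  qed
  ultimately consider "L = {0}" | "L = UNIV" using invariant_subspace_trivial by metis
  then show ?thesis
  proof cases
    case 1
    have "b \<xi> \<in> L" for \<xi>
      using 0 by (auto simp: L_def) (metis blinfun_apply_blinfun_compose zero_blinfun.rep_eq)
    then have "b = 0" using 1 by (intro blinfun_eqI) auto
    then show ?thesis ..
  next
    case 2
    then have "a (\<one> \<zeta>) = 0" for \<zeta> unfolding L_def using one_in by blast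
    then have "a = 0" by (intro blinfun_eqI) simp
    then show ?thesis ..
  qed
qed

end

section \<open>Semi-inner products\<close>

text \<open>The case c = 0 is genuine, since the forms may be degenerate: the expression is then
  affine in t, and for b nonzero the chosen t gives it the value -1.\<close>

lemma discriminant_le:
  fixes a b c :: real
  assumes "\<And>t. 0 \<le> a + 2 * t * b + t\<^sup>2 * c" and c: "0 \<le> c"
  shows "b\<^sup>2 \<le> a * c"
proof (cases "c = 0")
  case True
  have "b = 0"
  proof (rule ccontr)
    assume b: "b \<noteq> 0"
    have "0 \<le> a + 2 * (- (a + 1) / (2 * b)) * b + (- (a + 1) / (2 * b))\<^sup>2 * c" by (rule assms)
    then show False using b True by (simp add: field_simps)
  qed
  then show ?thesis using True by simp
next
  case False
  have "0 \<le> a + 2 * (- b / c) * b + (- b / c)\<^sup>2 * c" by (rule assms)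
  also have "\<dots> = a - b\<^sup>2 / c" using False by (simp add: power2_eq_square)
  finally have "b\<^sup>2 / c \<le> a" by simp
  then show ?thesis using False c by (simp add: pos_divide_le_eq)
qed

text \<open>Covers two forms: the trace form on \<open>M\<close>, and the possibly degenerate form
  that a square-summable family of vectors defines on all operators. Real parts suffice for the
  convexity arguments.\<close>

locale semi_inner =
  fixes V :: "'a::real_vector set" and B :: "'a \<Rightarrow> 'a \<Rightarrow> real"
  assumes subspace_V: "subspace V"
    and B_sym: "x \<in> V \<Longrightarrow> y \<in> V \<Longrightarrow> B x y = B y x"
    and B_add_left: "x \<in> V \<Longrightarrow> y \<in> V \<Longrightarrow> z \<in> V \<Longrightarrow> B (x + y) z = B x z + B y z"
    and B_scale_left: "x \<in> V \<Longrightarrow> z \<in> V \<Longrightarrow> B (r *\<^sub>R x) z = r * B x z"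
    and B_nonneg: "x \<in> V \<Longrightarrow> 0 \<le> B x x"
begin

abbreviation nrm :: "'a \<Rightarrow> real" where "nrm x \<equiv> sqrt (B x x)"

lemma V_closed:
  "x \<in> V \<Longrightarrow> y \<in> V \<Longrightarrow> x + y \<in> V" "x \<in> V \<Longrightarrow> y \<in> V \<Longrightarrow> x - y \<in> V"
  "x \<in> V \<Longrightarrow> r *\<^sub>R x \<in> V" "0 \<in> V"
  using subspace_V by (auto simp: subspace_add subspace_diff subspace_mul subspace_0)

lemma B_add_right: "x \<in> V \<Longrightarrow> y \<in> V \<Longrightarrow> z \<in> V \<Longrightarrow> B z (x + y) = B z x + B z y"
  by (metis B_add_left B_sym V_closed(1))

lemma B_scale_right: "x \<in> V \<Longrightarrow> z \<in> V \<Longrightarrow> B z (r *\<^sub>R x) = r * B z x"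
  by (metis B_scale_left B_sym V_closed(3))

lemma B_diff_left: "x \<in> V \<Longrightarrow> y \<in> V \<Longrightarrow> z \<in> V \<Longrightarrow> B (x - y) z = B x z - B y z"
  using B_add_left[of x "- 1 *\<^sub>R y" z] B_scale_left[of y z "-1"] V_closed(3)[of y "-1"] by simp

lemma B_diff_right: "x \<in> V \<Longrightarrow> y \<in> V \<Longrightarrow> z \<in> V \<Longrightarrow> B z (x - y) = B z x - B z y"
  by (metis B_diff_left B_sym V_closed(2))

lemmas B_simps = B_add_left B_add_right B_scale_left B_scale_right B_diff_left B_diff_right V_closed

lemma B_square_add:
  "x \<in> V \<Longrightarrow> y \<in> V \<Longrightarrow> B (x + t *\<^sub>R y) (x + t *\<^sub>R y) = B x x + 2 * t * B x y + t\<^sup>2 * B y y"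
  using B_sym[of x y] by (simp add: B_simps power2_eq_square algebra_simps)

lemma Cauchy_Schwarz:
  assumes "x \<in> V" "y \<in> V"
  shows "\<bar>B x y\<bar> \<le> nrm x * nrm y"
proof -
  have "(B x y)\<^sup>2 \<le> B x x * B y y"
    using B_nonneg[OF V_closed(1)[OF assms(1) V_closed(3)[OF assms(2)]]]
    by (intro discriminant_le) (simp_all add: B_square_add assms B_nonneg)
  then show ?thesis
    by (metis real_sqrt_abs real_sqrt_le_mono real_sqrt_mult)
qed

lemma nrm_triangle:
  assumes "x \<in> V" "y \<in> V"
  shows "nrm (x + y) \<le> nrm x + nrm y"
proof -
  have "B (x + y) (x + y) = B x x + 2 * B x y + B y y"
    using B_square_add[OF assms, of 1] by simp
  also have "\<dots> \<le> (nrm x)\<^sup>2 + 2 * (nrm x * nrm y) + (nrm y)\<^sup>2"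
    using Cauchy_Schwarz[OF assms] assms by (simp add: B_nonneg)
  also have "\<dots> = (nrm x + nrm y)\<^sup>2" by (simp add: power2_sum)
  finally show ?thesis
    using assms by (intro real_le_lsqrt) (auto simp: B_nonneg)
qed

lemma nrm_minus_commute: "x \<in> V \<Longrightarrow> y \<in> V \<Longrightarrow> B (x - y) (x - y) = B (y - x) (y - x)"
  by (simp add: B_simps)

lemma nrm_triangle_diff:
  assumes "x \<in> V" "y \<in> V"
  shows "nrm (x - y) \<le> nrm x + nrm y"
  using nrm_triangle[OF assms(1) V_closed(3)[OF assms(2)], of "-1"] B_scale_left[of y _ "-1"]
    B_scale_right[of y _ "-1"] V_closed(3)[OF assms(2), of "-1"] assms(2) by simp

text \<open>The parallelogram law centred at \<open>c\<close>; it supplies the convexity hypothesis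
  of \<open>minimizing_sequence\<close> for both forms.\<close>

lemma B_midpoint:
  assumes "x \<in> V" "y \<in> V" "c \<in> V"
  shows "B ((1/2) *\<^sub>R (x + y) - c) ((1/2) *\<^sub>R (x + y) - c) =
    (B (x - c) (x - c) + B (y - c) (y - c)) / 2 - B (x - y) (x - y) / 4"
  using B_sym[OF assms(1,2)] B_sym[OF assms(1,3)] B_sym[OF assms(2,3)] assms
  by (simp add: B_simps field_simps)

lemma B_parallelogram:
  assumes "x \<in> V" "y \<in> V"
  shows "B (x + y) (x + y) + B (x - y) (x - y) = 2 * B x x + 2 * B y y"
  using B_sym[OF assms] assms by (simp add: B_simps field_simps)

lemma nrm_tendsto:
  assumes X: "\<And>n. X n \<in> V" and v: "v \<in> V" and lim: "(\<lambda>n. nrm (X n - v)) \<longlonglongrightarrow> 0" and a: "a \<in> V"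
  shows "(\<lambda>n. B (X n - a) (X n - a)) \<longlonglongrightarrow> B (v - a) (v - a)"
proof -
  have b: "\<bar>nrm (X n - a) - nrm (v - a)\<bar> \<le> nrm (X n - v)" for n
    using nrm_triangle[of "X n - v" "v - a"] nrm_triangle[of "v - X n" "X n - a"]
      nrm_minus_commute[of v "X n"] X v a by (simp add: V_closed)
  have "(\<lambda>n. nrm (X n - a) - nrm (v - a)) \<longlonglongrightarrow> 0"
    by (rule Lim_null_comparison[OF _ lim]) (use b in auto)
  then have "(\<lambda>n. nrm (X n - a)) \<longlonglongrightarrow> nrm (v - a)" by (rule LIM_zero_cancel)
  then have "(\<lambda>n. (nrm (X n - a))\<^sup>2) \<longlonglongrightarrow> (nrm (v - a))\<^sup>2" by (rule tendsto_power)
  then show ?thesis using X v a by (simp add: B_nonneg V_closed)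
qed

end

section \<open>The trace\<close>

locale tracial_factor = vn_factor M for M :: "'h::complex_hilbert_space op set" +
  fixes \<tau> :: "'h op \<Rightarrow> complex"
  assumes trace: "normalized_trace M \<tau>"
begin

lemma trace_add: "x \<in> M \<Longrightarrow> y \<in> M \<Longrightarrow> \<tau> (x + y) = \<tau> x + \<tau> y"
  and trace_scaleC: "x \<in> M \<Longrightarrow> \<tau> (scaleC_op c x) = c * \<tau> x"
  and trace_one: "\<tau> \<one> = 1"
  and trace_square: "x \<in> M \<Longrightarrow> \<tau> (x\<^sup>\<dagger> \<cdot> x) \<in> \<real>\<^sub>\<ge>\<^sub>0"
  and trace_faithful: "x \<in> M \<Longrightarrow> \<tau> (x\<^sup>\<dagger> \<cdot> x) = 0 \<Longrightarrow> x = 0"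
  and trace_commute: "x \<in> M \<Longrightarrow> y \<in> M \<Longrightarrow> \<tau> (x \<cdot> y) = \<tau> (y \<cdot> x)"
  using trace by (auto simp: normalized_trace_def linear_functional_on_def)

lemma trace_scaleR: "x \<in> M \<Longrightarrow> \<tau> (r *\<^sub>R x) = r * \<tau> x"
  by (metis scaleC_op_of_real trace_scaleC)

lemma trace_zero: "\<tau> 0 = 0"
  using trace_scaleR[OF zero_in, of 0] by simp

lemma trace_diff: "x \<in> M \<Longrightarrow> y \<in> M \<Longrightarrow> \<tau> (x - y) = \<tau> x - \<tau> y"
  using trace_add[of x "- 1 *\<^sub>R y"] trace_scaleR[of y "-1"] scaleR_in[of y "-1"] by simp

lemma trace_sum: "(\<And>i. i \<in> I \<Longrightarrow> f i \<in> M) \<Longrightarrow> \<tau> (sum f I) = (\<Sum>i\<in>I. \<tau> (f i)) \<and> sum f I \<in> M"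
proof (induction I rule: infinite_finite_induct)
  case (insert x F)
  then show ?case by (simp add: trace_add add_in)
qed (simp_all add: trace_zero zero_in)

lemmas trace_simps = trace_add trace_diff trace_scaleR trace_scaleC trace_one trace_zero closed_in

text \<open>Positivity is given only on elements \<open>x\<^sup>\<dagger> \<cdot> x\<close>.
  Expanding it at 1 + y shows that the traces of y and its adjoint have a real sum; y = x and y =
  \<open>\<i>\<close> x together give both components.\<close>

lemma trace_adj:
  assumes x: "x \<in> M"
  shows "\<tau> (x\<^sup>\<dagger>) = cnj (\<tau> x)"
proof -
  have im: "Im (\<tau> y + \<tau> (y\<^sup>\<dagger>)) = 0" if y: "y \<in> M" for y
  proof -
    note yb = in_bounded[OF y]
    have "(\<one> + y)\<^sup>\<dagger> \<cdot> (\<one> + y) = \<one> + y + (y\<^sup>\<dagger> + y\<^sup>\<dagger> \<cdot> y)"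
      using yb by (simp add: adj_simps op_times.add_left op_times.add_right algebra_simps)
    then have "\<tau> ((\<one> + y)\<^sup>\<dagger> \<cdot> (\<one> + y)) = 1 + \<tau> y + (\<tau> (y\<^sup>\<dagger>) + \<tau> (y\<^sup>\<dagger> \<cdot> y))"
      using y by (simp add: trace_simps)
    moreover have "Im (\<tau> ((\<one> + y)\<^sup>\<dagger> \<cdot> (\<one> + y))) = 0" "Im (\<tau> (y\<^sup>\<dagger> \<cdot> y)) = 0"
      using trace_square[of "\<one> + y"] trace_square[of y] y closed_in
      by (auto simp: complex_nonneg_Reals_iff)
    ultimately show ?thesis by simp
  qed
  have "Im (\<tau> x + \<tau> (x\<^sup>\<dagger>)) = 0" by (rule im[OF x])
  moreover have "Im (\<i> * \<tau> x - \<i> * \<tau> (x\<^sup>\<dagger>)) = 0"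
    using im[OF scaleC_in[OF x, of \<i>]] x in_bounded[OF x]
    by (simp add: trace_simps adj_scaleC)
  ultimately show ?thesis by (simp add: complex_eq_iff)
qed

definition ip :: "'h op \<Rightarrow> 'h op \<Rightarrow> real" where
  "ip x y = Re (\<tau> (y\<^sup>\<dagger> \<cdot> x))"

sublocale ip: semi_inner M ip
proof
  show "subspace M" by (simp add: subspace_def closed_in)
  fix x y assume x: "x \<in> M" and y: "y \<in> M"
  have "\<tau> ((x\<^sup>\<dagger> \<cdot> y)\<^sup>\<dagger>) = cnj (\<tau> (x\<^sup>\<dagger> \<cdot> y))" using x y by (intro trace_adj) (simp add: closed_in)
  then show "ip x y = ip y x"
    using in_bounded[OF x] in_bounded[OF y] by (simp add: ip_def adj_simps)
  show "ip (r *\<^sub>R x) y = r * ip x y" for r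
    using x y by (simp add: ip_def op_times.scaleR_right trace_simps)
  show "ip (x + y) z = ip x z + ip y z" if "z \<in> M" for z
    using x y that by (simp add: ip_def op_times.add_right trace_simps)
  show "0 \<le> ip x x"
    using trace_square[OF x] by (simp add: ip_def complex_nonneg_Reals_iff)
qed

lemma norm2_eq: "norm2 \<tau> x = sqrt (ip x x)"
  by (simp add: norm2_def ip_def)

lemma trace_adj_times: "x \<in> M \<Longrightarrow> \<tau> (x\<^sup>\<dagger> \<cdot> x) = ip x x"
  using trace_square[of x] by (simp add: ip_def complex_eq_iff complex_nonneg_Reals_iff)

lemma ip_faithful: "x \<in> M \<Longrightarrow> ip x x = 0 \<Longrightarrow> x = 0"
  using trace_faithful trace_adj_times by simp

lemma ip_adj: "x \<in> M \<Longrightarrow> ip (x\<^sup>\<dagger>) (x\<^sup>\<dagger>) = ip x x"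
  using in_bounded[of x] by (simp add: ip_def adj_adj trace_commute closed_in)

text \<open>Normality expresses \<open>\<tau>\<close> through two different families
  \<open>\<xi>\<close> and \<open>\<eta>\<close>. On \<open>x\<^sup>\<dagger> \<cdot> x\<close> the
  inequality <a, b> <= |(a + b)/2|^2 merges them into the single family of their midpoints. The
  original series also shows that \<open>\<tau>\<close> is norm continuous.\<close>

lemma dominating_vectors:
  obtains \<zeta> :: "nat \<Rightarrow> 'h" and K :: real
  where "summable (\<lambda>n. (norm (\<zeta> n))\<^sup>2)"
    and "\<And>x. x \<in> M \<Longrightarrow> ip x x \<le> (\<Sum>n. (norm (blinfun_apply x (\<zeta> n)))\<^sup>2)"
    and "\<And>x. x \<in> M \<Longrightarrow> cmod (\<tau> x) \<le> K * norm x"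
proof -
  obtain \<xi> \<eta> :: "nat \<Rightarrow> 'h" where s: "summable (\<lambda>n. (norm (\<xi> n))\<^sup>2)" "summable (\<lambda>n. (norm (\<eta> n))\<^sup>2)"
    and t: "\<And>x. x \<in> M \<Longrightarrow> (\<lambda>n. cinner (x (\<xi> n)) (\<eta> n)) sums \<tau> x"
    using trace by (auto simp: normalized_trace_def normal_on_def)
  have ss: "summable (\<lambda>n. (norm (\<xi> n))\<^sup>2 + (norm (\<eta> n))\<^sup>2)" using s by (rule summable_add)
  define \<zeta> where "\<zeta> n = (1/2) *\<^sub>R (\<xi> n + \<eta> n)" for n
  have quarter: "(norm ((1/2) *\<^sub>R (a + b)))\<^sup>2 = ((norm a)\<^sup>2 + (norm b)\<^sup>2 + 2 * inner a b) / 4" for a b :: 'h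
    by (simp only: power2_norm_eq_inner) (simp add: inner_add inner_commute[of b a] field_simps)
  have amgm: "2 * \<bar>inner a b\<bar> \<le> (norm a)\<^sup>2 + (norm b)\<^sup>2" for a b :: 'h
    using Cauchy_Schwarz_ineq2[of a b] sum_squares_bound[of "norm a" "norm b"] by linarith
  have sz: "summable (\<lambda>n. (norm (\<zeta> n))\<^sup>2)"
  proof (rule summable_comparison_test[OF _ ss], intro exI[of _ 0] allI impI)
    fix n
    show "norm ((norm (\<zeta> n))\<^sup>2) \<le> (norm (\<xi> n))\<^sup>2 + (norm (\<eta> n))\<^sup>2"
      using amgm[of "\<xi> n" "\<eta> n"] unfolding \<zeta>_def quarter by simp
  qed
  have dom: "ip x x \<le> (\<Sum>n. (norm (x (\<zeta> n)))\<^sup>2)" if x: "x \<in> M" for x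
  proof -
    have "(\<lambda>n. Re (cinner ((x\<^sup>\<dagger> \<cdot> x) (\<xi> n)) (\<eta> n))) sums ip x x"
      unfolding ip_def using x by (intro sums_Re t) (simp add: closed_in)
    moreover have "Re (cinner ((x\<^sup>\<dagger> \<cdot> x) (\<xi> n)) (\<eta> n)) = inner (x (\<xi> n)) (x (\<eta> n))" for n
      using in_bounded[OF x] by (simp add: cinner_adj' Re_cinner)
    ultimately have 1: "(\<lambda>n. inner (x (\<xi> n)) (x (\<eta> n))) sums ip x x" by simp
    have "summable (\<lambda>n. (norm (x (\<zeta> n)))\<^sup>2)"
    proof (rule summable_comparison_test[OF _ summable_mult[OF sz, of "(norm x)\<^sup>2"]],
        intro exI[of _ 0] allI impI)
      fix n
      show "norm ((norm (x (\<zeta> n)))\<^sup>2) \<le> (norm x)\<^sup>2 * (norm (\<zeta> n))\<^sup>2"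
        using norm_blinfun[of x "\<zeta> n"] by (simp add: power_mono flip: power_mult_distrib)
    qed
    moreover have "inner (x (\<xi> n)) (x (\<eta> n)) \<le> (norm (x (\<zeta> n)))\<^sup>2" for n
    proof -
      have eq: "x (\<zeta> n) = (1/2) *\<^sub>R (x (\<xi> n) + x (\<eta> n))"
        unfolding \<zeta>_def by (simp only: blinfun.add_right blinfun.scaleR_right)
      show ?thesis unfolding eq quarter
        using amgm[of "x (\<xi> n)" "x (\<eta> n)"] abs_ge_self[of "inner (x (\<xi> n)) (x (\<eta> n))"]
        by (simp add: field_simps)
    qed
    ultimately have "(\<Sum>n. inner (x (\<xi> n)) (x (\<eta> n))) \<le> (\<Sum>n. (norm (x (\<zeta> n)))\<^sup>2)"
      using sums_summable[OF 1] by (intro suminf_le)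
    then show ?thesis using sums_unique[OF 1] by simp
  qed
  define K where "K = (\<Sum>n. (norm (\<xi> n))\<^sup>2 + (norm (\<eta> n))\<^sup>2)"
  have "cmod (\<tau> x) \<le> K * norm x" if x: "x \<in> M" for x
  proof -
    have b: "norm (cinner (x (\<xi> n)) (\<eta> n)) \<le> ((norm (\<xi> n))\<^sup>2 + (norm (\<eta> n))\<^sup>2) * norm x" for n
    proof -
      have "norm (cinner (x (\<xi> n)) (\<eta> n)) \<le> norm (x (\<xi> n)) * norm (\<eta> n)" by (rule cmod_cinner_le)
      also have "\<dots> \<le> (norm x * norm (\<xi> n)) * norm (\<eta> n)" by (intro mult_right_mono norm_blinfun) simp
      also have "\<dots> = norm x * (norm (\<xi> n) * norm (\<eta> n))" by simp
      also have "\<dots> \<le> norm x * ((norm (\<xi> n))\<^sup>2 + (norm (\<eta> n))\<^sup>2)"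
        using sum_squares_bound[of "norm (\<xi> n)" "norm (\<eta> n)"]
          mult_nonneg_nonneg[OF norm_ge_zero[of "\<xi> n"] norm_ge_zero[of "\<eta> n"]]
        by (intro mult_left_mono) (linarith, simp)
      finally show ?thesis by (simp add: mult.commute)
    qed
    have "norm (\<Sum>n. cinner (x (\<xi> n)) (\<eta> n)) \<le> (\<Sum>n. ((norm (\<xi> n))\<^sup>2 + (norm (\<eta> n))\<^sup>2) * norm x)"
      by (rule norm_suminf_le[OF b summable_mult2[OF ss]])
    then show ?thesis using t[OF x] ss by (simp add: K_def sums_iff suminf_mult2)
  qed
  then show ?thesis using that sz dom by blast
qed

lemma trace_bounded:
  obtains K where "\<And>x. x \<in> M \<Longrightarrow> cmod (\<tau> x) \<le> K * norm x"
  using dominating_vectors by metis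

text \<open>\<open>y\<close> is, up to scaling, a sum of squares plus a remainder whose contribution
  vanishes by norm continuity of \<open>\<tau>\<close>. It is used for x = 1 and for positive
  x.\<close>

lemma trace_times_nonneg_if_squares:
  assumes x: "x \<in> M" and y: "y \<in> M" "positive_op y"
    and sq: "\<And>g. g \<in> M \<Longrightarrow> hermitian g \<Longrightarrow> 0 \<le> Re (\<tau> (x \<cdot> (g \<cdot> g)))"
  shows "0 \<le> Re (\<tau> (x \<cdot> y))"
proof -
  obtain t where t: "t > 0" "positive_op (t *\<^sub>R y)" "positive_op ((1/2) *\<^sub>R \<one> - t *\<^sub>R y)"
    using scaled_below_half[OF y(2)] by blast
  define g where "g = square_remainder (t *\<^sub>R y)"
  have gM: "g n \<in> M" for n
    unfolding g_def by (rule square_remainder_in) (simp_all add: closed_in y)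
  have gh: "hermitian (g n)" for n
    using square_remainder_bounds[OF t(2,3)] by (simp add: g_def positive_hermitian)
  obtain K where K: "\<And>x. x \<in> M \<Longrightarrow> cmod (\<tau> x) \<le> K * norm x" by (rule trace_bounded) (rule that)
  have K0: "K \<ge> 0" using K[OF one_in] by (simp add: trace_one) (smt (verit) mult_nonneg_nonneg mult_nonpos_nonneg norm_ge_zero)
  have "0 \<le> Re (\<tau> (x \<cdot> (t *\<^sub>R y)))"
  proof (rule nonneg_from_remainder)
    fix n :: nat
    have "x \<cdot> (t *\<^sub>R y) = (\<Sum>i<n. x \<cdot> (g i \<cdot> g i)) + x \<cdot> g n"
      using square_remainder_sum[of "t *\<^sub>R y" n]
      by (metis g_def op_times.add_right op_times.sum_right)
    then have "\<tau> (x \<cdot> (t *\<^sub>R y)) = (\<Sum>i<n. \<tau> (x \<cdot> (g i \<cdot> g i))) + \<tau> (x \<cdot> g n)"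
      using trace_sum[of "{..<n}" "\<lambda>i. x \<cdot> (g i \<cdot> g i)"] x gM by (simp add: trace_simps)
    then have "Re (\<tau> (x \<cdot> (t *\<^sub>R y))) = (\<Sum>i<n. Re (\<tau> (x \<cdot> (g i \<cdot> g i)))) + Re (\<tau> (x \<cdot> g n))"
      by simp
    moreover have "(\<Sum>i<n. Re (\<tau> (x \<cdot> (g i \<cdot> g i)))) \<ge> 0" by (intro sum_nonneg sq gM gh)
    moreover have "\<bar>Re (\<tau> (x \<cdot> g n))\<bar> \<le> K * norm x / real (n + 2)"
    proof -
      have "\<bar>Re (\<tau> (x \<cdot> g n))\<bar> \<le> cmod (\<tau> (x \<cdot> g n))" by (rule abs_Re_le_cmod)
      also have "\<dots> \<le> K * norm (x \<cdot> g n)" using x gM by (intro K) (simp add: closed_in)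
      also have "\<dots> \<le> K * (norm x * (1 / real (n + 2)))"
        unfolding g_def using K0
        by (intro mult_left_mono order_trans[OF norm_blinfun_compose] norm_square_remainder_le t) auto
      finally show ?thesis by simp
    qed
    ultimately show "- (K * norm x) / real (n + 2) \<le> Re (\<tau> (x \<cdot> (t *\<^sub>R y)))" by linarith
  qed
  then show ?thesis
    using t(1) x y by (simp add: op_times.scaleR_right trace_simps zero_le_mult_iff)
qed

lemma trace_positive:
  assumes "y \<in> M" "positive_op y"
  shows "0 \<le> Re (\<tau> y)"
proof -
  have "0 \<le> Re (\<tau> (\<one> \<cdot> y))"
  proof (rule trace_times_nonneg_if_squares)
    fix g assume "g \<in> M" "hermitian g"
    then show "0 \<le> Re (\<tau> (\<one> \<cdot> (g \<cdot> g)))"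
      using trace_square[of g] by (simp add: hermitian_def complex_nonneg_Reals_iff)
  qed (use assms closed_in in auto)
  then show ?thesis by simp
qed

text \<open>For a self-adjoint g the trace of x g g equals that of g x g, and g x g is
  positive.\<close>

lemma trace_times_positive:
  assumes "x \<in> M" "positive_op x" "y \<in> M" "positive_op y"
  shows "0 \<le> Re (\<tau> (x \<cdot> y))"
proof (rule trace_times_nonneg_if_squares)
  fix g assume g: "g \<in> M" "hermitian g"
  have "\<tau> (x \<cdot> (g \<cdot> g)) = \<tau> (g\<^sup>\<dagger> \<cdot> x \<cdot> g)"
    using g assms trace_commute[of "x \<cdot> g" g] by (simp add: hermitian_def op_times_assoc closed_in)
  moreover have "0 \<le> Re (\<tau> (g\<^sup>\<dagger> \<cdot> x \<cdot> g))"
    using g assms by (intro trace_positive positive_sandwich) (auto simp: closed_in in_bounded)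
  ultimately show "0 \<le> Re (\<tau> (x \<cdot> (g \<cdot> g)))" by simp
qed (use assms in auto)

text \<open>Left multiplication: the positive operator |x|^2 - x^* x stays positive when sandwiched
  by y. Right multiplication follows because the trace norm is invariant under adjoints, that is,
  from traciality.\<close>

lemma ip_times_le:
  assumes x: "x \<in> M" and y: "y \<in> M"
  shows "ip (x \<cdot> y) (x \<cdot> y) \<le> (norm x)\<^sup>2 * ip y y"
    and "ip (y \<cdot> x) (y \<cdot> x) \<le> (norm x)\<^sup>2 * ip y y"
proof -
  note b = in_bounded[OF x] in_bounded[OF y]
  have *: "ip (x \<cdot> y) (x \<cdot> y) \<le> (norm x)\<^sup>2 * ip y y" if x: "x \<in> M" and y: "y \<in> M" for x y
  proof -
    note b = in_bounded[OF x] in_bounded[OF y]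
    have "positive_op ((norm x)\<^sup>2 *\<^sub>R \<one> - x\<^sup>\<dagger> \<cdot> x)"
      using norm_le_iff_positive[OF b(1), of "norm x"] by simp
    then have "0 \<le> Re (\<tau> (y\<^sup>\<dagger> \<cdot> ((norm x)\<^sup>2 *\<^sub>R \<one> - x\<^sup>\<dagger> \<cdot> x) \<cdot> y))"
      using x y b by (intro trace_positive positive_sandwich) (auto simp: closed_in)
    also have "y\<^sup>\<dagger> \<cdot> ((norm x)\<^sup>2 *\<^sub>R \<one> - x\<^sup>\<dagger> \<cdot> x) \<cdot> y
        = (norm x)\<^sup>2 *\<^sub>R (y\<^sup>\<dagger> \<cdot> y) - (x \<cdot> y)\<^sup>\<dagger> \<cdot> (x \<cdot> y)"
      using b by (intro blinfun_eqI) (simp add: op_simps adj_times)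
    finally show ?thesis
      using x y by (simp add: trace_simps ip_def)
  qed
  show "ip (x \<cdot> y) (x \<cdot> y) \<le> (norm x)\<^sup>2 * ip y y" by (rule *[OF x y])
  have "ip (y \<cdot> x) (y \<cdot> x) = ip (x\<^sup>\<dagger> \<cdot> y\<^sup>\<dagger>) (x\<^sup>\<dagger> \<cdot> y\<^sup>\<dagger>)"
    using ip_adj[of "y \<cdot> x"] x y b by (simp add: closed_in adj_times)
  also have "\<dots> \<le> (norm (x\<^sup>\<dagger>))\<^sup>2 * ip (y\<^sup>\<dagger>) (y\<^sup>\<dagger>)" using x y by (intro *) (auto simp: closed_in)
  also have "\<dots> \<le> (norm x)\<^sup>2 * ip y y"
    using ip_adj[OF y] norm_adj_le[OF b(1)] ip.B_nonneg[OF y]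
    by (auto intro!: mult_right_mono power_mono)
  finally show "ip (y \<cdot> x) (y \<cdot> x) \<le> (norm x)\<^sup>2 * ip y y" .
qed

lemma norm2_le_norm: "x \<in> M \<Longrightarrow> norm2 \<tau> x \<le> norm x"
  using ip_times_le(1)[of x \<one>] one_in
  by (simp add: norm2_eq ip_def trace_one real_le_lsqrt)

end

section \<open>Completeness of the unit ball for the trace norm\<close>

definition vector_form :: "(nat \<Rightarrow> 'h::complex_hilbert_space) \<Rightarrow> 'h op \<Rightarrow> 'h op \<Rightarrow> real" where
  "vector_form \<zeta> x y = (\<Sum>n. inner (blinfun_apply x (\<zeta> n)) (blinfun_apply y (\<zeta> n)))"

locale square_summable =
  fixes \<zeta> :: "nat \<Rightarrow> 'h::complex_hilbert_space"
  assumes summable_\<zeta>: "summable (\<lambda>n. (norm (\<zeta> n))\<^sup>2)"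
begin

lemma summable_form: "summable (\<lambda>n. inner (blinfun_apply x (\<zeta> n)) (blinfun_apply y (\<zeta> n)))"
proof (rule summable_comparison_test[OF _ summable_mult[OF summable_\<zeta>, of "norm x * norm y"]],
    intro exI[of _ 0] allI impI)
  fix n
  have "norm (inner (x (\<zeta> n)) (y (\<zeta> n))) \<le> norm (x (\<zeta> n)) * norm (y (\<zeta> n))"
    using Cauchy_Schwarz_ineq2 by simp
  also have "\<dots> \<le> (norm x * norm (\<zeta> n)) * (norm y * norm (\<zeta> n))"
    by (intro mult_mono norm_blinfun) auto
  finally show "norm (inner (x (\<zeta> n)) (y (\<zeta> n))) \<le> norm x * norm y * (norm (\<zeta> n))\<^sup>2"
    by (simp add: power2_eq_square mult_ac)
qed

sublocale vf: semi_inner UNIV "vector_form \<zeta>"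
proof
  show "vector_form \<zeta> x y = vector_form \<zeta> y x" for x y
    by (simp add: vector_form_def inner_commute)
  show "vector_form \<zeta> (x + y) z = vector_form \<zeta> x z + vector_form \<zeta> y z" for x y z
    unfolding vector_form_def blinfun.add_left inner_add_left
    by (rule suminf_add[symmetric]) (rule summable_form)+
  show "vector_form \<zeta> (r *\<^sub>R x) z = r * vector_form \<zeta> x z" for r x z
    unfolding vector_form_def blinfun.scaleR_left inner_scaleR_left
    by (rule suminf_mult) (rule summable_form)
  show "0 \<le> vector_form \<zeta> x x" for x
    unfolding vector_form_def by (intro suminf_nonneg summable_form) simp
qed simp

lemma vector_form_square: "vector_form \<zeta> x x = (\<Sum>n. (norm (blinfun_apply x (\<zeta> n)))\<^sup>2)"
  by (simp add: vector_form_def power2_norm_eq_inner)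

lemma summable_square:
  fixes x :: "'h op"
  shows "summable (\<lambda>n. (norm (blinfun_apply x (\<zeta> n)))\<^sup>2)"
  using summable_form[of x x] by (simp add: power2_norm_eq_inner)

lemma norm_le_vector_form:
  fixes x :: "'h op"
  shows "norm (blinfun_apply x (\<zeta> n)) \<le> sqrt (vector_form \<zeta> x x)"
proof (rule real_le_rsqrt)
  show "(norm (x (\<zeta> n)))\<^sup>2 \<le> vector_form \<zeta> x x"
    using sum_le_suminf[OF summable_square[of x], of "{n}"] by (simp add: vector_form_square)
qed

lemma vector_form_times_le: "vector_form \<zeta> (x \<cdot> b) (x \<cdot> b) \<le> (norm x)\<^sup>2 * vector_form \<zeta> b b"
  unfolding vector_form_square suminf_mult[OF summable_square, symmetric]
proof (rule suminf_le)
  show "(norm ((x \<cdot> b) (\<zeta> n)))\<^sup>2 \<le> (norm x)\<^sup>2 * (norm (b (\<zeta> n)))\<^sup>2" for n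
    using norm_blinfun[of x "b (\<zeta> n)"] by (simp add: power_mono flip: power_mult_distrib)
qed (intro summable_square summable_mult)+

lemma vector_form_adj:
  assumes "x \<in> bounded_operators"
  shows "vector_form \<zeta> (x \<cdot> b) (x \<cdot> c) = vector_form \<zeta> (x\<^sup>\<dagger> \<cdot> (x \<cdot> b)) c"
  using assms inner_adj[of "x\<^sup>\<dagger>"] by (simp add: vector_form_def adj_simps)

end

context tracial_factor
begin

text \<open>
  A Radon--Nikodym argument: if \<open>\<omega>(x) = \<Sum>\<^sub>n \<parallel>x \<zeta>\<^sub>n\<parallel>\<^sup>2\<close> dominates the trace, then \<open>\<tau>\<close> is represented by
  \<open>\<tau>(y) = \<Sum>\<^sub>n \<langle>y \<zeta>\<^sub>n', \<zeta>\<^sub>n\<rangle>\<close> with \<open>\<zeta>\<^sub>n' = lim b\<^sub>j \<zeta>\<^sub>n\<close>, where \<open>b\<^sub>j\<close> minimises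
  \<open>\<omega>(b) - 2 Re \<tau>(b)\<close>. The new vectors satisfy \<open>\<parallel>x \<zeta>\<^sub>n'\<parallel> \<le> \<parallel>x\<parallel>\<^sub>2\<close>.
\<close>

lemma trace_bounded_vector:
  obtains \<zeta>' :: 'h where "\<zeta>' \<noteq> 0" and "\<And>x. x \<in> M \<Longrightarrow> norm (blinfun_apply x \<zeta>') \<le> norm2 \<tau> x"
proof -
  obtain \<zeta> :: "nat \<Rightarrow> 'h" and K :: real where s: "summable (\<lambda>n. (norm (\<zeta> n))\<^sup>2)"
    and dom0: "\<And>x. x \<in> M \<Longrightarrow> ip x x \<le> (\<Sum>n. (norm (x (\<zeta> n)))\<^sup>2)"
    by (rule dominating_vectors) (rule that)
  interpret square_summable \<zeta> by standard (rule s)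
  define w where "w = vector_form \<zeta>"
  have dom: "ip x x \<le> w x x" if "x \<in> M" for x
    using dom0[OF that] by (simp add: w_def vector_form_square)
  define J where "J b = w b b - 2 * Re (\<tau> b)" for b
  \<comment> \<open>Completing the square, since the real part of the trace of b is at most its
    trace norm, hence at most \<open>sqrt (w b b)\<close>.\<close>
  have low: "- 1 \<le> J b" if b: "b \<in> M" for b
  proof -
    have "Re (\<tau> b) \<le> \<bar>ip b \<one>\<bar>" by (simp add: ip_def)
    also have "\<dots> \<le> ip.nrm b * ip.nrm \<one>" using b one_in by (rule ip.Cauchy_Schwarz)
    also have "\<dots> \<le> sqrt (w b b)" using dom[OF b] by (simp add: ip_def trace_one)
    finally have "Re (\<tau> b) \<le> sqrt (w b b)" .
    moreover have "(sqrt (w b b))\<^sup>2 = w b b" using vf.B_nonneg[of b] by (simp add: w_def)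
    moreover have "0 \<le> (sqrt (w b b) - 1)\<^sup>2" by simp
    ultimately show ?thesis by (simp add: J_def power2_diff)
  qed
  have mid: "J ((1/2) *\<^sub>R (x + y)) \<le> (J x + J y) / 2 - w (x - y) (x - y) / 4" if "x \<in> M" "y \<in> M" for x y
    using vf.B_midpoint[of x y 0] that
    by (simp add: J_def w_def trace_simps field_simps)
  obtain b where b: "\<And>n. b n \<in> M" "\<And>n x. x \<in> M \<Longrightarrow> J (b n) \<le> J x + 1 / Suc n"
    "\<And>i j. w (b i - b j) (b i - b j) \<le> 2 / Suc i + 2 / Suc j"
  proof (rule minimizing_sequence[of M J "\<lambda>x y. w (x - y) (x - y)" "-1"])
    show "M \<noteq> {}" using one_in by auto
  qed (use mid low in \<open>auto simp: closed_in\<close>)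
  \<comment> \<open>For j >= i the bound 2/(i+1) + 2/(j+1) is at most 4/(i+1), so \<open>d i\<close>
    controls the whole tail after \<open>b i\<close>.\<close>
  define d where "d i = sqrt (4 / real (Suc i))" for i
  have d_lim: "d \<longlonglongrightarrow> 0"
  proof -
    have "(\<lambda>i. sqrt (4 * (1 / real (Suc i)))) \<longlonglongrightarrow> sqrt (4 * 0)"
      by (intro tendsto_intros LIMSEQ_Suc[OF lim_1_over_n])
    then show ?thesis by (simp add: d_def[abs_def])
  qed
  have d: "sqrt (w (b i - b j) (b i - b j)) \<le> d i" if "j \<ge> i" for i j
  proof -
    have "2 / real (Suc j) \<le> 2 / real (Suc i)" using that by (simp add: frac_le)
    then have "w (b i - b j) (b i - b j) \<le> 4 / real (Suc i)" using b(3)[of i j] by simp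
    then show ?thesis unfolding d_def by (rule real_sqrt_le_mono)
  qed
  \<comment> \<open>The Euler-Lagrange equation of \<open>J\<close>, stated as a limit because the
    infimum need not be attained in \<open>M\<close>. The steps t = s and t = -s with s^2 = 1/(j+1)
    balance the quadratic term against the defect 1/(j+1) of \<open>b j\<close>.\<close>
  have EL: "(\<lambda>j. w y (b j)) \<longlonglongrightarrow> Re (\<tau> y)" if y: "y \<in> M" for y
  proof -
    define W where "W = w y y"
    have bound: "\<bar>w y (b j) - Re (\<tau> y)\<bar> \<le> (1 + W) / 2 * sqrt (1 / Suc j)" for j
    proof -
      define D where "D = w y (b j) - Re (\<tau> y)"
      define s where "s = sqrt (1 / Suc j)"
      have s: "s > 0" "s\<^sup>2 = 1 / Suc j" by (simp_all add: s_def)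
      have q: "0 \<le> t\<^sup>2 * W + 2 * t * D + 1 / Suc j" for t
      proof -
        have "J (b j) \<le> J (b j + t *\<^sub>R y) + 1 / Suc j" using b(1) y by (intro b(2)) (simp add: closed_in)
        also have "J (b j + t *\<^sub>R y) = J (b j) + t\<^sup>2 * W + 2 * t * D"
          using vf.B_square_add[of "b j" y t] vf.B_sym[of y "b j"] b(1)[of j] y
          by (simp add: J_def w_def W_def D_def trace_simps algebra_simps)
        finally show ?thesis by simp
      qed
      have "0 \<le> s\<^sup>2 * W + 2 * s * D + s\<^sup>2" "0 \<le> s\<^sup>2 * W - 2 * s * D + s\<^sup>2"
        using q[of s] q[of "- s"] by (simp_all add: s(2))
      then have "0 \<le> s * (s * W + 2 * D + s)" "0 \<le> s * (s * W - 2 * D + s)"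
        by (simp_all add: power2_eq_square algebra_simps)
      then have "0 \<le> s * W + 2 * D + s" "0 \<le> s * W - 2 * D + s"
        using s(1) by (simp_all add: zero_le_mult_iff)
      then show ?thesis unfolding D_def[symmetric] s_def[symmetric]
        by (simp add: abs_le_iff field_simps)
    qed
    have "(\<lambda>j. (1 + W) / 2 * sqrt (1 / real (Suc j))) \<longlonglongrightarrow> (1 + W) / 2 * sqrt 0"
      by (intro tendsto_intros LIMSEQ_Suc[OF lim_1_over_n])
    then have "(\<lambda>j. (1 + W) / 2 * sqrt (1 / real (Suc j))) \<longlonglongrightarrow> 0" by simp
    then have "(\<lambda>j. w y (b j) - Re (\<tau> y)) \<longlonglongrightarrow> 0"
    proof (rule Lim_null_comparison[rotated], intro always_eventually allI)
      show "norm (w y (b j) - Re (\<tau> y)) \<le> (1 + W) / 2 * sqrt (1 / real (Suc j))" for j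
        using bound[of j] by (simp only: real_norm_def)
    qed
    then show ?thesis by (rule LIM_zero_cancel)
  qed
  have "\<exists>l. (\<lambda>j. b j (\<zeta> n)) \<longlonglongrightarrow> l" for n
  proof -
    have "Cauchy (\<lambda>j. b j (\<zeta> n))"
    proof (rule metric_CauchyI)
      fix e :: real assume e: "e > 0"
      then obtain N where N: "\<And>i j. i \<ge> N \<Longrightarrow> j \<ge> N \<Longrightarrow> 2 / real (Suc i) + 2 / real (Suc j) < e\<^sup>2"
        using inverse_Suc_sum_small[of "e\<^sup>2"] by auto
      have "dist (b i (\<zeta> n)) (b j (\<zeta> n)) < e" if "i \<ge> N" "j \<ge> N" for i j
      proof -
        have "dist (b i (\<zeta> n)) (b j (\<zeta> n)) \<le> sqrt (w (b i - b j) (b i - b j))"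
          using norm_le_vector_form[of "b i - b j" n] by (simp add: dist_norm w_def blinfun.diff_left)
        also have "\<dots> < sqrt (e\<^sup>2)" using b(3)[of i j] N[OF that] by (intro real_sqrt_less_mono) linarith
        finally show ?thesis using e by simp
      qed
      then show "\<exists>M. \<forall>m\<ge>M. \<forall>k\<ge>M. dist (b m (\<zeta> n)) (b k (\<zeta> n)) < e" by blast
    qed
    then show ?thesis using Cauchy_convergent_iff convergent_def by blast
  qed
  then obtain \<zeta>' where \<zeta>': "\<And>n. (\<lambda>j. b j (\<zeta> n)) \<longlonglongrightarrow> \<zeta>' n" by metis
  \<comment> \<open>Let W be the square of the \<open>w\<close>-norm of x b_i. Up to an error
    \<open>sqrt W * norm x * d i\<close> it is at most the real part of the trace of x^* x b_i,
    which Cauchy-Schwarz and domination bound by \<open>norm2 \<tau> x * sqrt W\<close>. Cancel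
    \<open>sqrt W\<close> and let i grow.\<close>
  have le: "norm (x (\<zeta>' n)) \<le> norm2 \<tau> x" if x: "x \<in> M" for x n
  proof -
    note xb = in_bounded[OF x]
    have "norm (x (b i (\<zeta> n))) \<le> norm2 \<tau> x + norm x * d i" for i
    proof -
      define W where "W = w (x \<cdot> b i) (x \<cdot> b i)"
      have W: "W \<ge> 0" using vf.B_nonneg by (simp add: W_def w_def)
      have xbi: "x \<cdot> b i \<in> M" "x\<^sup>\<dagger> \<cdot> (x \<cdot> b i) \<in> M" using x b(1) by (auto simp: closed_in)
      have "W \<le> Re (\<tau> (x\<^sup>\<dagger> \<cdot> (x \<cdot> b i))) + sqrt W * (norm x * d i)"
      proof (rule LIMSEQ_le)
        show "(\<lambda>j. W) \<longlonglongrightarrow> W" by simp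
        show "(\<lambda>j. w (x\<^sup>\<dagger> \<cdot> (x \<cdot> b i)) (b j) + sqrt W * (norm x * d i)) \<longlonglongrightarrow>
            Re (\<tau> (x\<^sup>\<dagger> \<cdot> (x \<cdot> b i))) + sqrt W * (norm x * d i)"
          by (intro tendsto_intros EL xbi)
        show "\<exists>N. \<forall>j\<ge>N. W \<le> w (x\<^sup>\<dagger> \<cdot> (x \<cdot> b i)) (b j) + sqrt W * (norm x * d i)"
        proof (intro exI[of _ i] allI impI)
          fix j assume j: "j \<ge> i"
          have "W = w (x \<cdot> b i) (x \<cdot> b j) + w (x \<cdot> b i) (x \<cdot> (b i - b j))"
            using vf.B_diff_right[of "x \<cdot> b i" "x \<cdot> b j" "x \<cdot> b i"]
            by (simp add: W_def w_def op_times.diff_right)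
          also have "w (x \<cdot> b i) (x \<cdot> b j) = w (x\<^sup>\<dagger> \<cdot> (x \<cdot> b i)) (b j)"
            unfolding w_def by (rule vector_form_adj[OF xb])
          also have "w (x \<cdot> b i) (x \<cdot> (b i - b j)) \<le> sqrt W * (norm x * d i)"
          proof -
            have "w (x \<cdot> b i) (x \<cdot> (b i - b j)) \<le> sqrt W * sqrt (w (x \<cdot> (b i - b j)) (x \<cdot> (b i - b j)))"
              using vf.Cauchy_Schwarz[of "x \<cdot> b i" "x \<cdot> (b i - b j)"] by (simp add: W_def w_def)
            also have "\<dots> \<le> sqrt W * sqrt ((norm x)\<^sup>2 * w (b i - b j) (b i - b j))"
              unfolding w_def by (intro mult_left_mono real_sqrt_le_mono vector_form_times_le) (simp add: W)
            also have "\<dots> = sqrt W * (norm x * sqrt (w (b i - b j) (b i - b j)))"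
              by (simp add: real_sqrt_mult)
            also have "\<dots> \<le> sqrt W * (norm x * d i)"
              using d[OF j] by (intro mult_left_mono) (simp_all add: W)
            finally show ?thesis .
          qed
          finally show "W \<le> w (x\<^sup>\<dagger> \<cdot> (x \<cdot> b i)) (b j) + sqrt W * (norm x * d i)" by simp
        qed
      qed
      also have "Re (\<tau> (x\<^sup>\<dagger> \<cdot> (x \<cdot> b i))) \<le> sqrt W * norm2 \<tau> x"
      proof -
        have "Re (\<tau> (x\<^sup>\<dagger> \<cdot> (x \<cdot> b i))) \<le> \<bar>ip (x \<cdot> b i) x\<bar>" by (simp add: ip_def)
        also have "\<dots> \<le> ip.nrm (x \<cdot> b i) * ip.nrm x" by (rule ip.Cauchy_Schwarz[OF xbi(1) x])
        also have "\<dots> \<le> sqrt W * norm2 \<tau> x"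
          using dom[OF xbi(1)] ip.B_nonneg[OF x] by (auto simp: W_def norm2_eq intro!: mult_right_mono)
        finally show ?thesis .
      qed
      finally have "W \<le> sqrt W * (norm2 \<tau> x + norm x * d i)" by (simp add: distrib_left)
      then have 1: "sqrt W * sqrt W \<le> sqrt W * (norm2 \<tau> x + norm x * d i)" using W by simp
      have 2: "0 \<le> norm2 \<tau> x + norm x * d i"
        using ip.B_nonneg[OF x] by (simp add: norm2_eq d_def)
      have "sqrt W \<le> norm2 \<tau> x + norm x * d i"
        by (rule le_of_self_mult_le[OF 1 real_sqrt_ge_zero[OF W] 2])
      then show ?thesis using norm_le_vector_form[of "x \<cdot> b i" n] by (simp add: W_def w_def)
    qed
    moreover have "(\<lambda>i. norm (x (b i (\<zeta> n)))) \<longlonglongrightarrow> norm (x (\<zeta>' n))"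
      by (intro tendsto_norm bounded_linear.tendsto[OF blinfun.bounded_linear_right] \<zeta>')
    moreover have "(\<lambda>i. norm2 \<tau> x + norm x * d i) \<longlonglongrightarrow> norm2 \<tau> x + norm x * 0"
      by (intro tendsto_intros d_lim)
    ultimately show ?thesis by (intro LIMSEQ_le[of _ _ "\<lambda>i. norm2 \<tau> x + norm x * d i"]) auto
  qed
  \<comment> \<open>If every limit were 0, then \<open>b i\<close> would tend to 0 for the form
    \<open>w\<close>, and \<open>EL\<close> at 1 would give the identity trace 0.\<close>
  have "\<exists>n. \<zeta>' n \<noteq> 0"
  proof (rule ccontr)
    assume "\<nexists>n. \<zeta>' n \<noteq> 0"
    then have z: "\<zeta>' n = 0" for n by auto
    have small: "sqrt (w (b i) (b i)) \<le> d i" for i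
    proof -
      have "(\<Sum>n. (norm (b i (\<zeta> n)))\<^sup>2) \<le> (d i)\<^sup>2"
      proof (rule suminf_le_const[OF summable_square])
        fix N
        have "(\<lambda>j. \<Sum>n<N. (norm ((b i - b j) (\<zeta> n)))\<^sup>2) \<longlonglongrightarrow> (\<Sum>n<N. (norm (b i (\<zeta> n) - 0))\<^sup>2)"
          unfolding blinfun.diff_left using \<zeta>' z by (intro tendsto_intros) auto
        then have lim: "(\<lambda>j. \<Sum>n<N. (norm ((b i - b j) (\<zeta> n)))\<^sup>2) \<longlonglongrightarrow> (\<Sum>n<N. (norm (b i (\<zeta> n)))\<^sup>2)" by simp
        have "(\<Sum>n<N. (norm ((b i - b j) (\<zeta> n)))\<^sup>2) \<le> (d i)\<^sup>2" if "j \<ge> i" for j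
        proof -
          have "(\<Sum>n<N. (norm ((b i - b j) (\<zeta> n)))\<^sup>2) \<le> w (b i - b j) (b i - b j)"
            unfolding w_def vector_form_square by (rule sum_le_suminf[OF summable_square]) auto
          also have "\<dots> = (sqrt (w (b i - b j) (b i - b j)))\<^sup>2" using vf.B_nonneg by (simp add: w_def)
          also have "\<dots> \<le> (d i)\<^sup>2" using d[OF that] vf.B_nonneg by (intro power_mono) (auto simp: w_def)
          finally show ?thesis .
        qed
        then show "(\<Sum>n<N. (norm (b i (\<zeta> n)))\<^sup>2) \<le> (d i)\<^sup>2"
          by (intro LIMSEQ_le_const2[OF lim]) auto
      qed
      then have "w (b i) (b i) \<le> (d i)\<^sup>2" by (simp add: w_def vector_form_square)
      then show ?thesis by (rule real_le_lsqrt[rotated]) (simp add: d_def)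
    qed
    have "(\<lambda>i. w \<one> (b i)) \<longlonglongrightarrow> 0"
    proof (rule Lim_null_comparison)
      show "\<forall>\<^sub>F i in sequentially. norm (w \<one> (b i)) \<le> sqrt (w \<one> \<one>) * d i"
      proof (intro always_eventually allI)
        fix i
        have "norm (w \<one> (b i)) \<le> sqrt (w \<one> \<one>) * sqrt (w (b i) (b i))"
          using vf.Cauchy_Schwarz[of \<one> "b i"] by (simp add: w_def)
        also have "\<dots> \<le> sqrt (w \<one> \<one>) * d i" using small vf.B_nonneg[of \<one>]
          by (intro mult_left_mono) (auto simp: w_def)
        finally show "norm (w \<one> (b i)) \<le> sqrt (w \<one> \<one>) * d i" .
      qed
      show "(\<lambda>i. sqrt (w \<one> \<one>) * d i) \<longlonglongrightarrow> 0" using tendsto_mult[OF tendsto_const d_lim] by simp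
    qed
    then have "Re (\<tau> \<one>) = 0" using EL[OF one_in] LIMSEQ_unique by blast
    then show False by (simp add: trace_one)
  qed
  then show ?thesis using that le by blast
qed

text \<open>Bounded vectors are invariant under the commutant, which moves past x, and under
  \<open>M\<close> by the estimate for right multiplication. Their closure is therefore 0 or
  everything, and \<open>trace_bounded_vector\<close> excludes 0.\<close>

lemma bounded_vectors_dense:
  "closure {\<zeta>. \<exists>C. \<forall>x\<in>M. norm (blinfun_apply x \<zeta>) \<le> C * norm2 \<tau> x} = UNIV"
proof -
  define S where "S = {\<zeta>. \<exists>C. \<forall>x\<in>M. norm (blinfun_apply x \<zeta>) \<le> C * norm2 \<tau> x}"
  have n2: "0 \<le> norm2 \<tau> x" if "x \<in> M" for x using ip.B_nonneg[OF that] by (simp add: norm2_eq)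
  have sub: "subspace S"
    unfolding subspace_def
  proof (intro conjI ballI allI)
    show "0 \<in> S" unfolding S_def by (auto intro!: exI[of _ 0])
    fix a b assume "a \<in> S" "b \<in> S"
    then obtain C D where CD: "\<And>x. x \<in> M \<Longrightarrow> norm (x a) \<le> C * norm2 \<tau> x" "\<And>x. x \<in> M \<Longrightarrow> norm (x b) \<le> D * norm2 \<tau> x"
      by (auto simp: S_def)
    have "norm (x (a + b)) \<le> (C + D) * norm2 \<tau> x" if "x \<in> M" for x
      using CD[OF that] norm_triangle_ineq[of "x a" "x b"] by (simp add: blinfun.add_right distrib_right)
    then show "a + b \<in> S" by (auto simp: S_def)
  next
    fix r a assume "a \<in> S"
    then obtain C where C: "\<And>x. x \<in> M \<Longrightarrow> norm (x a) \<le> C * norm2 \<tau> x" by (auto simp: S_def)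
    have "norm (x (r *\<^sub>R a)) \<le> (\<bar>r\<bar> * C) * norm2 \<tau> x" if "x \<in> M" for x
      using mult_left_mono[OF C[OF that], of "\<bar>r\<bar>"] by (simp add: blinfun.scaleR_right mult.assoc)
    then show "r *\<^sub>R a \<in> S" by (auto simp: S_def)
  qed
  have inv: "y \<zeta> \<in> S" if y: "y \<in> M \<union> commutant M" and \<zeta>: "\<zeta> \<in> S" for y \<zeta>
  proof -
    obtain C where C: "\<And>x. x \<in> M \<Longrightarrow> norm (x \<zeta>) \<le> C * norm2 \<tau> x" using \<zeta> by (auto simp: S_def)
    have C': "norm (x \<zeta>) \<le> \<bar>C\<bar> * norm2 \<tau> x" if "x \<in> M" for x
      using C[OF that] n2[OF that] mult_right_mono[OF abs_ge_self[of C] n2[OF that]] by linarith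
    have "norm (x (y \<zeta>)) \<le> (\<bar>C\<bar> * norm y) * norm2 \<tau> x" if x: "x \<in> M" for x
    proof (cases "y \<in> M")
      case True
      have "norm ((x \<cdot> y) \<zeta>) \<le> \<bar>C\<bar> * norm2 \<tau> (x \<cdot> y)" using x True by (intro C') (simp add: closed_in)
      also have "\<dots> \<le> \<bar>C\<bar> * (norm y * norm2 \<tau> x)"
      proof (rule mult_left_mono)
        have "norm2 \<tau> (x \<cdot> y) \<le> sqrt ((norm y)\<^sup>2 * ip x x)"
          unfolding norm2_eq by (rule real_sqrt_le_mono) (rule ip_times_le(2)[OF True x])
        then show "norm2 \<tau> (x \<cdot> y) \<le> norm y * norm2 \<tau> x" by (simp add: norm2_eq real_sqrt_mult)
      qed simp
      finally show ?thesis by (simp add: mult.assoc)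
    next
      case False
      then have "y \<cdot> x = x \<cdot> y" using y x by (simp add: commutant_def)
      then have "norm (x (y \<zeta>)) = norm (y (x \<zeta>))" by (metis blinfun_apply_blinfun_compose)
      also have "\<dots> \<le> norm y * norm (x \<zeta>)" by (rule norm_blinfun)
      also have "\<dots> \<le> norm y * (\<bar>C\<bar> * norm2 \<tau> x)" by (intro mult_left_mono C' x) simp
      finally show ?thesis by (simp add: mult_ac)
    qed
    then show ?thesis by (auto simp: S_def)
  qed
  have "y \<zeta> \<in> closure S" if y: "y \<in> M \<union> commutant M" and \<zeta>: "\<zeta> \<in> closure S" for y \<zeta>
  proof -
    obtain X where X: "\<And>n. X n \<in> S" "X \<longlonglongrightarrow> \<zeta>" using \<zeta> closure_sequential by metis
    have "(\<lambda>n. y (X n)) \<longlonglongrightarrow> y \<zeta>" by (rule bounded_linear.tendsto[OF blinfun.bounded_linear_right X(2)])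
    then show ?thesis using inv[OF y X(1)] closure_sequential by metis
  qed
  moreover have "subspace (closure S)"
    unfolding subspace_def
  proof (intro conjI ballI allI)
    show "0 \<in> closure S" using sub subspace_0 closure_subset by blast
    fix a b assume "a \<in> closure S" "b \<in> closure S"
    then obtain X Y where XY: "\<And>n. X n \<in> S" "X \<longlonglongrightarrow> a" "\<And>n. Y n \<in> S" "Y \<longlonglongrightarrow> b"
      using closure_sequential by metis
    have "(\<lambda>n. X n + Y n) \<longlonglongrightarrow> a + b" by (intro tendsto_add XY)
    then show "a + b \<in> closure S"
      using closure_sequential XY(1,3) subspace_add[OF sub] by (metis (no_types, lifting))
  next
    fix r a assume "a \<in> closure S"
    then obtain X where X: "\<And>n. X n \<in> S" "X \<longlonglongrightarrow> a" using closure_sequential by metis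
    have "(\<lambda>n. r *\<^sub>R X n) \<longlonglongrightarrow> r *\<^sub>R a" by (intro tendsto_scaleR tendsto_const X)
    then show "r *\<^sub>R a \<in> closure S"
      using closure_sequential X(1) subspace_mul[OF sub] by (metis (no_types, lifting))
  qed
  ultimately consider "closure S = {0}" | "closure S = UNIV"
    using invariant_subspace_trivial[of "closure S"] closed_closure by metis
  then show ?thesis
  proof cases
    case 1
    obtain \<zeta>' :: 'h where "\<zeta>' \<noteq> 0" and b: "\<And>x. x \<in> M \<Longrightarrow> norm (x \<zeta>') \<le> norm2 \<tau> x"
      by (rule trace_bounded_vector) (rule that)
    moreover have "\<zeta>' \<in> S" unfolding S_def using b by (auto intro!: exI[of _ 1])
    ultimately have False using 1 closure_subset by fastforce
    then show ?thesis ..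
  next
    case 2
    then show ?thesis by (simp add: S_def)
  qed
qed

text \<open>A trace-norm Cauchy sequence is Cauchy at bounded vectors, hence by density and the norm
  bound at all vectors; bicommutants are strongly closed. Dominated convergence along the vectors of
  \<open>dominating_vectors\<close> then returns trace-norm convergence.\<close>

lemma ball_complete:
  assumes X: "\<And>n. X n \<in> M" and bd: "\<And>n. norm (X n) \<le> R"
    and C: "\<And>e. e > 0 \<Longrightarrow> \<exists>N. \<forall>i\<ge>N. \<forall>j\<ge>N. ip.nrm (X i - X j) < e"
  obtains x where "x \<in> M" and "norm x \<le> R"
    and "\<And>\<xi>. (\<lambda>n. blinfun_apply (X n) \<xi>) \<longlonglongrightarrow> blinfun_apply x \<xi>"
    and "(\<lambda>n. ip.nrm (X n - x)) \<longlonglongrightarrow> 0"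
proof -
  have Cx: "Cauchy (\<lambda>n. X n \<xi>)" for \<xi>
  proof (rule Cauchy_on_closure[OF bd])
    show "\<xi> \<in> closure {\<zeta>. \<exists>C. \<forall>x\<in>M. norm (blinfun_apply x \<zeta>) \<le> C * norm2 \<tau> x}" by (simp add: bounded_vectors_dense)
    fix \<zeta> assume "\<zeta> \<in> {\<zeta>. \<exists>C. \<forall>x\<in>M. norm (blinfun_apply x \<zeta>) \<le> C * norm2 \<tau> x}"
    then obtain C where C': "\<And>x. x \<in> M \<Longrightarrow> norm (x \<zeta>) \<le> C * norm2 \<tau> x" by auto
    show "Cauchy (\<lambda>n. X n \<zeta>)"
    proof (rule metric_CauchyI)
      fix e :: real assume e: "e > 0"
      then obtain N where N: "\<And>i j. i \<ge> N \<Longrightarrow> j \<ge> N \<Longrightarrow> ip.nrm (X i - X j) < e / (\<bar>C\<bar> + 1)"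
        using C[of "e / (\<bar>C\<bar> + 1)"] by auto
      have "dist (X i \<zeta>) (X j \<zeta>) < e" if "i \<ge> N" "j \<ge> N" for i j
      proof -
        have "dist (X i \<zeta>) (X j \<zeta>) \<le> C * ip.nrm (X i - X j)"
          using C'[OF diff_in[OF X X], of i j] by (simp add: dist_norm blinfun.diff_left norm2_eq)
        also have "\<dots> \<le> (\<bar>C\<bar> + 1) * ip.nrm (X i - X j)"
          using ip.B_nonneg[OF diff_in[OF X X], of i j] by (intro mult_right_mono) auto
        also have "\<dots> < (\<bar>C\<bar> + 1) * (e / (\<bar>C\<bar> + 1))" by (intro mult_strict_left_mono N that) auto
        also have "\<dots> = e" by (simp add: field_simps)
        finally show ?thesis .
      qed
      then show "\<exists>M. \<forall>m\<ge>M. \<forall>n\<ge>M. dist (X m \<zeta>) (X n \<zeta>) < e" by blast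
    qed
  qed
  obtain x where x: "norm x \<le> R" "\<And>\<xi>. (\<lambda>n. X n \<xi>) \<longlonglongrightarrow> blinfun_apply x \<xi>"
    by (rule strong_limit_exists[OF bd Cx]) (rule that)
  have xM: "x \<in> M" using strong_limit_in[OF X x(2)] .
  obtain \<zeta> :: "nat \<Rightarrow> 'h" and K :: real where s: "summable (\<lambda>n. (norm (\<zeta> n))\<^sup>2)"
    and dom: "\<And>x. x \<in> M \<Longrightarrow> ip x x \<le> (\<Sum>n. (norm (x (\<zeta> n)))\<^sup>2)"
    by (rule dominating_vectors) (rule that)
  have "(\<lambda>n. \<Sum>k. (norm ((X n - x) (\<zeta> k)))\<^sup>2) \<longlonglongrightarrow> (\<Sum>k. 0)"
  proof (rule tannerys_theorem[THEN conjunct2, THEN conjunct2])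
    show "(\<lambda>n. (norm ((X n - x) (\<zeta> k)))\<^sup>2) \<longlonglongrightarrow> 0" for k
    proof -
      have "(\<lambda>n. (norm (X n (\<zeta> k) - x (\<zeta> k)))\<^sup>2) \<longlonglongrightarrow> (norm (x (\<zeta> k) - x (\<zeta> k)))\<^sup>2"
        by (intro tendsto_intros x)
      then show ?thesis by (simp add: blinfun.diff_left)
    qed
    show "summable (\<lambda>k. (2 * R)\<^sup>2 * (norm (\<zeta> k))\<^sup>2)" using s by (rule summable_mult)
    show "\<forall>\<^sub>F (k, n) in sequentially \<times>\<^sub>F sequentially.
        norm ((norm ((X n - x) (\<zeta> k)))\<^sup>2) \<le> (2 * R)\<^sup>2 * (norm (\<zeta> k))\<^sup>2"
    proof (intro always_eventually allI, clarify)
      fix k n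
      have "norm ((X n - x) (\<zeta> k)) \<le> norm (X n - x) * norm (\<zeta> k)" by (rule norm_blinfun)
      also have "norm (X n - x) \<le> 2 * R" using norm_triangle_ineq4[of "X n" x] bd[of n] x(1) by linarith
      finally have "norm ((X n - x) (\<zeta> k)) \<le> 2 * R * norm (\<zeta> k)" by (simp add: mult_right_mono)
      from power_mono[OF this norm_ge_zero, of 2]
      show "norm ((norm ((X n - x) (\<zeta> k)))\<^sup>2) \<le> (2 * R)\<^sup>2 * (norm (\<zeta> k))\<^sup>2"
        by (simp add: power_mult_distrib)
    qed
  qed simp
  then have lim: "(\<lambda>n. \<Sum>k. (norm ((X n - x) (\<zeta> k)))\<^sup>2) \<longlonglongrightarrow> 0" by simp
  have "(\<lambda>n. ip (X n - x) (X n - x)) \<longlonglongrightarrow> 0"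
    by (rule Lim_null_comparison[OF _ lim])
      (use dom[OF diff_in[OF X xM]] ip.B_nonneg[OF diff_in[OF X xM]] in auto)
  then have "(\<lambda>n. ip.nrm (X n - x)) \<longlonglongrightarrow> sqrt 0" by (rule tendsto_real_sqrt)
  then show ?thesis using that xM x by simp
qed

end

section \<open>Conditional expectations onto abelian subalgebras\<close>

text \<open>Both parts come with explicit formulas, so that they visibly lie in any algebra that
  contains \<open>x\<close> and its adjoint.\<close>

lemma cartesian_decomposition:
  fixes x :: "'h::complex_hilbert_space op"
  assumes x: "x \<in> bounded_operators"
  obtains s t where "s = (1/2) *\<^sub>R (x + x\<^sup>\<dagger>)" "t = scaleC_op (- \<i>) ((1/2) *\<^sub>R (x - x\<^sup>\<dagger>))"
    "hermitian s" "hermitian t" "x = s + scaleC_op \<i> t"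
proof -
  note xb = x adj_bounded[OF x]
  define s t where "s = (1/2) *\<^sub>R (x + x\<^sup>\<dagger>)" and "t = scaleC_op (- \<i>) ((1/2) *\<^sub>R (x - x\<^sup>\<dagger>))"
  have tb: "t \<in> bounded_operators" using xb by (simp add: t_def bounded_operators_closed)
  have "hermitian s" using xb by (auto simp: hermitian_def s_def adj_simps add.commute)
  moreover have "hermitian t"
  proof -
    have "t\<^sup>\<dagger> = scaleC_op \<i> ((1/2) *\<^sub>R (x\<^sup>\<dagger> - x))" using xb by (simp add: t_def adj_simps)
    also have "\<dots> = t"
      by (intro blinfun_eqI)
        (simp add: t_def scaleC_op_apply op_simps scaleC_left_diff scaleC_scaleR scaleC_minus_left
          scaleR_diff_right)
    finally show ?thesis using tb by (simp add: hermitian_def)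
  qed
  moreover have "x = s + scaleC_op \<i> t"
  proof -
    have "scaleC_op \<i> t = (1/2) *\<^sub>R (x - x\<^sup>\<dagger>)"
      by (intro blinfun_eqI) (simp add: t_def scaleC_op_apply scaleC_scaleC)
    then have "s + scaleC_op \<i> t = (1/2) *\<^sub>R ((x + x\<^sup>\<dagger>) + (x - x\<^sup>\<dagger>))"
      unfolding s_def by (simp only: scaleR_add_right)
    also have "(x + x\<^sup>\<dagger>) + (x - x\<^sup>\<dagger>) = 2 *\<^sub>R x" by (simp add: scaleR_2)
    finally show ?thesis by simp
  qed
  ultimately show ?thesis using that s_def t_def by blast
qed

lemma positive_strong_limit:
  assumes X: "\<And>n. positive_op (X n)" and x: "x \<in> bounded_operators"
    and lim: "\<And>\<xi>. (\<lambda>n. blinfun_apply (X n) \<xi>) \<longlonglongrightarrow> blinfun_apply x \<xi>"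
  shows "positive_op x"
  unfolding positive_op_def
proof (intro conjI allI x)
  fix \<xi>
  have "(\<lambda>n. cinner (X n \<xi>) \<xi>) \<longlonglongrightarrow> cinner (x \<xi>) \<xi>"
    unfolding cinner_eq_Complex by (intro tendsto_Complex tendsto_inner tendsto_const lim)
  then show "cinner (x \<xi>) \<xi> \<in> \<real>\<^sub>\<ge>\<^sub>0"
    using closed_sequentially[OF closed_nonneg_Reals_complex, of "\<lambda>n. cinner (X n \<xi>) \<xi>"] X
    by (auto simp: positive_op_def)
qed

locale abelian_subalgebra = tracial_factor M \<tau> + N: von_neumann N
  for M :: "'h::complex_hilbert_space op set" and \<tau> :: "'h op \<Rightarrow> complex" and N :: "'h op set" +
  assumes sub: "N \<subseteq> M" and abel: "abelian N"
begin

lemma in_M: "a \<in> N \<Longrightarrow> a \<in> M"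
  using sub by auto

lemma N_commute: "a \<in> N \<Longrightarrow> b \<in> N \<Longrightarrow> a \<cdot> b = b \<cdot> a"
  using abel by (simp add: abelian_def)

lemma N_left_commute: "a \<in> N \<Longrightarrow> b \<in> N \<Longrightarrow> a \<cdot> (b \<cdot> c) = b \<cdot> (a \<cdot> c)"
  by (metis N_commute op_times_assoc)

lemma N_positive_times:
  "a \<in> N \<Longrightarrow> b \<in> N \<Longrightarrow> positive_op a \<Longrightarrow> positive_op b \<Longrightarrow> positive_op (a \<cdot> b)"
  by (rule positive_commuting_times) (auto simp: N_commute)

text \<open>The order interval [0, 1] of \<open>N\<close>. It is norm bounded, hence amenable to
  \<open>ball_complete\<close>, and closed under products because \<open>N\<close> is
  abelian.\<close>

definition effects :: "'h op set" where
  "effects = {a \<in> N. positive_op a \<and> positive_op (\<one> - a)}"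

lemma effectsD:
  assumes "a \<in> effects"
  shows "a \<in> N" "a \<in> M" "positive_op a" "positive_op (\<one> - a)"
  using assms sub by (auto simp: effects_def)

lemma effects_norm: "a \<in> effects \<Longrightarrow> norm a \<le> 1"
  using positive_norm_le[of a 1] by (auto simp: effects_def)

lemma effects_compl: "a \<in> effects \<Longrightarrow> \<one> - a \<in> effects"
  by (auto simp: effects_def N.closed_in)

lemma effects_times:
  assumes a: "a \<in> effects" and b: "b \<in> effects"
  shows "a \<cdot> b \<in> effects"
proof -
  have "positive_op ((\<one> - a) + a \<cdot> (\<one> - b))"
    using effectsD[OF a] effectsD[OF b]
    by (intro positive_closed N_positive_times) (auto simp: N.closed_in)
  moreover have "(\<one> - a) + a \<cdot> (\<one> - b) = \<one> - a \<cdot> b" by (simp add: op_times.diff_right)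
  ultimately show ?thesis
    using effectsD[OF a] effectsD[OF b] by (simp add: effects_def N.closed_in N_positive_times)
qed

text \<open>The element is 1 - (1 - a) (1 - b): moving from \<open>a\<close> in a direction (1 - a)
  b never passes 1.\<close>

lemma effects_join:
  assumes a: "a \<in> effects" and b: "b \<in> effects"
  shows "a + (\<one> - a) \<cdot> b \<in> effects"
proof -
  have "\<one> - (\<one> - a) \<cdot> (\<one> - b) \<in> effects" by (intro effects_compl effects_times a b)
  moreover have "\<one> - (\<one> - a) \<cdot> (\<one> - b) = a + (\<one> - a) \<cdot> b"
    by (simp add: op_times.diff_right op_times.diff_left)
  ultimately show ?thesis by simp
qed

lemma effects_convex:
  assumes a: "a \<in> effects" and b: "b \<in> effects" and t: "0 \<le> t" "t \<le> (1::real)"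
  shows "a + t *\<^sub>R (b - a) \<in> effects"
proof -
  have "positive_op ((1 - t) *\<^sub>R a + t *\<^sub>R b)" "positive_op ((1 - t) *\<^sub>R (\<one> - a) + t *\<^sub>R (\<one> - b))"
    using effectsD[OF a] effectsD[OF b] t by (auto intro!: positive_closed)
  moreover have "(1 - t) *\<^sub>R a + t *\<^sub>R b = a + t *\<^sub>R (b - a)"
    "(1 - t) *\<^sub>R (\<one> - a) + t *\<^sub>R (\<one> - b) = \<one> - (a + t *\<^sub>R (b - a))"
    by (simp_all add: algebra_simps)
  ultimately show ?thesis
    using effectsD[OF a] effectsD[OF b] by (simp add: effects_def N.closed_in)
qed

lemma effects_one: "\<one> \<in> effects"
  by (simp add: effects_def N.closed_in positive_closed)

lemma effects_limit:
  assumes X: "\<And>n. X n \<in> effects"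
    and lim: "\<And>\<xi>. (\<lambda>n. blinfun_apply (X n) \<xi>) \<longlonglongrightarrow> blinfun_apply x \<xi>"
  shows "x \<in> effects"
proof -
  have x: "x \<in> N" using N.strong_limit_in[OF _ lim] effectsD(1)[OF X] by blast
  have "positive_op x"
    by (rule positive_strong_limit[OF effectsD(3)[OF X] N.in_bounded[OF x] lim])
  moreover have "positive_op (\<one> - x)"
  proof (rule positive_strong_limit[OF effectsD(4)[OF X]])
    show "\<one> - x \<in> bounded_operators" using x by (simp add: N.in_bounded N.closed_in)
    show "(\<lambda>n. (\<one> - X n) \<xi>) \<longlonglongrightarrow> (\<one> - x) \<xi>" for \<xi>
      unfolding blinfun.diff_left by (intro tendsto_diff tendsto_const lim)
  qed
  ultimately show ?thesis using x by (simp add: effects_def)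
qed

text \<open>
  With \<open>r = 1 - h\<close> the value \<open>Re \<tau>((x - h) r\<^sup>j k)\<close> does not depend on \<open>j \<ge> 1\<close>; it is at least
  \<open>- Re \<tau>(h r\<^sup>j k)\<close>, and these numbers telescope.
\<close>

lemma variational_one_sided:
  assumes x: "x \<in> M" "positive_op x" and h: "h \<in> effects"
    and up: "\<And>k. k \<in> effects \<Longrightarrow> Re (\<tau> ((x - h) \<cdot> ((\<one> - h) \<cdot> k))) \<le> 0"
    and dn: "\<And>k. k \<in> effects \<Longrightarrow> 0 \<le> Re (\<tau> ((x - h) \<cdot> (h \<cdot> k)))"
    and k: "k \<in> effects"
  shows "Re (\<tau> ((x - h) \<cdot> ((\<one> - h) \<cdot> k))) = 0"
proof -
  define r where "r = \<one> - h"
  define f where "f c = Re (\<tau> ((x - h) \<cdot> c))" for c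
  define K where "K j = ((\<lambda>T. r \<cdot> T) ^^ j) k" for j
  have r: "r \<in> effects" unfolding r_def by (rule effects_compl[OF h])
  have K: "K j \<in> effects" for j
    unfolding K_def by (induction j) (simp_all add: k effects_times r)
  have KS: "K (Suc j) = r \<cdot> K j" for j by (simp add: K_def)
  have KS': "K (Suc j) = K j - h \<cdot> K j" for j by (simp add: KS r_def op_times.diff_left)
  note m = effectsD(2)[OF h] effectsD(2)[OF K] effectsD(2)[OF r]
  \<comment> \<open>Since r and h commute, f at r h \<open>K j\<close> is <= 0 as an upward
    direction and >= 0 as a downward one. It vanishes, so a further factor r does not change
    f.\<close>
  have const: "f (r \<cdot> K j) = f (r \<cdot> k)" for j
  proof (induction j)
    case 0 then show ?case by (simp add: K_def)
  next
    case (Suc j)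
    have "f (r \<cdot> (h \<cdot> K j)) \<le> 0"
      unfolding f_def r_def by (intro up effects_times h K)
    moreover have "0 \<le> f (h \<cdot> (r \<cdot> K j))"
      unfolding f_def by (intro dn effects_times r K)
    moreover have "h \<cdot> (r \<cdot> K j) = r \<cdot> (h \<cdot> K j)"
      by (rule N_left_commute) (use effectsD(1) h r in auto)
    ultimately have "f (r \<cdot> (h \<cdot> K j)) = 0" by simp
    moreover have "f (r \<cdot> K (Suc j)) = f (r \<cdot> K j) - f (r \<cdot> (h \<cdot> K j))"
      unfolding KS' f_def using x m by (simp add: op_times.diff_right trace_simps)
    ultimately show ?case using Suc by simp
  qed
  have step: "f (r \<cdot> k) \<ge> Re (\<tau> (K (Suc (Suc j)))) - Re (\<tau> (K (Suc j)))" for j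
  proof -
    have "f (r \<cdot> k) = f (K (Suc j))" using const[of j] by (simp add: KS)
    also have "\<dots> = Re (\<tau> (x \<cdot> K (Suc j))) - Re (\<tau> (h \<cdot> K (Suc j)))"
      unfolding f_def using x m by (simp add: op_times.diff_left trace_simps)
    also have "\<dots> \<ge> - Re (\<tau> (h \<cdot> K (Suc j)))"
      using trace_times_positive[OF x effectsD(2,3)[OF K[of "Suc j"]]] by simp
    finally show ?thesis
      unfolding KS'[of "Suc j"] using m by (simp add: trace_simps)
  qed
  have sum: "real n * f (r \<cdot> k) \<ge> Re (\<tau> (K (Suc n))) - Re (\<tau> (K 1))" for n
  proof (induction n)
    case (Suc n)
    then show ?case using step[of n] by (simp add: algebra_simps)
  qed simp
  have "0 \<le> Re (\<tau> (\<one> - K 1))" by (intro trace_positive) (use effectsD[OF K] closed_in in auto)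
  then have K1: "Re (\<tau> (K 1)) \<le> 1" using m by (simp add: trace_simps)
  \<comment> \<open>After telescoping, n f (r k) is at least a difference of two traces from [0, 1],
    hence at least -1 for every n.\<close>
  have "0 \<le> f (r \<cdot> k)"
  proof (rule nonneg_from_remainder)
    fix n :: nat
    have "0 \<le> Re (\<tau> (K (Suc (n + 2))))" using effectsD[OF K] by (intro trace_positive)
    then have "real (n + 2) * f (r \<cdot> k) \<ge> - 1" using sum[of "n + 2"] K1 by linarith
    moreover have "real (n + 2) > 0" by simp
    ultimately show "- 1 / real (n + 2) \<le> f (r \<cdot> k)"
      by (simp only: pos_divide_le_eq mult.commute[of "real (n + 2)"])
  qed
  then show ?thesis using up[OF k] by (simp add: f_def r_def)
qed

text \<open>At the effect h nearest to x the real part of the trace of (x - h) (a - h) is <= 0 for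
  all effects a. Testing a = h + (1 - h) k and a = h (1 - k) gives the two hypotheses of
  \<open>variational_one_sided\<close>; its use for x, h and for 1 - x, 1 - h gives equality in both
  directions, and (1 - h) k and h k add up to k.\<close>

lemma effect_expectation:
  assumes x: "x \<in> M" "positive_op x" "positive_op (\<one> - x)"
  obtains h where "h \<in> effects" and "\<And>k. k \<in> effects \<Longrightarrow> Re (\<tau> ((x - h) \<cdot> k)) = 0"
proof -
  define Q where "Q a = ip (a - x) (a - x)" for a
  obtain X where X: "\<And>n. X n \<in> effects" "\<And>n a. a \<in> effects \<Longrightarrow> Q (X n) \<le> Q a + 1 / Suc n"
    "\<And>i j. ip (X i - X j) (X i - X j) \<le> 2 / Suc i + 2 / Suc j"
  proof (rule minimizing_sequence[of effects Q "\<lambda>a b. ip (a - b) (a - b)" 0])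
    show "effects \<noteq> {}" using effects_one by auto
    fix a b assume ab: "a \<in> effects" "b \<in> effects"
    have "(1/2) *\<^sub>R (a + b) = a + (1/2) *\<^sub>R (b - a)"
      by (simp add: algebra_simps flip: scaleR_add_left)
    then show "(1/2) *\<^sub>R (a + b) \<in> effects" using effects_convex[OF ab, of "1/2"] by simp
    show "Q ((1/2) *\<^sub>R (a + b)) \<le> (Q a + Q b) / 2 - ip (a - b) (a - b) / 4"
      unfolding Q_def using ip.B_midpoint effectsD(2)[OF ab(1)] effectsD(2)[OF ab(2)] x by simp
  next
    fix a assume "a \<in> effects"
    then show "0 \<le> Q a" unfolding Q_def using effectsD x by (intro ip.B_nonneg) (simp add: closed_in)
  qed (rule that)
  have C: "\<exists>N. \<forall>i\<ge>N. \<forall>j\<ge>N. ip.nrm (X i - X j) < e" if e: "e > 0" for e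
  proof -
    obtain N where N: "\<And>i j. i \<ge> N \<Longrightarrow> j \<ge> N \<Longrightarrow> 2 / real (Suc i) + 2 / real (Suc j) < e\<^sup>2"
      using inverse_Suc_sum_small[of "e\<^sup>2"] e by auto
    have "ip.nrm (X i - X j) < e" if "i \<ge> N" "j \<ge> N" for i j
    proof -
      have "ip.nrm (X i - X j) < sqrt (e\<^sup>2)"
        using X(3)[of i j] N[OF that] by (intro real_sqrt_less_mono) linarith
      then show ?thesis using e by simp
    qed
    then show ?thesis by blast
  qed
  obtain h where h: "h \<in> M" "\<And>\<xi>. (\<lambda>n. X n \<xi>) \<longlonglongrightarrow> blinfun_apply h \<xi>"
    "(\<lambda>n. ip.nrm (X n - h)) \<longlonglongrightarrow> 0"
    by (rule ball_complete[of X 1]) (use X(1) effectsD(2) effects_norm C in auto)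
  have hI: "h \<in> effects" by (rule effects_limit[OF X(1) h(2)])
  have Qlim: "(\<lambda>n. Q (X n)) \<longlonglongrightarrow> Q h"
    unfolding Q_def by (rule ip.nrm_tendsto) (use X(1) effectsD(2) h x in auto)
  have min: "Q h \<le> Q a" if "a \<in> effects" for a
  proof (rule LIMSEQ_le[OF Qlim])
    show "(\<lambda>n. Q a + 1 / Suc n) \<longlonglongrightarrow> Q a"
      using tendsto_add[OF tendsto_const LIMSEQ_Suc[OF lim_1_over_n]] by simp
  qed (use X(2) that in auto)
  have vi: "Re (\<tau> ((x - h) \<cdot> (a - h))) \<le> 0" if a: "a \<in> effects" for a
  proof -
    have aM: "a - h \<in> M" "h - x \<in> M" using effectsD[OF a] h x by (auto simp: closed_in)
    define W where "W = ip (a - h) (a - h)"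
    have W: "W \<ge> 0" unfolding W_def by (rule ip.B_nonneg[OF aM(1)])
    define D where "D = ip (h - x) (a - h)"
    have q: "0 \<le> 2 * D + t * W" if t: "0 < t" "t \<le> 1" for t
    proof -
      have "Q h \<le> Q (h + t *\<^sub>R (a - h))" using t by (intro min effects_convex hI a) auto
      also have "Q (h + t *\<^sub>R (a - h)) = Q h + 2 * t * D + t\<^sup>2 * W"
      proof -
        have eq: "h + t *\<^sub>R (a - h) - x = (h - x) + t *\<^sub>R (a - h)" by simp
        show ?thesis unfolding Q_def eq D_def W_def by (rule ip.B_square_add[OF aM(2,1)])
      qed
      finally have "0 \<le> t * (2 * D + t * W)" by (simp add: power2_eq_square algebra_simps)
      then show ?thesis using t(1) by (simp add: zero_le_mult_iff)
    qed
    have "0 \<le> 2 * D"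
    proof (rule nonneg_from_remainder[where K = W])
      show "- W / real (n + 2) \<le> 2 * D" for n :: nat using q[of "1 / real (n + 2)"] by simp
    qed
    moreover have "(a - h)\<^sup>\<dagger> = a - h"
      using positive_hermitian[OF effectsD(3)[OF a]] positive_hermitian[OF effectsD(3)[OF hI]]
        hermitian_closed(2) by (auto simp: hermitian_def)
    then have "D = Re (\<tau> ((a - h) \<cdot> (h - x)))" by (simp add: D_def ip_def)
    then have "D = Re (\<tau> ((h - x) \<cdot> (a - h)))" using trace_commute[OF aM] by simp
    moreover have "(h - x) \<cdot> (a - h) = - 1 *\<^sub>R ((x - h) \<cdot> (a - h))"
      by (simp add: op_times.diff_left)
    then have "\<tau> ((h - x) \<cdot> (a - h)) = - \<tau> ((x - h) \<cdot> (a - h))"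
      using trace_scaleR[of "(x - h) \<cdot> (a - h)" "-1"] x h effectsD[OF a] by (simp add: closed_in)
    ultimately show ?thesis by simp
  qed
  have up: "Re (\<tau> ((x - h) \<cdot> ((\<one> - h) \<cdot> k))) \<le> 0" if k: "k \<in> effects" for k
    using vi[OF effects_join[OF hI k]] by simp
  have dn: "0 \<le> Re (\<tau> ((x - h) \<cdot> (h \<cdot> k)))" if k: "k \<in> effects" for k
  proof -
    have "h \<cdot> (\<one> - k) - h = - 1 *\<^sub>R (h \<cdot> k)" by (simp add: op_times.diff_right)
    moreover have "\<tau> ((x - h) \<cdot> (- 1 *\<^sub>R (h \<cdot> k))) = - \<tau> ((x - h) \<cdot> (h \<cdot> k))"
      using trace_scaleR[of "(x - h) \<cdot> (h \<cdot> k)" "-1"] x h effectsD[OF k]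
      by (simp add: op_times.scaleR_right closed_in op_times.minus_right)
    ultimately show ?thesis using vi[OF effects_times[OF hI effects_compl[OF k]]] by simp
  qed
  have "Re (\<tau> ((x - h) \<cdot> k)) = 0" if k: "k \<in> effects" for k
  proof -
    have neg: "Re (\<tau> (((\<one> - x) - (\<one> - h)) \<cdot> c)) = - Re (\<tau> ((x - h) \<cdot> c))" if "c \<in> M" for c
    proof -
      have "((\<one> - x) - (\<one> - h)) \<cdot> c = - 1 *\<^sub>R ((x - h) \<cdot> c)" by (simp add: op_times.diff_left)
      then show ?thesis using trace_scaleR[of "(x - h) \<cdot> c" "-1"] x h that by (simp add: closed_in)
    qed
    have m: "h \<cdot> c \<in> M" "(\<one> - h) \<cdot> c \<in> M" if "c \<in> effects" for c
      using h effectsD[OF that] by (auto simp: closed_in)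
    have 1: "Re (\<tau> ((x - h) \<cdot> ((\<one> - h) \<cdot> k))) = 0"
      by (rule variational_one_sided[OF x(1,2) hI up dn k])
    have "Re (\<tau> (((\<one> - x) - (\<one> - h)) \<cdot> ((\<one> - (\<one> - h)) \<cdot> k))) = 0"
    proof (rule variational_one_sided[OF _ x(3) effects_compl[OF hI] _ _ k])
      show "\<one> - x \<in> M" using x by (simp add: closed_in)
      show "Re (\<tau> (((\<one> - x) - (\<one> - h)) \<cdot> ((\<one> - (\<one> - h)) \<cdot> c))) \<le> 0" if "c \<in> effects" for c
        using neg[OF m(1)[OF that]] dn[OF that] by simp
      show "0 \<le> Re (\<tau> (((\<one> - x) - (\<one> - h)) \<cdot> ((\<one> - h) \<cdot> c)))" if "c \<in> effects" for c
        using neg[OF m(2)[OF that]] up[OF that] by simp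
    qed
    then have 2: "Re (\<tau> ((x - h) \<cdot> (h \<cdot> k))) = 0" using neg[OF m(1)[OF k]] by simp
    have "(x - h) \<cdot> k = (x - h) \<cdot> ((\<one> - h) \<cdot> k) + (x - h) \<cdot> (h \<cdot> k)"
      by (simp add: op_times.diff_left op_times.diff_right)
    then show ?thesis using 1 2 x h effectsD[OF k] by (simp add: trace_simps)
  qed
  then show ?thesis using that hI by blast
qed

text \<open>Describes the value of the expectation by duality. Faithfulness makes h unique, and
  linearity and the module property can be read off before \<open>cond_exp\<close> is known to be
  well defined.\<close>

definition expects :: "'h op \<Rightarrow> 'h op \<Rightarrow> bool" where
  "expects x h \<longleftrightarrow> h \<in> N \<and> (\<forall>a\<in>N. \<tau> (x \<cdot> a) = \<tau> (h \<cdot> a))"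

lemma expects_unique:
  assumes "expects x h" "expects x h'"
  shows "h = h'"
proof -
  define g where "g = h - h'"
  have g: "g \<in> N" using assms by (simp add: g_def expects_def N.closed_in)
  have hh: "h \<in> M" "h' \<in> M" using assms in_M by (auto simp: expects_def)
  have "\<tau> (g \<cdot> g\<^sup>\<dagger>) = \<tau> (h \<cdot> g\<^sup>\<dagger>) - \<tau> (h' \<cdot> g\<^sup>\<dagger>)"
    using hh in_M[OF g] by (simp add: g_def op_times.diff_left trace_simps)
  also have "\<dots> = 0" using assms N.adj_in[OF g] by (simp add: expects_def)
  finally have "\<tau> (g\<^sup>\<dagger> \<cdot> g) = 0" using trace_commute[of g "g\<^sup>\<dagger>"] in_M[OF g] by (simp add: closed_in)
  then show ?thesis using trace_faithful[OF in_M[OF g]] by (simp add: g_def)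
qed

lemma expects_add:
  "x \<in> M \<Longrightarrow> y \<in> M \<Longrightarrow> expects x h \<Longrightarrow> expects y k \<Longrightarrow> expects (x + y) (h + k)"
  by (auto simp: expects_def op_times.add_left trace_simps in_M N.closed_in)

lemma scaleC_op_times: "scaleC_op c x \<cdot> y = scaleC_op c (x \<cdot> y)"
  by (rule blinfun_eqI) (simp add: scaleC_op_apply)

lemma expects_scaleC: "x \<in> M \<Longrightarrow> expects x h \<Longrightarrow> expects (scaleC_op c x) (scaleC_op c h)"
  by (auto simp: expects_def scaleC_op_times trace_simps in_M N.closed_in)

lemma expects_self: "a \<in> N \<Longrightarrow> expects a a"
  by (simp add: expects_def)

text \<open>Effects span \<open>N\<close>: a self-adjoint s of norm at most c equals 2c k - c with
  the effect k = (c + s)/(2c). This settles real parts; the imaginary part follows by passing from a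
  to \<open>- \<i>\<close> a.\<close>

lemma expects_if_effects:
  assumes y: "y \<in> M" "hermitian y" and 0: "\<And>k. k \<in> effects \<Longrightarrow> Re (\<tau> (y \<cdot> k)) = 0" and a: "a \<in> N"
  shows "\<tau> (y \<cdot> a) = 0"
proof -
  have herm: "Re (\<tau> (y \<cdot> s)) = 0" if s: "s \<in> N" "hermitian s" for s
  proof -
    define c where "c = norm s + 1"
    have c: "c > 0" "norm s \<le> c" by (simp_all add: c_def add_nonneg_pos)
    have "positive_op ((norm s *\<^sub>R \<one> + s) + \<one>)"
      using hermitian_lower_bound[OF s(2)] by (rule positive_closed(1)[OF _ positive_closed(4)])
    moreover have "(norm s *\<^sub>R \<one> + s) + \<one> = c *\<^sub>R \<one> + s" by (simp add: c_def scaleR_add_left)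
    ultimately have p: "positive_op (c *\<^sub>R \<one> + s)" "positive_op (c *\<^sub>R \<one> - s)"
      using positive_norm_minus[OF s(2) c(2)] by simp_all
    define k where "k = (1 / (2 * c)) *\<^sub>R (c *\<^sub>R \<one> + s)"
    have "positive_op k" unfolding k_def using p c by (intro positive_closed(2)) auto
    moreover have "\<one> - k = (1 / (2 * c)) *\<^sub>R (c *\<^sub>R \<one> - s)"
    proof -
      have "\<one> = (1 / (2 * c)) *\<^sub>R ((2 * c) *\<^sub>R (\<one> :: 'h op))" using c by simp
      then have "\<one> - k = (1 / (2 * c)) *\<^sub>R ((2 * c) *\<^sub>R \<one> - (c *\<^sub>R \<one> + s))"
        unfolding k_def by (metis scaleR_diff_right)
      also have "(2 * c) *\<^sub>R \<one> - (c *\<^sub>R \<one> + s) = c *\<^sub>R \<one> - s"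
        unfolding mult_2 scaleR_add_left by simp
      finally show ?thesis .
    qed
    then have "positive_op (\<one> - k)" using p c by (simp add: positive_closed)
    ultimately have k: "k \<in> effects" using s by (simp add: effects_def k_def N.closed_in)
    have "s = (2 * c) *\<^sub>R k - c *\<^sub>R \<one>" using c by (simp add: k_def)
    then have "y \<cdot> s = (2 * c) *\<^sub>R (y \<cdot> k) - c *\<^sub>R (y \<cdot> \<one>)"
      by (metis op_times.diff_right op_times.scaleR_right)
    then have "Re (\<tau> (y \<cdot> s)) = 2 * c * Re (\<tau> (y \<cdot> k)) - c * Re (\<tau> (y \<cdot> \<one>))"
      using y effectsD[OF k] by (simp add: trace_simps)
    then show ?thesis using 0[OF k] 0[OF effects_one] by simp
  qed
  have re: "Re (\<tau> (y \<cdot> b)) = 0" if b: "b \<in> N" for b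
  proof -
    have bb: "b \<in> bounded_operators" "y \<in> bounded_operators" using N.in_bounded b in_bounded y by auto
    have "\<tau> (y \<cdot> b\<^sup>\<dagger>) = \<tau> ((b \<cdot> y)\<^sup>\<dagger>)" using y bb by (simp add: adj_times hermitian_def)
    also have "\<dots> = cnj (\<tau> (y \<cdot> b))"
      using trace_adj[of "b \<cdot> y"] trace_commute[of b y] in_M[OF b] y by (simp add: closed_in)
    finally have "Re (\<tau> (y \<cdot> b\<^sup>\<dagger>)) = Re (\<tau> (y \<cdot> b))" by simp
    moreover have "Re (\<tau> (y \<cdot> (b + b\<^sup>\<dagger>))) = 0"
      using b bb by (intro herm) (auto simp: N.closed_in hermitian_def adj_simps add.commute)
    then have "Re (\<tau> (y \<cdot> b)) + Re (\<tau> (y \<cdot> b\<^sup>\<dagger>)) = 0"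
      using y in_M[OF b] by (simp add: op_times.add_right trace_simps)
    ultimately show ?thesis by simp
  qed
  have "y \<cdot> scaleC_op (- \<i>) a = scaleC_op (- \<i>) (y \<cdot> a)"
    using bounded_operatorsD[OF in_bounded[OF y(1)]] by (intro blinfun_eqI) (simp add: scaleC_op_apply)
  then have "Re (- \<i> * \<tau> (y \<cdot> a)) = 0"
    using re[OF N.scaleC_in[OF a, of "- \<i>"]] y in_M[OF a] by (simp add: trace_simps)
  then show ?thesis using re[OF a] by (simp add: complex_eq_iff)
qed

lemma expects_effect:
  assumes x: "x \<in> M" "positive_op x" "positive_op (\<one> - x)"
  obtains h where "expects x h" "positive_op h"
proof -
  obtain h where h: "h \<in> effects" "\<And>k. k \<in> effects \<Longrightarrow> Re (\<tau> ((x - h) \<cdot> k)) = 0"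
    using effect_expectation[OF x] by metis
  have "\<tau> (x \<cdot> a) = \<tau> (h \<cdot> a)" if a: "a \<in> N" for a
  proof -
    have "hermitian (x - h)"
      using positive_hermitian[OF x(2)] positive_hermitian[OF effectsD(3)[OF h(1)]]
      by (rule hermitian_closed)
    then have "\<tau> ((x - h) \<cdot> a) = 0"
      using expects_if_effects[of "x - h" a] h(2) a x effectsD[OF h(1)] by (simp add: closed_in)
    then show ?thesis using x effectsD[OF h(1)] in_M[OF a] by (simp add: op_times.diff_left trace_simps)
  qed
  then show ?thesis using that h effectsD[OF h(1)] by (auto simp: expects_def)
qed

lemma expects_positive:
  assumes x: "x \<in> M" "positive_op x"
  obtains h where "expects x h" "positive_op h"
proof -
  define c where "c = norm x + 1"
  have c: "c > 0" "norm x \<le> c" by (simp_all add: c_def add_nonneg_pos)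
  define z where "z = (1 / c) *\<^sub>R x"
  have "(1 / c) *\<^sub>R (c *\<^sub>R \<one> - x) = \<one> - z" using c by (simp add: z_def scaleR_diff_right)
  then have "positive_op (\<one> - z)"
    using positive_norm_minus[OF positive_hermitian[OF x(2)] c(2)] c positive_closed(2)[of _ "1 / c"]
    by (metis less_imp_le zero_le_divide_1_iff)
  moreover have "z \<in> M" "positive_op z" using x c by (simp_all add: z_def closed_in positive_closed)
  ultimately obtain h where h: "expects z h" "positive_op h" using expects_effect[of z] by metis
  have "expects (c *\<^sub>R z) (c *\<^sub>R h)"
    using expects_scaleC[OF \<open>z \<in> M\<close> h(1), of "of_real c"] by (simp add: scaleC_op_of_real)
  moreover have "c *\<^sub>R z = x" using c by (simp add: z_def)
  ultimately show ?thesis using that h c positive_closed(2)[of h c] by simp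
qed

lemma expects_exists:
  assumes x: "x \<in> M"
  obtains h where "expects x h"
proof -
  have herm: "\<exists>h. expects s h" if s: "s \<in> M" "hermitian s" for s
  proof -
    have p: "positive_op (norm s *\<^sub>R \<one> + s)" using hermitian_lower_bound[OF s(2)] .
    moreover have m: "norm s *\<^sub>R \<one> + s \<in> M" using s by (simp add: closed_in)
    ultimately obtain h where h: "expects (norm s *\<^sub>R \<one> + s) h" using expects_positive by metis
    have c: "(- norm s) *\<^sub>R \<one> \<in> N" by (intro N.scaleR_in N.one_in)
    have "expects ((norm s *\<^sub>R \<one> + s) + (- norm s) *\<^sub>R \<one>) (h + (- norm s) *\<^sub>R \<one>)"
      by (rule expects_add[OF m in_M[OF c] h expects_self[OF c]])
    then show ?thesis by auto
  qed
  obtain s t where st: "s = (1/2) *\<^sub>R (x + x\<^sup>\<dagger>)" "t = scaleC_op (- \<i>) ((1/2) *\<^sub>R (x - x\<^sup>\<dagger>))"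
    "hermitian s" "hermitian t" "x = s + scaleC_op \<i> t"
    by (rule cartesian_decomposition[OF in_bounded[OF x]]) (rule that)
  have m: "s \<in> M" "t \<in> M" using x by (auto simp: st(1,2) closed_in)
  obtain h k where hk: "expects s h" "expects t k" using herm m st by blast
  have "expects (s + scaleC_op \<i> t) (h + scaleC_op \<i> k)"
    using m hk by (intro expects_add expects_scaleC) (auto simp: closed_in)
  then show ?thesis using that st(5) by metis
qed

abbreviation E :: "'h op \<Rightarrow> 'h op" where "E \<equiv> cond_exp M \<tau> N"

text \<open>Resolves the definite description in \<open>cond_exp\<close>. Any trace preserving
  expectation satisfies \<open>expects\<close> by its module property and so agrees with
  \<open>F\<close> on \<open>M\<close>; outside \<open>M\<close> extensionality forces
  \<open>undefined\<close>, which is why \<open>F\<close> has that default.\<close>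

lemma E_expects:
  assumes x: "x \<in> M"
  shows "expects x (E x)"
proof -
  define F where "F = (\<lambda>x. if x \<in> M then THE h. expects x h else undefined)"
  have F: "expects x (F x)" if x: "x \<in> M" for x
  proof -
    obtain h where h: "expects x h" by (rule expects_exists[OF x]) (rule that)
    then have "F x = h" using x unfolding F_def by (simp add: expects_unique the_equality)
    then show ?thesis using h by simp
  qed
  have F_eq: "F x = h" if "x \<in> M" "expects x h" for x h
    using F[OF that(1)] that(2) by (rule expects_unique)
  have mod: "expects (a \<cdot> x \<cdot> b) (a \<cdot> h \<cdot> b)" if "a \<in> N" "b \<in> N" "x \<in> M" "expects x h" for a b x h
    unfolding expects_def
  proof (intro conjI ballI)
    show "a \<cdot> h \<cdot> b \<in> N" using that by (simp add: expects_def N.closed_in)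
    fix c assume c: "c \<in> N"
    have "\<tau> (a \<cdot> x \<cdot> b \<cdot> c) = \<tau> (x \<cdot> (b \<cdot> c \<cdot> a))"
      using trace_commute[of a "x \<cdot> (b \<cdot> c)"] that in_M c by (simp add: op_times_assoc closed_in)
    also have "\<dots> = \<tau> (h \<cdot> (b \<cdot> c \<cdot> a))" using that c by (simp add: expects_def N.closed_in)
    also have "\<dots> = \<tau> (a \<cdot> h \<cdot> b \<cdot> c)"
      using trace_commute[of a "h \<cdot> (b \<cdot> c)"] that in_M c
      by (simp add: op_times_assoc closed_in expects_def)
    finally show "\<tau> (a \<cdot> x \<cdot> b \<cdot> c) = \<tau> (a \<cdot> h \<cdot> b \<cdot> c)" .
  qed
  have "E = F"
    unfolding cond_exp_def
  proof (rule the_equality)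
    show "conditional_expectation M N F \<and> (\<forall>x\<in>M. \<tau> (F x) = \<tau> x)"
      unfolding conditional_expectation_def
    proof (intro conjI ballI allI impI)
      show "F \<in> M \<rightarrow>\<^sub>E N"
      proof (rule PiE_I)
        show "F x \<in> N" if "x \<in> M" for x using F[OF that] by (simp add: expects_def)
        show "F x = undefined" if "x \<notin> M" for x using that by (simp add: F_def)
      qed
      fix x assume x: "x \<in> M"
      show "F (x + y) = F x + F y" if "y \<in> M" for y
        using x that by (intro F_eq expects_add F) (auto simp: closed_in)
      show "F (scaleC_op c x) = scaleC_op c (F x)" for c
        using x by (intro F_eq expects_scaleC F) (auto simp: closed_in)
      show "positive_op (F x)" if "positive_op x"
        using expects_positive[OF x that] F_eq[OF x] by metis
      show "\<tau> (F x) = \<tau> x" using F[OF x] N.one_in by (force simp: expects_def)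
      show "F (a \<cdot> x \<cdot> b) = a \<cdot> F x \<cdot> b" if "a \<in> N" "b \<in> N" for a b
        using x that in_M by (intro F_eq mod F) (auto simp: closed_in)
    next
      show "F a = a" if "a \<in> N" for a using that in_M by (intro F_eq expects_self)
    qed
  next
    fix G assume G: "conditional_expectation M N G \<and> (\<forall>x\<in>M. \<tau> (G x) = \<tau> x)"
    show "G = F"
    proof
      fix x
      show "G x = F x"
      proof (cases "x \<in> M")
        case True
        have "expects x (G x)"
          unfolding expects_def
        proof (intro conjI ballI)
          show "G x \<in> N" using G True by (auto simp: conditional_expectation_def)
          fix a assume a: "a \<in> N"
          have "G (\<one> \<cdot> x \<cdot> a) = \<one> \<cdot> G x \<cdot> a"
            using G True a N.one_in unfolding conditional_expectation_def by blast
          then have "G (x \<cdot> a) = G x \<cdot> a" by simp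
          moreover have "\<tau> (G (x \<cdot> a)) = \<tau> (x \<cdot> a)" using G True in_M[OF a] by (simp add: closed_in)
          ultimately show "\<tau> (x \<cdot> a) = \<tau> (G x \<cdot> a)" by simp
        qed
        then show ?thesis using F_eq[OF True] by simp
      next
        case False
        then show ?thesis using G by (auto simp: conditional_expectation_def F_def PiE_def extensional_def)
      qed
    qed
  qed
  then show ?thesis using F[OF x] by simp
qed

section \<open>Algebraic and contractive properties of the expectation\<close>

lemma E_eqI: "x \<in> M \<Longrightarrow> expects x h \<Longrightarrow> E x = h"
  using E_expects expects_unique by blast

lemma E_in: "x \<in> M \<Longrightarrow> E x \<in> N"
  using E_expects by (simp add: expects_def)

lemma E_in_M: "x \<in> M \<Longrightarrow> E x \<in> M"
  using E_in in_M by blast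

lemma E_self: "a \<in> N \<Longrightarrow> E a = a"
  by (intro E_eqI expects_self in_M)

lemma E_add: "x \<in> M \<Longrightarrow> y \<in> M \<Longrightarrow> E (x + y) = E x + E y"
  by (intro E_eqI expects_add E_expects) (auto simp: closed_in)

lemma E_scaleR: "x \<in> M \<Longrightarrow> E (r *\<^sub>R x) = r *\<^sub>R E x"
  using E_eqI[OF scaleC_in expects_scaleC[OF _ E_expects], of x "of_real r"]
  by (simp add: scaleC_op_of_real)

lemma E_diff: "x \<in> M \<Longrightarrow> y \<in> M \<Longrightarrow> E (x - y) = E x - E y"
  using E_add[of x "- 1 *\<^sub>R y"] E_scaleR[of y "-1"] scaleR_in[of y "-1"] by simp

lemma E_trace: "x \<in> M \<Longrightarrow> \<tau> (E x) = \<tau> x"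
  using E_expects[of x] N.one_in by (force simp: expects_def)

lemma E_positive: "x \<in> M \<Longrightarrow> positive_op x \<Longrightarrow> positive_op (E x)"
  using expects_positive[of x] E_eqI by metis

lemma E_times_right:
  assumes x: "x \<in> M" and b: "b \<in> N"
  shows "E (x \<cdot> b) = E x \<cdot> b"
proof (rule E_eqI)
  show "x \<cdot> b \<in> M" using x in_M[OF b] by (simp add: closed_in)
  show "expects (x \<cdot> b) (E x \<cdot> b)"
    using E_expects[OF x] b by (auto simp: expects_def op_times_assoc N.closed_in)
qed

lemma E_times_left:
  assumes x: "x \<in> M" and b: "b \<in> N"
  shows "E (b \<cdot> x) = b \<cdot> E x"
proof (rule E_eqI)
  show "b \<cdot> x \<in> M" using x in_M[OF b] by (simp add: closed_in)
  have "\<tau> (b \<cdot> x \<cdot> a) = \<tau> (b \<cdot> E x \<cdot> a)" if a: "a \<in> N" for a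
  proof -
    have "\<tau> (b \<cdot> x \<cdot> a) = \<tau> (x \<cdot> (a \<cdot> b))"
      using trace_commute[of b "x \<cdot> a"] x in_M a b by (simp add: op_times_assoc closed_in)
    also have "\<dots> = \<tau> (E x \<cdot> (a \<cdot> b))" using E_expects[OF x] a b by (simp add: expects_def N.closed_in)
    also have "\<dots> = \<tau> (b \<cdot> E x \<cdot> a)"
      using trace_commute[of b "E x \<cdot> a"] E_in_M[OF x] in_M a b by (simp add: op_times_assoc closed_in)
    finally show ?thesis .
  qed
  then show "expects (b \<cdot> x) (b \<cdot> E x)" using E_in[OF x] b by (auto simp: expects_def N.closed_in)
qed

lemma E_adj:
  assumes x: "x \<in> M"
  shows "E (x\<^sup>\<dagger>) = (E x)\<^sup>\<dagger>"
proof (rule E_eqI)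
  show "x\<^sup>\<dagger> \<in> M" using x by (simp add: closed_in)
  have *: "\<tau> (y\<^sup>\<dagger> \<cdot> a) = cnj (\<tau> (y \<cdot> a\<^sup>\<dagger>))" if y: "y \<in> M" and a: "a \<in> N" for y a
  proof -
    have b: "y \<in> bounded_operators" "a \<in> bounded_operators" using y a in_bounded N.in_bounded by auto
    have "cnj (\<tau> (y \<cdot> a\<^sup>\<dagger>)) = \<tau> (a \<cdot> y\<^sup>\<dagger>)"
      using trace_adj[of "y \<cdot> a\<^sup>\<dagger>"] y in_M[OF a] b by (simp add: closed_in adj_simps)
    then show ?thesis using trace_commute[of a "y\<^sup>\<dagger>"] y in_M[OF a] by (simp add: closed_in)
  qed
  show "expects (x\<^sup>\<dagger>) ((E x)\<^sup>\<dagger>)"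
    using E_expects[OF x] E_in[OF x] *[OF x] *[OF E_in_M[OF x]] by (auto simp: expects_def N.closed_in)
qed

lemma E_orthogonal:
  assumes x: "x \<in> M" and a: "a \<in> N"
  shows "ip (x - E x) a = 0"
proof -
  have "\<tau> (a\<^sup>\<dagger> \<cdot> (x - E x)) = \<tau> ((x - E x) \<cdot> a\<^sup>\<dagger>)"
    using x E_in_M[OF x] in_M[OF a] by (intro trace_commute) (auto simp: closed_in)
  also have "\<dots> = 0"
    using E_expects[OF x] x E_in_M[OF x] in_M[OF a] N.adj_in[OF a]
    by (simp add: expects_def op_times.diff_left trace_simps)
  finally show ?thesis by (simp add: ip_def)
qed

lemma E_Pythagoras:
  assumes x: "x \<in> M"
  shows "ip x x = ip (x - E x) (x - E x) + ip (E x) (E x)"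
  using ip.B_square_add[of "x - E x" "E x" 1] E_orthogonal[OF x E_in[OF x]] x E_in_M[OF x]
  by (simp add: closed_in)

lemma E_norm2_le: "x \<in> M \<Longrightarrow> norm2 \<tau> (E x) \<le> norm2 \<tau> x"
  and E_diff_norm2_le: "x \<in> M \<Longrightarrow> norm2 \<tau> (x - E x) \<le> norm2 \<tau> x"
  using E_Pythagoras[of x] ip.B_nonneg[of "x - E x"] ip.B_nonneg[of "E x"] E_in_M[of x]
  by (simp_all add: norm2_eq closed_in)

text \<open>Positivity of this variance is the Kadison-Schwarz inequality; its vanishing later shows
  that the relative commutant lies in the subalgebra.\<close>

lemma E_variance:
  assumes x: "x \<in> M"
  shows "E ((x - E x)\<^sup>\<dagger> \<cdot> (x - E x)) = E (x\<^sup>\<dagger> \<cdot> x) - (E x)\<^sup>\<dagger> \<cdot> E x"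
proof -
  note m = x E_in_M[OF x] in_bounded[OF x] in_bounded[OF E_in_M[OF x]]
  have "(x - E x)\<^sup>\<dagger> \<cdot> (x - E x) = x\<^sup>\<dagger> \<cdot> x - x\<^sup>\<dagger> \<cdot> E x - ((E x)\<^sup>\<dagger> \<cdot> x - (E x)\<^sup>\<dagger> \<cdot> E x)"
    using m by (simp add: adj_diff op_times.diff_left op_times.diff_right)
  then show ?thesis
    using m E_in[OF x] N.adj_in
    by (simp add: E_diff E_times_left E_times_right E_self N.closed_in closed_in E_adj)
qed

text \<open>E(x)^* E(x) <= E(x^* x) <= |x|^2, where the first inequality is positivity of the
  variance.\<close>

lemma E_norm_le:
  assumes x: "x \<in> M"
  shows "norm (E x) \<le> norm x"
proof -
  note m = x E_in_M[OF x] in_bounded[OF x] in_bounded[OF E_in_M[OF x]]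
  have "positive_op ((norm x)\<^sup>2 *\<^sub>R \<one> - x\<^sup>\<dagger> \<cdot> x)"
    using norm_le_iff_positive[of x "norm x"] m by simp
  then have "positive_op (E ((norm x)\<^sup>2 *\<^sub>R \<one> - x\<^sup>\<dagger> \<cdot> x))"
    using m by (intro E_positive) (auto simp: closed_in)
  moreover have "positive_op (E ((x - E x)\<^sup>\<dagger> \<cdot> (x - E x)))"
    using m by (intro E_positive positive_adj_times) (auto simp: closed_in bounded_operators_closed)
  ultimately have "positive_op (E ((norm x)\<^sup>2 *\<^sub>R \<one> - x\<^sup>\<dagger> \<cdot> x) + E ((x - E x)\<^sup>\<dagger> \<cdot> (x - E x)))"
    by (rule positive_closed)
  also have "E ((norm x)\<^sup>2 *\<^sub>R \<one> - x\<^sup>\<dagger> \<cdot> x) + E ((x - E x)\<^sup>\<dagger> \<cdot> (x - E x))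
     = (norm x)\<^sup>2 *\<^sub>R \<one> - (E x)\<^sup>\<dagger> \<cdot> E x"
    unfolding E_variance[OF x] using m N.one_in by (simp add: E_diff E_self closed_in N.closed_in)
  finally show ?thesis using norm_le_iff_positive[of "E x" "norm x"] m by simp
qed

end

section \<open>Extreme points\<close>

text \<open>
  A smooth variational principle replaces the Krein--Milman theorem: a perturbation
  \<open>\<parallel>x\<parallel>\<^sup>2 - \<Sum>\<^sub>i \<mu>\<^sub>i \<parallel>x - z\<^sub>i\<parallel>\<^sup>2\<close> with \<open>\<Sum>\<^sub>i \<mu>\<^sub>i < 1\<close> attains its maximum over the set, and it is
  strictly convex.
\<close>

lemma (in semi_inner) extreme_point_exists:
  assumes K: "K \<subseteq> V" "K \<noteq> {}" and bd: "\<And>x. x \<in> K \<Longrightarrow> B x x \<le> R"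
    and complete: "\<And>X. (\<And>n. X n \<in> K) \<Longrightarrow>
      (\<And>e. e > 0 \<Longrightarrow> \<exists>N. \<forall>i\<ge>N. \<forall>j\<ge>N. nrm (X i - X j) < e) \<Longrightarrow>
      \<exists>v\<in>K. (\<lambda>n. nrm (X n - v)) \<longlonglongrightarrow> 0"
  obtains v where "v \<in> K" and "\<And>y. y \<in> V \<Longrightarrow> v + y \<in> K \<Longrightarrow> v - y \<in> K \<Longrightarrow> B y y = 0"
proof -
  \<comment> \<open>The weights sum to 1/2, so at least half of the original convexity survives. The
    tolerance \<open>\<epsilon> n\<close> is matched to \<open>\<mu> n\<close> so that later points
    lie within 1/(n+1) of \<open>z n\<close>.\<close>
  define \<mu> where "\<mu> n = (1/2::real) ^ (n + 2)" for n :: nat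
  define \<epsilon> where "\<epsilon> n = \<mu> n * (1 / real (Suc n))\<^sup>2" for n :: nat
  have \<mu>: "\<mu> n > 0" for n by (simp add: \<mu>_def)
  have \<epsilon>: "\<epsilon> n > 0" for n using \<mu> by (simp add: \<epsilon>_def)
  have Bn: "0 \<le> B (x - y) (x - y)" if "x \<in> K" "y \<in> K" for x y
    using that K by (intro B_nonneg V_closed) auto
  \<comment> \<open>\<open>z0\<close> is kept if it is within \<open>e\<close> of the supremum, and
    replaced by a better point otherwise. In both cases the value does not drop, which makes
    \<open>F n (z n)\<close> increase with n.\<close>
  have near_max: "\<exists>z\<in>K. F z0 \<le> F z \<and> (\<forall>x\<in>K. F x \<le> F z + e)"
    if F: "\<And>x. x \<in> K \<Longrightarrow> F x \<le> B x x" and z0: "z0 \<in> K" and e: "e > 0" for F and z0 and e :: real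
  proof -
    have bddF: "bdd_above (F ` K)" using F bd by (meson bdd_above.I2 order_trans)
    have ub: "F x \<le> Sup (F ` K)" if "x \<in> K" for x using that bddF by (simp add: cSup_upper)
    show ?thesis
    proof (cases "Sup (F ` K) - e \<le> F z0")
      case True
      then show ?thesis using ub z0 by (intro bexI[of _ z0]) force+
    next
      case False
      have "\<exists>y\<in>F ` K. Sup (F ` K) - e < y" using e K(2) by (intro less_cSupD) auto
      then obtain z where "z \<in> K" "Sup (F ` K) - e < F z" by auto
      then show ?thesis using ub False by (intro bexI[of _ z]) force+
    qed
  qed
  \<comment> \<open>A stage is a pair of the current function and a nearly maximal point of it;
    \<open>T\<close> subtracts the next penalty, centred at that point.\<close>
  define P where "P n s \<longleftrightarrow> snd s \<in> K \<and> (\<forall>x\<in>K. fst s x \<le> fst s (snd s) + \<epsilon> n) \<and> (\<forall>x\<in>K. fst s x \<le> B x x)"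
    for n and s :: "('a \<Rightarrow> real) \<times> 'a"
  define T where "T n s s' \<longleftrightarrow> fst s' = (\<lambda>x. fst s x - \<mu> n * B (x - snd s) (x - snd s)) \<and>
      fst s' (snd s) \<le> fst s' (snd s')" for n and s s' :: "('a \<Rightarrow> real) \<times> 'a"
  have "\<exists>f. f 0 \<in> {s. P 0 s \<and> fst s = (\<lambda>x. B x x)} \<and> (\<forall>n. P n (f n) \<and> T n (f n) (f (Suc n)))"
  proof -
    obtain z0 where z0: "z0 \<in> K" using K by auto
    obtain z where z: "z \<in> K" "\<forall>x\<in>K. B x x \<le> B z z + \<epsilon> 0"
      using near_max[of "\<lambda>x. B x x" z0 "\<epsilon> 0"] z0 \<epsilon> by auto
    have start: "P 0 ((\<lambda>x. B x x), z)" using z by (simp add: P_def)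
    have step: "\<exists>s'. P (Suc n) s' \<and> T n s s'" if s: "P n s" for n s
    proof -
      define F where "F = (\<lambda>x. fst s x - \<mu> n * B (x - snd s) (x - snd s))"
      have FB: "F x \<le> B x x" if x: "x \<in> K" for x
      proof -
        have "0 \<le> \<mu> n * B (x - snd s) (x - snd s)" using s x \<mu>[of n] Bn by (simp add: P_def)
        then show ?thesis using s x by (force simp: F_def P_def)
      qed
      obtain z' where z': "z' \<in> K" "F (snd s) \<le> F z'" "\<forall>x\<in>K. F x \<le> F z' + \<epsilon> (Suc n)"
        using near_max[of F "snd s" "\<epsilon> (Suc n)"] FB s \<epsilon> by (auto simp: P_def)
      have "P (Suc n) (F, z')" "T n s (F, z')" using z' FB by (simp_all add: P_def T_def F_def)
      then show ?thesis by blast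
    qed
    define f where "f = rec_nat ((\<lambda>x. B x x), z) (\<lambda>n s. SOME s'. P (Suc n) s' \<and> T n s s')"
    have f0: "f 0 = ((\<lambda>x. B x x), z)" by (simp add: f_def)
    have fS: "f (Suc n) = (SOME s'. P (Suc n) s' \<and> T n (f n) s')" for n by (simp add: f_def)
    have Pf: "P n (f n)" for n
    proof (induction n)
      case 0 then show ?case using start f0 by simp
    next
      case (Suc n) then show ?case unfolding fS using someI_ex[OF step[OF Suc]] by blast
    qed
    have "T n (f n) (f (Suc n))" for n unfolding fS using someI_ex[OF step[OF Pf]] by blast
    then show ?thesis using Pf f0 start by (intro exI[of _ f]) auto
  qed
  then obtain f where f: "fst (f 0) = (\<lambda>x. B x x)" "\<And>n. P n (f n)" "\<And>n. T n (f n) (f (Suc n))" by auto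
  define F z where "F n = fst (f n)" and "z n = snd (f n)" for n
  have F0: "F 0 x = B x x" for x using f(1) by (simp add: F_def)
  have FS: "F (Suc n) x = F n x - \<mu> n * B (x - z n) (x - z n)" for n x
    using f(3)[of n] by (simp add: T_def F_def z_def)
  have zK: "z n \<in> K" for n using f(2)[of n] by (simp add: P_def z_def)
  then have zV: "z n \<in> V" for n using K by auto
  have B0: "B 0 0 = 0" using B_scale_left[of 0 0 0] V_closed(4) by simp
  have up: "F n x \<le> F n (z n) + \<epsilon> n" if "x \<in> K" for n x
    using f(2)[of n] that by (simp add: P_def F_def z_def)
  have "F (Suc n) (z n) \<le> F (Suc n) (z (Suc n))" for n
    using f(3)[of n] unfolding T_def F_def z_def by (rule conjunct2)
  then have Lstep: "F n (z n) \<le> F (Suc n) (z (Suc n))" for n by (simp add: FS B0)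
  have Lmono: "F n (z n) \<le> F m (z m)" if "n \<le> m" for n m
    using lift_Suc_mono_le[of "\<lambda>n. F n (z n)", OF Lstep that] .
  have Fstep: "F (Suc n) x \<le> F n x" if x: "x \<in> K" for n x
    using \<mu>[of n] Bn[OF x zK] by (simp add: FS)
  have Fmono: "F m x \<le> F n x" if "n \<le> m" "x \<in> K" for n m x
    using lift_Suc_antimono_le[of "\<lambda>n. F n x", OF Fstep[OF that(2)] that(1)] .
  have close: "nrm (z m - z n) \<le> 1 / real (Suc n)" if nm: "n \<le> m" for n m
  proof (cases "m = n")
    case True then show ?thesis by (simp add: B0)
  next
    case False
    have "F n (z n) \<le> F m (z m)" by (rule Lmono[OF nm])
    also have "\<dots> \<le> F (Suc n) (z m)" using False nm zK by (intro Fmono) auto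
    also have "\<dots> = F n (z m) - \<mu> n * B (z m - z n) (z m - z n)" by (rule FS)
    also have "F n (z m) \<le> F n (z n) + \<epsilon> n" by (rule up[OF zK])
    finally have "\<mu> n * B (z m - z n) (z m - z n) \<le> \<mu> n * (1 / real (Suc n))\<^sup>2" by (simp add: \<epsilon>_def)
    then have "B (z m - z n) (z m - z n) \<le> (1 / real (Suc n))\<^sup>2" using \<mu>[of n] by simp
    then show ?thesis by (intro real_le_lsqrt) auto
  qed
  have "\<exists>N. \<forall>i\<ge>N. \<forall>j\<ge>N. nrm (z i - z j) < e" if e: "e > 0" for e
  proof -
    obtain N where N: "1 / real (Suc N) < e / 2" using nat_approx_posE[of "e/2"] e by auto
    have "nrm (z i - z j) < e" if "i \<ge> N" "j \<ge> N" for i j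
    proof -
      have "nrm (z i - z j) = nrm ((z i - z N) - (z j - z N))" by simp
      also have "\<dots> \<le> nrm (z i - z N) + nrm (z j - z N)"
        using zV by (intro nrm_triangle_diff V_closed)
      finally show ?thesis using close[OF that(1)] close[OF that(2)] N by linarith
    qed
    then show ?thesis by blast
  qed
  then obtain v where v: "v \<in> K" and lim: "(\<lambda>n. nrm (z n - v)) \<longlonglongrightarrow> 0"
    using complete[of z] zK by blast
  have vV: "v \<in> V" using v K by auto
  have Flim: "(\<lambda>m. F n (z m)) \<longlonglongrightarrow> F n v" for n
  proof (induction n)
    case 0
    show ?case unfolding F0 using nrm_tendsto[OF zV vV lim V_closed(4)] by simp
  next
    case (Suc n)
    show ?case unfolding FS
      by (intro tendsto_diff Suc tendsto_mult tendsto_const nrm_tendsto[OF zV vV lim zV])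
  qed
  have vmax: "F n (z n) \<le> F n v" for n
  proof (rule LIMSEQ_le_const[OF Flim])
    show "\<exists>N. \<forall>m\<ge>N. F n (z n) \<le> F n (z m)"
      using Lmono Fmono zK by (meson order_trans)
  qed
  have "B y y = 0" if y: "y \<in> V" "v + y \<in> K" "v - y \<in> K" for y
  proof -
    \<comment> \<open>The coefficient is 2 (1 - sum of the first n weights) = 1 + 2^(-n). That it
      never falls below 1 is the uniform convexity needed at the end.\<close>
    have par: "F n (v + y) + F n (v - y) = 2 * F n v + (1 + (1/2) ^ n) * B y y" for n
    proof (induction n)
      case 0
      show ?case using B_parallelogram[OF vV y(1)] by (simp add: F0)
    next
      case (Suc n)
      have e: "v + y - z n = (v - z n) + y" "v - y - z n = (v - z n) - y" by simp_all
      have p: "B (v + y - z n) (v + y - z n) + B (v - y - z n) (v - y - z n)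
          = 2 * B (v - z n) (v - z n) + 2 * B y y"
        unfolding e by (rule B_parallelogram) (use vV zV y V_closed in auto)
      have "F (Suc n) (v + y) + F (Suc n) (v - y) = (F n (v + y) + F n (v - y))
        - \<mu> n * (B (v + y - z n) (v + y - z n) + B (v - y - z n) (v - y - z n))"
        by (simp add: FS distrib_left)
      also have "\<dots> = 2 * F (Suc n) v + (1 + (1/2) ^ Suc n) * B y y"
        unfolding Suc p FS by (simp add: \<mu>_def algebra_simps)
      finally show ?case .
    qed
    have By: "0 \<le> B y y" by (rule B_nonneg[OF y(1)])
    \<comment> \<open>Neither v + y nor v - y exceeds the value of \<open>F m\<close> at v by more
      than \<open>\<epsilon> m\<close>, whereas by \<open>par\<close> the two excesses sum to at
      least \<open>B y y\<close>.\<close>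
    have "0 \<le> - B y y"
    proof (rule nonneg_from_remainder)
      fix n :: nat
      define m where "m = n + 1"
      have "B y y \<le> (1 + (1/2) ^ m) * B y y" using By by (simp add: distrib_right)
      also have "\<dots> = F m (v + y) + F m (v - y) - 2 * F m v" using par[of m] by simp
      also have "\<dots> \<le> 2 * \<epsilon> m" using up[OF y(2), of m] up[OF y(3), of m] vmax[of m] by linarith
      also have "\<dots> \<le> 1 / real (Suc m)"
      proof -
        have "(1/2::real) ^ m \<le> 1" by (simp add: power_le_one)
        then have "\<mu> m \<le> 1/2" by (simp add: \<mu>_def)
        moreover have "(1 / real (Suc m))\<^sup>2 \<le> 1 / real (Suc m)" unfolding power2_eq_square by (rule mult_left_le) simp_all
        ultimately have "\<mu> m * (1 / real (Suc m))\<^sup>2 \<le> 1/2 * (1 / real (Suc m))"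
          by (intro mult_mono) auto
        then show ?thesis unfolding \<epsilon>_def by linarith
      qed
      finally show "- 1 / real (n + 2) \<le> - B y y" by (simp add: m_def)
    qed
    then show ?thesis using By by simp
  qed
  then show ?thesis using that v by blast
qed

section \<open>Equivalent complementary projections\<close>

context tracial_factor
begin

text \<open>Faithfulness is given only on \<open>x\<^sup>\<dagger> \<cdot> x\<close>. For y of trace
  0 the trace of y (|y| - y) is nonnegative and equals minus the trace of y^2, so y has trace norm
  0.\<close>

lemma trace_positive_faithful:
  assumes y: "y \<in> M" "positive_op y" and 0: "Re (\<tau> y) = 0"
  shows "y = 0"
proof -
  have "0 \<le> Re (\<tau> (y \<cdot> (norm y *\<^sub>R \<one> - y)))"
    using y positive_norm_minus[OF positive_hermitian[OF y(2)], of "norm y"]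
    by (intro trace_times_positive) (auto simp: closed_in)
  also have "\<dots> = - Re (\<tau> (y \<cdot> y))"
    using y 0 by (simp add: op_times.diff_right op_times.scaleR_right trace_simps)
  also have "Re (\<tau> (y \<cdot> y)) = ip y y"
    using positive_hermitian[OF y(2)] by (simp add: ip_def hermitian_def)
  finally show ?thesis using ip.B_nonneg[OF y(1)] by (intro ip_faithful y) simp
qed

text \<open>
  An extreme point \<open>x\<close> of the unit ball of \<open>p M (1 - p)\<close> is a partial isometry, and
  \<open>(p - x x\<^sup>*) M (1 - p - x\<^sup>* x) = 0\<close>, so one of the two factors vanishes; equality of traces
  makes the other one vanish as well.
\<close>

lemma half_projections_equivalent:
  assumes p: "p \<in> M" "hermitian p" "p \<cdot> p = p" "Re (\<tau> p) = 1/2"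
  obtains v where "v \<in> M" "v \<cdot> v\<^sup>\<dagger> = p" "v\<^sup>\<dagger> \<cdot> v = \<one> - p"
proof -
  define q where "q = \<one> - p"
  have q: "q \<in> M" "hermitian q" "q \<cdot> q = q" "Re (\<tau> q) = 1/2"
    using p by (auto simp: q_def trace_simps hermitian_closed op_times.diff_left op_times.diff_right)
  have pq: "p\<^sup>\<dagger> = p" "q\<^sup>\<dagger> = q" using p q by (auto simp: hermitian_def)
  define K where "K = {x \<in> M. norm x \<le> 1 \<and> p \<cdot> x \<cdot> q = x}"
  have comp: "\<exists>v\<in>K. (\<lambda>n. ip.nrm (X n - v)) \<longlonglongrightarrow> 0"
    if X: "\<And>n. X n \<in> K" and C: "\<And>e. e > 0 \<Longrightarrow> \<exists>N. \<forall>i\<ge>N. \<forall>j\<ge>N. ip.nrm (X i - X j) < e" for X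
  proof -
    have XM: "\<And>n. X n \<in> M" "\<And>n. norm (X n) \<le> 1" using X by (auto simp: K_def)
    obtain v where v: "v \<in> M" "norm v \<le> 1" "\<And>\<xi>. (\<lambda>n. X n \<xi>) \<longlonglongrightarrow> blinfun_apply v \<xi>"
      "(\<lambda>n. ip.nrm (X n - v)) \<longlonglongrightarrow> 0"
      by (rule ball_complete[OF XM C]) (assumption, rule that)
    have "p \<cdot> v \<cdot> q = v"
    proof (rule blinfun_eqI, rule LIMSEQ_unique)
      fix \<xi>
      show "(\<lambda>n. p (X n (q \<xi>))) \<longlonglongrightarrow> (p \<cdot> v \<cdot> q) \<xi>"
        using bounded_linear.tendsto[OF blinfun.bounded_linear_right v(3)] by simp
      have "p (X n (q \<xi>)) = X n \<xi>" for n
        using X[of n] by (simp add: K_def) (metis blinfun_apply_blinfun_compose)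
      then show "(\<lambda>n. p (X n (q \<xi>))) \<longlonglongrightarrow> v \<xi>" using v(3) by simp
    qed
    then show ?thesis using v by (auto simp: K_def)
  qed
  have ne: "K \<noteq> {}" by (auto simp: K_def zero_in intro!: exI[of _ 0])
  have le1: "ip x x \<le> 1" if "x \<in> K" for x
    using order_trans[OF norm2_le_norm[of x], of 1] that by (auto simp: K_def norm2_eq)
  have sub: "K \<subseteq> M" by (auto simp: K_def)
  obtain x where x: "x \<in> K"
    and ext: "\<And>y. y \<in> M \<Longrightarrow> x + y \<in> K \<Longrightarrow> x - y \<in> K \<Longrightarrow> ip y y = 0"
    by (rule ip.extreme_point_exists[OF sub ne le1 comp]) (assumption+, rule that)
  have xM: "x \<in> M" and xn: "norm x \<le> 1" and pxq: "p \<cdot> x \<cdot> q = x" using x by (auto simp: K_def)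
  have xb: "x \<in> bounded_operators" by (rule in_bounded[OF xM])
  have px: "p \<cdot> x = x" by (metis op_times_assoc p(3) pxq)
  have xq: "x \<cdot> q = x" by (metis op_times_assoc q(3) pxq)
  have xp': "x\<^sup>\<dagger> \<cdot> p = x\<^sup>\<dagger>" using px adj_times[of p x] xb in_bounded[OF p(1)] pq by simp
  have qx': "q \<cdot> x\<^sup>\<dagger> = x\<^sup>\<dagger>" using xq adj_times[of x q] xb in_bounded[OF q(1)] pq by simp
  define h k where "h = x\<^sup>\<dagger> \<cdot> x" and "k = x \<cdot> x\<^sup>\<dagger>"
  have hM: "h \<in> M" "k \<in> M" using xM by (auto simp: h_def k_def closed_in)
  have hq: "h \<cdot> q = h" "q \<cdot> h = h"
    using xq qx' by (simp_all add: h_def op_times_assoc flip: op_times_assoc[of q])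
  have h': "h\<^sup>\<dagger> = h" "k\<^sup>\<dagger> = k" using xb by (auto simp: h_def k_def adj_simps)
  have hb: "h \<in> bounded_operators" "k \<in> bounded_operators" using hM in_bounded by auto
  define r where "r = \<one> - h"
  have rpos: "positive_op r" using norm_le_iff_positive[OF xb, of 1] xn by (simp add: r_def h_def)
  have r: "r \<in> M" "r\<^sup>\<dagger> = r" "r \<in> bounded_operators"
    using hM h' hb by (auto simp: r_def closed_in adj_simps)
  have xh: "x \<cdot> h = x"
  proof -
    \<comment> \<open>In terms of a polar decomposition with modulus t, x + y and x - y have moduli
      (3t - t^3)/2 and (t + t^3)/2, which stay in [0, 1] for t in [0, 1]. Extremality then gives x r
      = 0.\<close>
    define y where "y = (1/2) *\<^sub>R (x \<cdot> r)"
    have yM: "y \<in> M" using xM r by (simp add: y_def closed_in)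
    have pyq: "p \<cdot> y \<cdot> q = y"
    proof -
      have "p \<cdot> (x \<cdot> r) \<cdot> q = x \<cdot> r"
        using px xq hq
        by (simp add: r_def op_times.diff_left op_times.diff_right op_times_assoc
            flip: op_times_assoc[of p])
      then show ?thesis by (simp add: y_def op_times.scaleR_left op_times.scaleR_right)
    qed
    have "norm (x - y) \<le> 1"
    proof -
      have "x - y = (1/2) *\<^sub>R (x + x \<cdot> h)"
      proof -
        have "x - y = (1/2) *\<^sub>R (2 *\<^sub>R x - (x - x \<cdot> h))"
          by (simp add: y_def r_def op_times.diff_right scaleR_diff_right)
        then show ?thesis by (simp add: scaleR_2)
      qed
      moreover have "norm (x + x \<cdot> h) \<le> 1 + 1"
      proof (rule norm_triangle_mono[OF xn])
        have "norm (x\<^sup>\<dagger>) \<le> 1" using norm_adj_le[OF xb] xn by linarith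
        then have "norm h \<le> 1"
          using norm_blinfun_compose[of "x\<^sup>\<dagger>" x] xn mult_le_one[of "norm (x\<^sup>\<dagger>)" "norm x"]
          by (simp add: h_def)
        then show "norm (x \<cdot> h) \<le> 1"
          using norm_blinfun_compose[of x h] xn mult_le_one[of "norm x" "norm h"] by simp
      qed
      ultimately show ?thesis by simp
    qed
    moreover have "norm (x + y) \<le> 1"
    proof -
      define s where "s = \<one> + (1/2) *\<^sub>R r"
      have "x + y = x \<cdot> s" by (simp add: s_def y_def op_times.add_right op_times.scaleR_right)
      then have "(x + y)\<^sup>\<dagger> \<cdot> (x + y) = s\<^sup>\<dagger> \<cdot> h \<cdot> s"
        using xb r by (simp add: s_def adj_simps h_def op_times_assoc)
      also have "s\<^sup>\<dagger> = s" using r by (simp add: s_def adj_simps)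
      \<comment> \<open>(1 + r/2)^2 (1 - r) = 1 - (3/4) r^2 - (1/4) r^3.\<close>
      also have "s \<cdot> h \<cdot> s = \<one> - ((3/4) *\<^sub>R (r\<^sup>\<dagger> \<cdot> r) + (1/4) *\<^sub>R (r\<^sup>\<dagger> \<cdot> r \<cdot> r))"
      proof -
        have e: "h = \<one> - r" by (simp add: r_def)
        have c: "(a + b) *\<^sub>R v = a *\<^sub>R v + b *\<^sub>R v" for a b and v :: 'h by (rule scaleR_add_left)
        have three: "(3/4) *\<^sub>R v = (1/2) *\<^sub>R v + (1/4) *\<^sub>R v" for v :: 'h
          using c[of "1/2" "1/4" v] by simp
        have half: "v = (1/2) *\<^sub>R v + (1/2) *\<^sub>R v" for v :: 'h
          using c[of "1/2" "1/2" v] by simp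
        have quarter: "(1/2) *\<^sub>R v = (1/4) *\<^sub>R v + (1/4) *\<^sub>R v" for v :: 'h
          using c[of "1/4" "1/4" v] by simp
        show ?thesis
          unfolding r(2) s_def e
        proof (rule blinfun_eqI)
          fix \<xi>
          show "((\<one> + (1/2) *\<^sub>R r) \<cdot> (\<one> - r) \<cdot> (\<one> + (1/2) *\<^sub>R r)) \<xi> =
             (\<one> - ((3/4) *\<^sub>R (r \<cdot> r) + (1/4) *\<^sub>R (r \<cdot> r \<cdot> r))) \<xi>"
            using half[of "r \<xi>"] quarter[of "r (r \<xi>)"] half[of "r (r \<xi>)"] quarter[of "r (r (r \<xi>))"]
              half[of "r (r (r \<xi>))"] three[of "r (r \<xi>)"]
            by (simp add: op_simps algebra_simps)
        qed
      qed
      finally have "\<one> - (x + y)\<^sup>\<dagger> \<cdot> (x + y) = (3/4) *\<^sub>R (r\<^sup>\<dagger> \<cdot> r) + (1/4) *\<^sub>R (r\<^sup>\<dagger> \<cdot> r \<cdot> r)" by simp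
      moreover have "positive_op \<dots>"
        using r rpos by (intro positive_closed positive_adj_times positive_sandwich) auto
      ultimately show ?thesis
        using norm_le_iff_positive[of "x + y" 1] in_bounded[OF add_in[OF xM yM]] by simp
    qed
    ultimately have "ip y y = 0"
      using xM yM pxq pyq
      by (intro ext) (auto simp: K_def closed_in op_times.add_left op_times.add_right
          op_times.diff_left op_times.diff_right)
    then have "y = 0" by (rule ip_faithful[OF yM])
    then show ?thesis by (simp add: y_def r_def op_times.diff_right)
  qed
  have hh: "h \<cdot> h = h" using xh by (simp add: h_def op_times_assoc)
  have hx': "h \<cdot> x\<^sup>\<dagger> = x\<^sup>\<dagger>" using arg_cong[OF xh, of adj] xb hb h' by (simp add: adj_times)
  have kk: "k \<cdot> k = k"
  proof -
    have "k \<cdot> k = x \<cdot> (h \<cdot> x\<^sup>\<dagger>)" by (simp add: k_def h_def op_times_assoc)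
    then show ?thesis by (simp add: hx' k_def)
  qed
  have kp: "k \<cdot> p = k" "p \<cdot> k = k"
    using px xp' by (simp_all add: k_def op_times_assoc flip: op_times_assoc[of p])
  have xk': "x\<^sup>\<dagger> \<cdot> (p - k) = 0"
    using xp' hx' by (simp add: op_times.diff_right k_def h_def flip: op_times_assoc)
  have g1: "(q - h) \<cdot> (q - h) = q - h" "(q - h)\<^sup>\<dagger> = q - h"
    and g2: "(p - k) \<cdot> (p - k) = p - k" "(p - k)\<^sup>\<dagger> = p - k"
    using p q pq hq hh h' kk kp hb in_bounded
    by (simp_all add: op_times.diff_left op_times.diff_right adj_diff)
  have gpos: "positive_op (q - h)" "positive_op (p - k)" "positive_op p"
    using positive_adj_times[of "q - h"] positive_adj_times[of "p - k"] positive_adj_times[of p]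
      g1 g2 pq p q hb in_bounded by (auto simp: bounded_operators_closed)
  have pert: "x + y \<in> K" if y: "y \<in> M" "norm y \<le> 1" "(p - k) \<cdot> y = y" "y \<cdot> (q - h) = y" for y
  proof -
    have yb: "y \<in> bounded_operators" by (rule in_bounded[OF y(1)])
    have xy: "x\<^sup>\<dagger> \<cdot> y = 0" using xk' y(3) by (metis blinfun_compose_zero(1) op_times_assoc)
    have "y\<^sup>\<dagger> \<cdot> x = (x\<^sup>\<dagger> \<cdot> y)\<^sup>\<dagger>" using xb yb by (simp add: adj_simps)
    then have yx: "y\<^sup>\<dagger> \<cdot> x = 0" using xy by simp
    have pp: "p \<cdot> (p - k) = p - k" "(q - h) \<cdot> q = q - h"
      using p(3) kp hq q(3) by (simp_all add: op_times.diff_left op_times.diff_right)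
    have py: "p \<cdot> y = y" "y \<cdot> q = y"
      by (metis op_times_assoc pp(1) y(3), metis op_times_assoc pp(2) y(4))
    have y': "(q - h) \<cdot> y\<^sup>\<dagger> = y\<^sup>\<dagger>"
      using arg_cong[OF y(4), of adj] adj_times[of y "q - h"] yb g1
          positive_bounded[OF gpos(1)] by simp
    have "(x + y)\<^sup>\<dagger> \<cdot> (x + y) = h + y\<^sup>\<dagger> \<cdot> y"
      using xb yb xy yx by (simp add: adj_add op_times.add_left op_times.add_right h_def)
    moreover have "(q - h)\<^sup>\<dagger> \<cdot> (\<one> - y\<^sup>\<dagger> \<cdot> y) \<cdot> (q - h) = (q - h) - y\<^sup>\<dagger> \<cdot> y"
    proof -
      have "(q - h)\<^sup>\<dagger> \<cdot> (\<one> - y\<^sup>\<dagger> \<cdot> y) \<cdot> (q - h)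
          = (q - h) \<cdot> (q - h) - ((q - h) \<cdot> y\<^sup>\<dagger>) \<cdot> (y \<cdot> (q - h))"
        unfolding g1(2) by (simp only: op_times.diff_right[of "q - h" \<one>] op_times.diff_left[of _ _ "q - h"]
            op_times_one op_times_assoc)
      then show ?thesis by (simp only: g1(1) y' y(4))
    qed
    ultimately have e: "\<one> - (x + y)\<^sup>\<dagger> \<cdot> (x + y) = p + (q - h)\<^sup>\<dagger> \<cdot> (\<one> - y\<^sup>\<dagger> \<cdot> y) \<cdot> (q - h)"
      by (simp add: q_def)
    have "positive_op (\<one> - y\<^sup>\<dagger> \<cdot> y)" using norm_le_iff_positive[OF yb, of 1] y(2) by simp
    then have "positive_op (p + (q - h)\<^sup>\<dagger> \<cdot> (\<one> - y\<^sup>\<dagger> \<cdot> y) \<cdot> (q - h))"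
      using gpos positive_bounded by (intro positive_closed(1) positive_sandwich) auto
    then have "norm (x + y) \<le> 1"
      using norm_le_iff_positive[of "x + y" 1] e in_bounded[OF add_in[OF xM y(1)]] by simp
    then show ?thesis
      using xM y(1) pxq py
      by (simp add: K_def closed_in op_times.add_left op_times.add_right)
  qed
  have "(p - k) \<cdot> m \<cdot> (q - h) = 0" if m: "m \<in> M" for m
  proof -
    define w where "w = (p - k) \<cdot> m \<cdot> (q - h)"
    have wM: "w \<in> M" using m p q hM by (simp add: w_def closed_in)
    have wabs: "(p - k) \<cdot> w = w" "w \<cdot> (q - h) = w"
      unfolding w_def by (metis g2(1) op_times_assoc, metis g1(1) op_times_assoc)
    define t where "t = 1 / (norm w + 1)"
    have n: "norm w + 1 > 0" using norm_ge_zero[of w] by linarith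
    have t: "t > 0" using n by (simp add: t_def)
    have nw: "norm (t *\<^sub>R w) \<le> 1" using n by (simp add: t_def)
    have twM: "t *\<^sub>R w \<in> M" "- (t *\<^sub>R w) \<in> M"
      using scaleR_in[OF wM, of t] scaleR_in[OF wM, of "- t"] by simp_all
    have "x + t *\<^sub>R w \<in> K"
      by (rule pert[OF twM(1) nw]) (simp_all only: op_times.scaleR_left op_times.scaleR_right wabs)
    moreover have "x + - (t *\<^sub>R w) \<in> K"
      by (rule pert[OF twM(2)])
        (simp_all only: norm_minus_cancel nw op_times.minus_left op_times.minus_right
          op_times.scaleR_left op_times.scaleR_right wabs)
    ultimately have "ip (t *\<^sub>R w) (t *\<^sub>R w) = 0" using twM by (intro ext) simp_all
    then have "t *\<^sub>R w = 0" using wM by (intro ip_faithful) (auto simp: closed_in)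
    then show ?thesis using t by (simp add: w_def)
  qed
  then consider "p - k = 0" | "q - h = 0"
    using factor_prime[OF diff_in[OF p(1) hM(2)] diff_in[OF q(1) hM(1)]] by blast
  then have "p = k \<and> q = h"
  proof cases
    \<comment> \<open>Traciality gives p - k and q - h the same trace 1/2 - Re
      \<open>\<tau> h\<close>; both are positive, so once one is 0 the other is 0 by
      faithfulness.\<close>
    have hk: "Re (\<tau> h) = Re (\<tau> k)" using trace_commute[of x "x\<^sup>\<dagger>"] xM by (simp add: h_def k_def closed_in)
    {
      case 1
      have "Re (\<tau> (q - h)) = 0" using 1 hk p q hM by (simp add: trace_simps)
      then show ?thesis using trace_positive_faithful[OF _ gpos(1)] 1 q hM by (simp add: closed_in)
    next
      case 2
      have "Re (\<tau> (p - k)) = 0" using 2 hk p q hM by (simp add: trace_simps)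
      then show ?thesis using trace_positive_faithful[OF _ gpos(2)] 2 p hM by (simp add: closed_in)
    }
  qed
  then have "k = p" "h = q" by simp_all
  then show ?thesis using that[OF xM] unfolding h_def k_def q_def by blast
qed

end

context abelian_subalgebra
begin

text \<open>a + a (1 - a) b = a (1 - a) (1 + b) + a^2, with complement (1 - a)^2 + a (1 - a) (1 -
  b). The factor a (1 - a) makes room on both sides.\<close>

lemma effects_perturb:
  assumes a: "a \<in> effects" and b: "b \<in> N" "positive_op (\<one> + b)" "positive_op (\<one> - b)"
  shows "a + a \<cdot> (\<one> - a) \<cdot> b \<in> effects"
proof -
  have m: "a \<in> N" "\<one> - a \<in> N" "\<one> + b \<in> N" "\<one> - b \<in> N"
    using effectsD[OF a] b by (auto simp: N.closed_in)
  note pos = effectsD(3,4)[OF a]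
  have "positive_op (a \<cdot> (\<one> - a) \<cdot> (\<one> + b))" "positive_op (a \<cdot> a)"
    "positive_op ((\<one> - a) \<cdot> (\<one> - a))" "positive_op (a \<cdot> (\<one> - a) \<cdot> (\<one> - b))"
    using m pos b by (simp_all only: N_positive_times N.times_in)
  then have "positive_op (a \<cdot> (\<one> - a) \<cdot> (\<one> + b) + a \<cdot> a)"
    and "positive_op ((\<one> - a) \<cdot> (\<one> - a) + a \<cdot> (\<one> - a) \<cdot> (\<one> - b))"
    by (simp_all only: positive_closed(1))
  moreover have "a \<cdot> (\<one> - a) \<cdot> (\<one> + b) + a \<cdot> a = a + a \<cdot> (\<one> - a) \<cdot> b"
    by (simp add: op_times.add_right op_times.diff_right op_times.diff_left)
  moreover have "(\<one> - a) \<cdot> (\<one> - a) + a \<cdot> (\<one> - a) \<cdot> (\<one> - b) = \<one> - (a + a \<cdot> (\<one> - a) \<cdot> b)"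
    by (simp add: op_times.add_right op_times.diff_right op_times.diff_left)
  ultimately show ?thesis using m b by (simp add: effects_def N.closed_in)
qed

text \<open>
  An extreme point \<open>a\<close> of the effects of trace 1/2 is a projection: otherwise \<open>a (1 - a)\<close> spans a
  one-dimensional ideal of \<open>N\<close>, and \<open>N\<close> would contain a minimal projection.
\<close>

lemma half_projection_exists:
  assumes rc: "\<And>x. x \<in> M \<Longrightarrow> (\<And>a. a \<in> N \<Longrightarrow> x \<cdot> a = a \<cdot> x) \<Longrightarrow> x \<in> N"
    and cont: "\<And>e. e \<in> M \<Longrightarrow> projection e \<Longrightarrow> abelian ((\<lambda>x. e \<cdot> x \<cdot> e) ` M) \<Longrightarrow> e = 0"
  obtains p where "p \<in> N" "hermitian p" "p \<cdot> p = p" "Re (\<tau> p) = 1/2"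
proof -
  define K where "K = {a \<in> effects. Re (\<tau> a) = 1/2}"
  have ip_one: "ip x \<one> = Re (\<tau> x)" for x by (simp add: ip_def)
  have comp: "\<exists>v\<in>K. (\<lambda>n. ip.nrm (X n - v)) \<longlonglongrightarrow> 0"
    if X: "\<And>n. X n \<in> K" and C: "\<And>e. e > 0 \<Longrightarrow> \<exists>N. \<forall>i\<ge>N. \<forall>j\<ge>N. ip.nrm (X i - X j) < e" for X
  proof -
    have XI: "X n \<in> effects" for n using X by (simp add: K_def)
    obtain v where v: "v \<in> M" "\<And>\<xi>. (\<lambda>n. X n \<xi>) \<longlonglongrightarrow> blinfun_apply v \<xi>"
      "(\<lambda>n. ip.nrm (X n - v)) \<longlonglongrightarrow> 0"
      by (rule ball_complete[OF effectsD(2)[OF XI] effects_norm[OF XI] C]) (assumption, rule that)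
    have half: "Re (\<tau> (X n)) = 1/2" for n using X by (simp add: K_def)
    have "\<bar>1/2 - Re (\<tau> v)\<bar> \<le> ip.nrm (X n - v)" for n
      using ip.Cauchy_Schwarz[OF diff_in[OF effectsD(2)[OF XI] v(1)] one_in, of n]
        effectsD(2)[OF XI] v(1)
      unfolding half[of n, symmetric] by (simp add: ip_one trace_simps)
    then have "\<bar>1/2 - Re (\<tau> v)\<bar> \<le> 0"
      by (intro LIMSEQ_le_const[OF v(3)]) auto
    then show ?thesis using effects_limit[OF XI v(2)] v(3) by (auto simp: K_def)
  qed
  have ne: "(1/2) *\<^sub>R \<one> \<in> K"
    using effects_convex[OF effects_compl[OF effects_one] effects_one, of "1/2"] one_in
    by (simp add: K_def trace_simps)
  have le1: "ip x x \<le> 1" if "x \<in> K" for x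
    using order_trans[OF norm2_le_norm[of x] effects_norm[of x]] that effectsD(2)[of x]
    by (simp add: K_def norm2_eq)
  have sub: "K \<subseteq> M" using effectsD(2) by (auto simp: K_def)
  have ne': "K \<noteq> {}" using ne by auto
  obtain a where a: "a \<in> K"
    and ext: "\<And>y. y \<in> M \<Longrightarrow> a + y \<in> K \<Longrightarrow> a - y \<in> K \<Longrightarrow> ip y y = 0"
    by (rule ip.extreme_point_exists[OF sub ne' le1 comp]) (assumption+, rule that)
  have aI: "a \<in> effects" and at: "Re (\<tau> a) = 1/2" using a by (auto simp: K_def)
  define h where "h = a \<cdot> (\<one> - a)"
  have hN: "h \<in> N" unfolding h_def using effectsD[OF aI] by (simp add: N.closed_in)
  have hpos: "positive_op h" unfolding h_def
    using effectsD[OF aI] by (intro N_positive_times) (auto simp: N.closed_in)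
  have hM: "h \<in> M" by (rule in_M[OF hN])
  \<comment> \<open>After scaling b to norm at most 1, both a + h b and a - h b are effects of trace
    1/2, so extremality of a forces h b = 0.\<close>
  have ideal: "h \<cdot> b = 0" if b: "b \<in> N" "hermitian b" "Re (\<tau> (h \<cdot> b)) = 0" for b
  proof -
    have n: "norm b + 1 > 0" using norm_ge_zero[of b] by linarith
    define t where "t = 1 / (norm b + 1)"
    have t: "t > 0" using n by (simp add: t_def)
    define c where "c = t *\<^sub>R b"
    have c: "c \<in> N" "hermitian c" using b by (auto simp: c_def N.closed_in hermitian_closed)
    have nc: "norm c \<le> 1" using n by (simp add: c_def t_def)
    have pm: "positive_op (\<one> - c)" using positive_norm_minus[OF c(2) nc] by simp
    have "positive_op ((norm c *\<^sub>R \<one> + c) + (1 - norm c) *\<^sub>R \<one>)"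
      using nc by (intro positive_closed hermitian_lower_bound c) auto
    then have pp: "positive_op (\<one> + c)" by (simp add: algebra_simps)
    have hc: "h \<cdot> c \<in> M" using hM in_M[OF c(1)] by (simp add: closed_in)
    have tr: "Re (\<tau> (h \<cdot> c)) = 0"
      using b hM in_M[OF b(1)] by (simp add: c_def op_times.scaleR_right trace_simps)
    have "a + h \<cdot> c \<in> K"
      using effects_perturb[OF aI c(1) pp pm] at tr effectsD(2)[OF aI] hc
      by (simp add: K_def h_def trace_simps)
    moreover have "a - h \<cdot> c \<in> K"
      using effects_perturb[OF aI, of "- c"] pp pm at tr effectsD(2)[OF aI] hc N.scaleR_in[OF c(1), of "-1"]
      by (simp add: K_def h_def trace_simps op_times.minus_right)
    ultimately have "h \<cdot> c = 0" by (intro ip_faithful ext hc)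
    then show ?thesis using t by (simp add: c_def op_times.scaleR_right)
  qed
  have "h = 0"
  proof (rule ccontr)
    assume h0: "h \<noteq> 0"
    define s where "s = Re (\<tau> h)"
    have s: "s > 0"
      using trace_positive[OF hM hpos] trace_positive_faithful[OF hM hpos] h0 unfolding s_def by linarith
    \<comment> \<open>Subtracting from b the multiple c of 1 that makes the trace of h (b - c)
      vanish brings \<open>ideal\<close> into play.\<close>
    have scal: "\<exists>c::real. h \<cdot> b = c *\<^sub>R h" if b: "b \<in> N" "hermitian b" for b
    proof -
      define c where "c = Re (\<tau> (h \<cdot> b)) / s"
      have "h \<cdot> (b - c *\<^sub>R \<one>) = 0"
      proof (rule ideal)
        show "b - c *\<^sub>R \<one> \<in> N" using b by (simp add: N.closed_in)
        show "hermitian (b - c *\<^sub>R \<one>)" using b by (simp add: hermitian_closed)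
        have "Re (\<tau> (h \<cdot> (b - c *\<^sub>R \<one>))) = Re (\<tau> (h \<cdot> b)) - c * s"
          using hM in_M[OF b(1)] by (simp add: op_times.diff_right op_times.scaleR_right trace_simps s_def)
        then show "Re (\<tau> (h \<cdot> (b - c *\<^sub>R \<one>))) = 0" using s by (simp add: c_def)
      qed
      then show ?thesis by (auto simp: op_times.diff_right op_times.scaleR_right)
    qed
    note hh' = positive_hermitian[OF hpos]
    obtain c where c: "h \<cdot> h = c *\<^sub>R h" using scal[OF hN hh'] by blast
    have c0: "c \<noteq> 0"
    proof
      assume "c = 0"
      then have "ip h h = 0" using c hh' by (simp add: ip_def hermitian_def trace_zero)
      then show False using h0 ip_faithful[OF hM] by simp
    qed
    \<comment> \<open>As h^2 = c h, dividing by c turns h into a projection.\<close>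
    define e where "e = (1 / c) *\<^sub>R h"
    have eN: "e \<in> N" using hN by (simp add: e_def N.closed_in)
    have ee: "e \<cdot> e = e" using c c0 by (simp add: e_def op_times.scaleR_left op_times.scaleR_right)
    have "projection e"
      using hh' ee hermitian_closed(3)[OF hh', of "1 / c"] by (simp add: projection_def hermitian_def e_def)
    have escal: "\<exists>c. e \<cdot> b = scaleC_op c e" if b: "b \<in> N" for b
    proof -
      obtain x y where xy: "x = (1/2) *\<^sub>R (b + b\<^sup>\<dagger>)" "y = scaleC_op (- \<i>) ((1/2) *\<^sub>R (b - b\<^sup>\<dagger>))"
        "hermitian x" "hermitian y" "b = x + scaleC_op \<i> y"
        by (rule cartesian_decomposition[OF N.in_bounded[OF b]]) (rule that)
      have m: "x \<in> N" "y \<in> N" using b by (auto simp: xy(1,2) N.closed_in)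
      obtain c1 c2 where c12: "h \<cdot> x = c1 *\<^sub>R h" "h \<cdot> y = c2 *\<^sub>R h" using scal m xy by metis
      have "h \<cdot> b = scaleC_op (Complex c1 c2) h"
      proof (rule blinfun_eqI)
        fix \<xi>
        have "h (x \<xi>) = c1 *\<^sub>R h \<xi>" "h (y \<xi>) = c2 *\<^sub>R h \<xi>"
          using arg_cong[OF c12(1), of "\<lambda>T. blinfun_apply T \<xi>"]
            arg_cong[OF c12(2), of "\<lambda>T. blinfun_apply T \<xi>"] by (simp_all add: op_simps)
        then have "(h \<cdot> b) \<xi> = c1 *\<^sub>R h \<xi> + \<i> *\<^sub>C c2 *\<^sub>R h \<xi>"
          unfolding xy(5)
          by (simp add: op_simps scaleC_op_apply bounded_operatorsD[OF in_bounded[OF hM]])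
        also have "\<dots> = (of_real c1 + \<i> * of_real c2) *\<^sub>C h \<xi>"
          by (simp add: scaleC_add_left scaleC_of_real flip: scaleC_scaleC)
        finally show "(h \<cdot> b) \<xi> = (scaleC_op (Complex c1 c2) h) \<xi>"
          by (simp add: scaleC_op_apply Complex_eq)
      qed
      then have "e \<cdot> b = scaleC_op (Complex c1 c2) e"
        unfolding e_def op_times.scaleR_left
        by (intro blinfun_eqI) (simp add: scaleC_op_apply op_simps scaleC_scaleR)
      then show ?thesis ..
    qed
    \<comment> \<open>Elements of \<open>N\<close> act on e as scalars, so e x e commutes with
      \<open>N\<close> and lies in \<open>N\<close> by \<open>rc\<close>. The corner of e is thus
      commutative, which type II excludes for e nonzero.\<close>
    have corner: "e \<cdot> x \<cdot> e \<in> N" if x: "x \<in> M" for x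
    proof (rule rc)
      show "e \<cdot> x \<cdot> e \<in> M" using x in_M[OF eN] by (simp add: closed_in)
      fix b assume b: "b \<in> N"
      obtain d where d: "e \<cdot> b = scaleC_op d e" using escal[OF b] by blast
      have "e \<cdot> x \<cdot> e \<cdot> b = e \<cdot> x \<cdot> scaleC_op d e" by (simp add: op_times_assoc d)
      also have "\<dots> = scaleC_op d e \<cdot> (x \<cdot> e)"
        using bounded_operatorsD[OF in_bounded[OF x]] bounded_operatorsD[OF N.in_bounded[OF eN]]
        by (intro blinfun_eqI) (simp add: scaleC_op_apply)
      also have "scaleC_op d e = b \<cdot> e" using d N_commute[OF eN b] by simp
      finally show "e \<cdot> x \<cdot> e \<cdot> b = b \<cdot> (e \<cdot> x \<cdot> e)" by (simp add: op_times_assoc)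
    qed
    have "abelian ((\<lambda>x. e \<cdot> x \<cdot> e) ` M)"
      unfolding abelian_def using corner N_commute by blast
    then have "e = 0" using cont[OF in_M[OF eN]] \<open>projection e\<close> by blast
    then show False using h0 c0 by (simp add: e_def)
  qed
  then have "a \<cdot> a = a" by (simp add: h_def op_times.diff_right)
  then show ?thesis using that effectsD[OF aI] at positive_hermitian by blast
qed

end

section \<open>Unitaries and asymptotic homomorphisms\<close>

text \<open>Makes the conjugate of \<open>A\<close> by a unitary a von Neumann algebra, so that the
  existence of expectations applies to it as well.\<close>

lemma commutant_conjugate:
  assumes w: "unitary w" and S: "S \<subseteq> bounded_operators"
  shows "commutant (conjugate w S) = conjugate w (commutant S)"
proof -
  have wb: "w \<in> bounded_operators" "w\<^sup>\<dagger> \<in> bounded_operators"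
    and ww: "w\<^sup>\<dagger> \<cdot> w = \<one>" "w \<cdot> w\<^sup>\<dagger> = \<one>"
    using w by (auto simp: unitary_def adj_bounded)
  have cancel: "w\<^sup>\<dagger> \<cdot> (w \<cdot> x) = x" "w \<cdot> (w\<^sup>\<dagger> \<cdot> x) = x" for x
    by (simp_all add: ww flip: op_times_assoc)
  show ?thesis
  proof (intro equalityI subsetI)
    fix T assume T: "T \<in> commutant (conjugate w S)"
    then have Tb: "T \<in> bounded_operators" by (simp add: commutant_def)
    define R where "R = w\<^sup>\<dagger> \<cdot> T \<cdot> w"
    have "R \<cdot> s = s \<cdot> R" if s: "s \<in> S" for s
    proof -
      have "T \<cdot> (w \<cdot> s \<cdot> w\<^sup>\<dagger>) = (w \<cdot> s \<cdot> w\<^sup>\<dagger>) \<cdot> T"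
        using T s by (auto simp: commutant_def conjugate_def)
      then have "w\<^sup>\<dagger> \<cdot> (T \<cdot> (w \<cdot> s \<cdot> w\<^sup>\<dagger>)) \<cdot> w = w\<^sup>\<dagger> \<cdot> ((w \<cdot> s \<cdot> w\<^sup>\<dagger>) \<cdot> T) \<cdot> w" by simp
      then show ?thesis by (simp add: R_def op_times_assoc cancel ww)
    qed
    then have "R \<in> commutant S" using wb Tb by (simp add: commutant_def R_def bounded_operators_closed)
    moreover have "T = w \<cdot> R \<cdot> w\<^sup>\<dagger>" by (simp add: R_def op_times_assoc cancel ww)
    ultimately show "T \<in> conjugate w (commutant S)" by (auto simp: conjugate_def)
  next
    fix T assume "T \<in> conjugate w (commutant S)"
    then obtain R where R: "R \<in> commutant S" "T = w \<cdot> R \<cdot> w\<^sup>\<dagger>" by (auto simp: conjugate_def)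
    have "T \<cdot> (w \<cdot> s \<cdot> w\<^sup>\<dagger>) = (w \<cdot> s \<cdot> w\<^sup>\<dagger>) \<cdot> T" if s: "s \<in> S" for s
    proof -
      have "R \<cdot> s = s \<cdot> R" using R(1) s by (simp add: commutant_def)
      then have "w \<cdot> (R \<cdot> s) \<cdot> w\<^sup>\<dagger> = w \<cdot> (s \<cdot> R) \<cdot> w\<^sup>\<dagger>" by simp
      then show ?thesis by (simp add: R(2) op_times_assoc cancel)
    qed
    moreover have "T \<in> bounded_operators" using R wb by (simp add: commutant_def bounded_operators_closed)
    ultimately show "T \<in> commutant (conjugate w S)" by (auto simp: commutant_def conjugate_def)
  qed
qed

lemma von_neumann_algebra_conjugate:
  assumes N: "von_neumann_algebra N" and w: "unitary w"
  shows "von_neumann_algebra (conjugate w N)"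
proof -
  interpret von_neumann N by standard (rule N)
  have wb: "w \<in> bounded_operators" "w\<^sup>\<dagger> \<in> bounded_operators" using w by (auto simp: unitary_def adj_bounded)
  have "conjugate w N \<subseteq> bounded_operators"
    using wb in_bounded by (auto simp: conjugate_def bounded_operators_closed)
  moreover have "\<forall>x\<in>conjugate w N. x\<^sup>\<dagger> \<in> conjugate w N"
    using wb in_bounded adj_in by (auto simp: conjugate_def adj_simps op_times_assoc)
  moreover have "commutant (commutant (conjugate w N)) = conjugate w N"
    using commutant_conjugate[OF w] in_bounded commutant_bounded bicommutant
    by (simp add: subsetI)
  ultimately show ?thesis by (simp add: von_neumann_algebra_def)
qed

lemma norm_partial_isometry_le:
  assumes v: "v \<in> bounded_operators" and idem: "(v\<^sup>\<dagger> \<cdot> v) \<cdot> (v\<^sup>\<dagger> \<cdot> v) = v\<^sup>\<dagger> \<cdot> v"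
  shows "norm v \<le> 1"
proof -
  define p where "p = \<one> - v\<^sup>\<dagger> \<cdot> v"
  have pb: "p \<in> bounded_operators" "p\<^sup>\<dagger> = p" using v by (auto simp: p_def adj_simps)
  have "p \<cdot> p = p" using idem by (simp add: p_def op_times.diff_left op_times.diff_right)
  then have "positive_op p" using positive_adj_times[OF pb(1)] pb(2) by simp
  then show ?thesis using norm_le_iff_positive[OF v, of 1] by (simp add: p_def)
qed

lemma norm_unitary_le: "unitary w \<Longrightarrow> norm w \<le> 1"
  by (rule norm_partial_isometry_le) (auto simp: unitary_def)

context tracial_factor
begin

lemma ip_times_unitary:
  assumes z: "z \<in> M" and w: "w \<in> M" "unitary w"
  shows "ip (z \<cdot> w) (z \<cdot> w) = ip z z"
proof -
  have b: "z \<in> bounded_operators" "w \<in> bounded_operators" using z w in_bounded by auto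
  have "\<tau> ((z \<cdot> w)\<^sup>\<dagger> \<cdot> (z \<cdot> w)) = \<tau> (w\<^sup>\<dagger> \<cdot> ((z\<^sup>\<dagger> \<cdot> z) \<cdot> w))" using b by (simp add: adj_times op_times_assoc)
  also have "\<dots> = \<tau> ((z\<^sup>\<dagger> \<cdot> z) \<cdot> (w \<cdot> w\<^sup>\<dagger>))"
    using trace_commute[of "w\<^sup>\<dagger>" "(z\<^sup>\<dagger> \<cdot> z) \<cdot> w"] z w by (simp add: closed_in op_times_assoc)
  finally show ?thesis using w(2) by (simp add: ip_def unitary_def)
qed

end

text \<open>\<open>U n\<close> stands for the power u^n with n >= 0: the limit over the integers is
  restricted to a sequence of unitaries of \<open>A\<close>.\<close>

locale asymptotic = abelian_subalgebra M \<tau> A for M :: "'h::complex_hilbert_space op set" and \<tau> A +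
  fixes U :: "nat \<Rightarrow> 'h op"
  assumes U_in: "U n \<in> A" and U_unitary: "unitary (U n)"
    and asymp: "x \<in> M \<Longrightarrow> y \<in> M \<Longrightarrow>
      (\<lambda>n. norm2 \<tau> (E (x \<cdot> U n \<cdot> y) - E x \<cdot> E y \<cdot> U n)) \<longlonglongrightarrow> 0"
begin

section \<open>Maximality, strong singularity and the Popa invariant\<close>

lemma U_in_M: "U n \<in> M"
  using U_in in_M by blast

lemma relative_commutant:
  assumes x: "x \<in> M" and comm: "\<And>a. a \<in> A \<Longrightarrow> x \<cdot> a = a \<cdot> x"
  shows "x \<in> A"
proof -
  have mult: "E (z \<cdot> y) = E z \<cdot> E y"
    if z: "z \<in> M" "\<And>a. a \<in> A \<Longrightarrow> z \<cdot> a = a \<cdot> z" and y: "y \<in> M" for z y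
  proof -
    define d where "d = E (z \<cdot> y) - E z \<cdot> E y"
    have zy: "z \<cdot> y \<in> M" using z y by (simp add: closed_in)
    have dM: "d \<in> M" using z y zy by (simp add: d_def closed_in E_in_M)
    \<comment> \<open>The unitary factor does not change the trace norm, so the sequence is constant
      and its limit 0 is its value.\<close>
    have "norm2 \<tau> (E (z \<cdot> U n \<cdot> y) - E z \<cdot> E y \<cdot> U n) = norm2 \<tau> d" for n
    proof -
      have "z \<cdot> U n \<cdot> y = U n \<cdot> (z \<cdot> y)" using z(2)[OF U_in] by (simp add: op_times_assoc)
      then have "E (z \<cdot> U n \<cdot> y) = E (z \<cdot> y) \<cdot> U n"
        using E_times_left[OF zy U_in] N_commute[OF U_in E_in[OF zy]] by simp
      then have "E (z \<cdot> U n \<cdot> y) - E z \<cdot> E y \<cdot> U n = d \<cdot> U n" by (simp add: d_def op_times.diff_left)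
      then show ?thesis using ip_times_unitary[OF dM U_in_M U_unitary] by (simp add: norm2_eq)
    qed
    then have "(\<lambda>n. norm2 \<tau> d) \<longlonglongrightarrow> 0" using asymp[OF z(1) y] by simp
    then have "norm2 \<tau> d = 0" by (simp add: LIMSEQ_const_iff)
    then have "d = 0" using ip_faithful[OF dM] by (simp add: norm2_eq)
    then show ?thesis by (simp add: d_def)
  qed
  have xb: "x \<in> bounded_operators" by (rule in_bounded[OF x])
  have "x\<^sup>\<dagger> \<cdot> a = a \<cdot> x\<^sup>\<dagger>" if a: "a \<in> A" for a
  proof -
    have ab: "a \<in> bounded_operators" by (rule N.in_bounded[OF a])
    have "(x \<cdot> a\<^sup>\<dagger>)\<^sup>\<dagger> = (a\<^sup>\<dagger> \<cdot> x)\<^sup>\<dagger>" using comm[OF N.adj_in[OF a]] by simp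
    then show ?thesis using xb ab by (simp add: adj_simps)
  qed
  then have "E (x\<^sup>\<dagger> \<cdot> x) = (E x)\<^sup>\<dagger> \<cdot> E x"
    using mult[of "x\<^sup>\<dagger>" x] x E_adj[OF x] by (simp add: closed_in)
  then have "E ((x - E x)\<^sup>\<dagger> \<cdot> (x - E x)) = 0" by (simp add: E_variance[OF x])
  moreover have dM: "x - E x \<in> M" using x E_in_M by (simp add: closed_in)
  ultimately have "\<tau> ((x - E x)\<^sup>\<dagger> \<cdot> (x - E x)) = 0"
    using E_trace[of "(x - E x)\<^sup>\<dagger> \<cdot> (x - E x)"] by (simp add: closed_in trace_zero)
  then have "x - E x = 0" by (rule trace_faithful[OF dM])
  then show ?thesis using E_in[OF x] by simp
qed

lemma masa: "masa M A"
  unfolding masa_def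
proof (intro conjI allI impI)
  show "self_adjoint_subalgebra M A"
    using sub by (auto simp: self_adjoint_subalgebra_def N.closed_in)
  show "abelian A" by (rule abel)
  fix B assume B: "self_adjoint_subalgebra M B \<and> abelian B \<and> A \<subseteq> B"
  have "b \<in> A" if b: "b \<in> B" for b
  proof (rule relative_commutant)
    show "b \<in> M" using B b by (auto simp: self_adjoint_subalgebra_def)
    show "b \<cdot> a = a \<cdot> b" if "a \<in> A" for a using B b that by (auto simp: abelian_def)
  qed
  then show "B = A" using B by auto
qed

text \<open>For z = x u^n y Pythagoras gives |z - E z|^2 = s - |E z|^2, and |E z| is at most |E x E
  y| plus a null sequence. Both suprema enter as \<open>D\<close>, with y the adjoint of x.\<close>

lemma residual_le_limit:
  assumes xy: "x \<in> M" "y \<in> M"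
    and s: "\<And>n. ip (x \<cdot> U n \<cdot> y) (x \<cdot> U n \<cdot> y) = s"
    and D: "\<And>n. norm2 \<tau> (x \<cdot> U n \<cdot> y - E (x \<cdot> U n \<cdot> y)) \<le> D"
  shows "s - ip (E x \<cdot> E y) (E x \<cdot> E y) \<le> D\<^sup>2"
proof -
  define c where "c = ip.nrm (E x \<cdot> E y)"
  define e where "e n = norm2 \<tau> (E (x \<cdot> U n \<cdot> y) - E x \<cdot> E y \<cdot> U n)" for n
  have m: "x \<cdot> U n \<cdot> y \<in> M" "E x \<cdot> E y \<in> M" for n
    using xy U_in_M E_in_M by (auto simp: closed_in)
  have "s - (e n + c)\<^sup>2 \<le> D\<^sup>2" for n
  proof -
    define z where "z = x \<cdot> U n \<cdot> y"
    have zM: "z \<in> M" "z - E z \<in> M" "E z \<in> M" using m(1)[of n] E_in_M by (auto simp: z_def closed_in)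
    have pM: "E x \<cdot> E y \<cdot> U n \<in> M" using m(2) U_in_M by (simp add: closed_in)
    have "ip.nrm (E z) = ip.nrm ((E z - E x \<cdot> E y \<cdot> U n) + E x \<cdot> E y \<cdot> U n)" by simp
    also have "\<dots> \<le> ip.nrm (E z - E x \<cdot> E y \<cdot> U n) + ip.nrm (E x \<cdot> E y \<cdot> U n)"
      using zM pM by (intro ip.nrm_triangle) (auto simp: closed_in)
    also have "\<dots> = e n + c"
      using ip_times_unitary[OF m(2) U_in_M U_unitary] by (simp add: e_def z_def c_def norm2_eq)
    finally have "ip.nrm (E z) \<le> e n + c" .
    then have "(ip.nrm (E z))\<^sup>2 \<le> (e n + c)\<^sup>2" using ip.B_nonneg[OF zM(3)] by (intro power_mono) auto
    then have "ip (E z) (E z) \<le> (e n + c)\<^sup>2" using ip.B_nonneg[OF zM(3)] by simp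
    moreover have "(ip.nrm (z - E z))\<^sup>2 \<le> D\<^sup>2"
      using D[of n] ip.B_nonneg[OF zM(2)] by (intro power_mono) (auto simp: z_def norm2_eq)
    then have "ip (z - E z) (z - E z) \<le> D\<^sup>2" using ip.B_nonneg[OF zM(2)] by simp
    moreover have "s = ip (z - E z) (z - E z) + ip (E z) (E z)"
      using E_Pythagoras[OF zM(1)] s[of n] by (simp add: z_def)
    ultimately show ?thesis by linarith
  qed
  moreover have "(\<lambda>n. s - (e n + c)\<^sup>2) \<longlonglongrightarrow> s - (0 + c)\<^sup>2"
    using asymp[OF xy] unfolding e_def by (intro tendsto_intros)
  ultimately have "s - (0 + c)\<^sup>2 \<le> D\<^sup>2" by (intro LIMSEQ_le_const2[of "\<lambda>n. s - (e n + c)\<^sup>2"]) auto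
  then show ?thesis using ip.B_nonneg[OF m(2)] by (simp add: c_def)
qed

lemma strong_singularity:
  assumes w: "w \<in> M" "unitary w"
  shows "norm2 \<tau> (w - E w) \<le> norm_inf2 M \<tau> (\<lambda>x. cond_exp M \<tau> (conjugate w A) x - E x)"
proof -
  have wb: "w \<in> bounded_operators" by (rule in_bounded[OF w(1)])
  have ww: "w\<^sup>\<dagger> \<cdot> w = \<one>" "w \<cdot> w\<^sup>\<dagger> = \<one>" using w(2) by (auto simp: unitary_def)
  have w': "w\<^sup>\<dagger> \<in> M" "unitary (w\<^sup>\<dagger>)" using w wb ww by (auto simp: closed_in unitary_def adj_simps)
  interpret C: abelian_subalgebra M \<tau> "conjugate w A"
  proof
    show "von_neumann_algebra (conjugate w A)" by (rule von_neumann_algebra_conjugate[OF N.vN w(2)])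
    show "conjugate w A \<subseteq> M" using w w' in_M by (auto simp: conjugate_def closed_in)
    have cancel: "w\<^sup>\<dagger> \<cdot> (w \<cdot> x) = x" for x by (simp add: ww flip: op_times_assoc)
    show "abelian (conjugate w A)"
      using N_left_commute by (auto simp: abelian_def conjugate_def op_times_assoc cancel)
  qed
  define D where "D = norm_inf2 M \<tau> (\<lambda>x. cond_exp M \<tau> (conjugate w A) x - E x)"
  \<comment> \<open>The supremum lives in the reals and dominates its members only once boundedness
    is known.\<close>
  have bdd: "bdd_above ((\<lambda>x. norm2 \<tau> (C.E x - E x)) ` {x \<in> M. norm x \<le> 1})"
  proof (rule bdd_aboveI2)
    fix x assume x: "x \<in> {x \<in> M. norm x \<le> 1}"
    have "norm2 \<tau> (C.E x - E x) \<le> norm2 \<tau> (C.E x) + norm2 \<tau> (E x)"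
      unfolding norm2_eq using x by (intro ip.nrm_triangle_diff E_in_M C.E_in_M) auto
    also have "\<dots> \<le> norm2 \<tau> x + norm2 \<tau> x"
      using x by (intro add_mono E_norm2_le C.E_norm2_le) auto
    also have "\<dots> \<le> 1 + 1" using x norm2_le_norm[of x] by auto
    finally show "norm2 \<tau> (C.E x - E x) \<le> 1 + 1" .
  qed
  have D_ge: "norm2 \<tau> (C.E x - E x) \<le> D" if "x \<in> M" "norm x \<le> 1" for x
    unfolding D_def norm_inf2_def using that by (intro cSUP_upper bdd) auto
  have "1 - ip (E w \<cdot> E (w\<^sup>\<dagger>)) (E w \<cdot> E (w\<^sup>\<dagger>)) \<le> D\<^sup>2"
  proof (rule residual_le_limit[OF w(1) w'(1)])
    fix n
    have uU: "unitary (U n)" by (rule U_unitary)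
    have one: "ip \<one> \<one> = 1" by (simp add: ip_def trace_one)
    have "ip (\<one> \<cdot> w \<cdot> U n \<cdot> w\<^sup>\<dagger>) (\<one> \<cdot> w \<cdot> U n \<cdot> w\<^sup>\<dagger>) = ip \<one> \<one>"
      using w w' U_in_M uU one_in by (simp only: ip_times_unitary closed_in)
    then show "ip (w \<cdot> U n \<cdot> w\<^sup>\<dagger>) (w \<cdot> U n \<cdot> w\<^sup>\<dagger>) = 1" using one by simp
    \<comment> \<open>The expectation onto the conjugate fixes this element, so the difference of
      the two expectations there is the residual for \<open>E\<close>.\<close>
    have "w \<cdot> U n \<cdot> w\<^sup>\<dagger> \<in> conjugate w A" using U_in by (auto simp: conjugate_def)
    then have "C.E (w \<cdot> U n \<cdot> w\<^sup>\<dagger>) = w \<cdot> U n \<cdot> w\<^sup>\<dagger>" by (rule C.E_self)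
    moreover have "norm (w \<cdot> U n \<cdot> w\<^sup>\<dagger>) \<le> 1"
    proof -
      have "norm (w \<cdot> U n) \<le> 1"
        using norm_blinfun_compose[of w "U n"] mult_le_one[of "norm w" "norm (U n)"]
          norm_unitary_le[OF w(2)] norm_unitary_le[OF uU] by simp
      then show ?thesis
        using norm_blinfun_compose[of "w \<cdot> U n" "w\<^sup>\<dagger>"] mult_le_one[of "norm (w \<cdot> U n)" "norm (w\<^sup>\<dagger>)"]
          norm_unitary_le[OF w'(2)] by simp
    qed
    ultimately show "norm2 \<tau> (w \<cdot> U n \<cdot> w\<^sup>\<dagger> - E (w \<cdot> U n \<cdot> w\<^sup>\<dagger>)) \<le> D"
      using D_ge[of "w \<cdot> U n \<cdot> w\<^sup>\<dagger>"] w w' U_in_M by (simp add: closed_in)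
  qed
  moreover have "ip (E w \<cdot> E (w\<^sup>\<dagger>)) (E w \<cdot> E (w\<^sup>\<dagger>)) \<le> ip (E w) (E w)"
  proof -
    have "norm (E (w\<^sup>\<dagger>)) \<le> 1" using E_norm_le[OF w'(1)] norm_unitary_le[OF w'(2)] by linarith
    then have "(norm (E (w\<^sup>\<dagger>)))\<^sup>2 \<le> 1" by (simp add: power_le_one)
    then have "(norm (E (w\<^sup>\<dagger>)))\<^sup>2 * ip (E w) (E w) \<le> 1 * ip (E w) (E w)"
      using ip.B_nonneg[OF E_in_M[OF w(1)]] by (rule mult_right_mono)
    then show ?thesis using ip_times_le(2)[OF E_in_M[OF w'(1)] E_in_M[OF w(1)]] by linarith
  qed
  moreover have "ip (w - E w) (w - E w) = 1 - ip (E w) (E w)"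
    using E_Pythagoras[OF w(1)] by (simp add: ip_def ww trace_one)
  ultimately have "ip (w - E w) (w - E w) \<le> D\<^sup>2" by linarith
  moreover have "0 \<le> D"
    using D_ge[OF zero_in] ip.B_nonneg[of "C.E 0 - E 0"] E_in_M[OF zero_in] C.E_in_M[OF zero_in]
    by (simp add: norm2_eq closed_in order_trans[OF real_sqrt_ge_zero])
  ultimately show ?thesis unfolding D_def[symmetric] norm2_eq by (intro real_le_lsqrt)
qed

text \<open>Upper bound: y = y p gives |y|_2 <= |p|_2 = |q|_2 for contractions y. Lower bound: v u^n
  v^* has trace norm |q|_2, and E v = p (E v) q = (p q) E v = 0. The upper bound is what keeps the
  invariant from exceeding 1.\<close>

lemma popa_distance_eq:
  assumes v: "v \<in> popa_partial_isometries M A"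
  shows "popa_distance M \<tau> (conjugate v A) A = norm2 \<tau> (v\<^sup>\<dagger> \<cdot> v)"
proof -
  define p q where "p = v \<cdot> v\<^sup>\<dagger>" and "q = v\<^sup>\<dagger> \<cdot> v"
  have vM: "v \<in> M" and pq: "p \<in> A" "q \<in> A" "p \<cdot> q = 0" and qq: "q \<cdot> q = q"
    using v by (auto simp: popa_partial_isometries_def partial_isometry_def projection_def p_def q_def)
  have vb: "v \<in> bounded_operators" by (rule in_bounded[OF vM])
  have v'M: "v\<^sup>\<dagger> \<in> M" using vM by (rule adj_in)
  note qM = in_M[OF pq(2)] and pM = in_M[OF pq(1)]
  have herm: "p\<^sup>\<dagger> = p" "q\<^sup>\<dagger> = q" using vb by (auto simp: p_def q_def adj_simps)
  have vq: "v \<cdot> q = v"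
  proof -
    have dM: "v - v \<cdot> q \<in> M" using vM qM by (simp add: closed_in)
    have "(v - v \<cdot> q)\<^sup>\<dagger> \<cdot> (v - v \<cdot> q) = q - q \<cdot> q - (q \<cdot> q - q \<cdot> (q \<cdot> q))"
      using vb in_bounded[OF qM] herm
      by (simp add: adj_diff adj_times bounded_operators_closed op_times.diff_left op_times.diff_right
          op_times_assoc q_def[symmetric])
        (simp add: q_def op_times_assoc)
    then have "\<tau> ((v - v \<cdot> q)\<^sup>\<dagger> \<cdot> (v - v \<cdot> q)) = 0" by (simp add: qq trace_zero)
    then show ?thesis using trace_faithful[OF dM] by simp
  qed
  have pv: "p \<cdot> v = v" using vq by (simp add: p_def q_def op_times_assoc)
  have pp: "p \<cdot> p = p" using pv by (simp add: p_def flip: op_times_assoc)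
  have nv: "norm v \<le> 1" using norm_partial_isometry_le[OF vb] qq by (simp add: q_def)
  have nv': "norm (v\<^sup>\<dagger>) \<le> 1" using norm_adj_le[OF vb] nv by linarith
  have ip_pq: "ip p p = ip q q"
    using trace_commute[OF vM v'M] by (simp add: ip_def herm pp qq) (simp add: p_def q_def)
  have le: "norm2 \<tau> (y - E y) \<le> norm2 \<tau> q" if y: "y \<in> conjugate v A" "norm y \<le> 1" for y
  proof -
    obtain a where a: "a \<in> A" "y = v \<cdot> a \<cdot> v\<^sup>\<dagger>" using y(1) by (auto simp: conjugate_def)
    have yM: "y \<in> M" using a vM v'M in_M by (simp add: closed_in)
    have "v\<^sup>\<dagger> \<cdot> p = v\<^sup>\<dagger>" using arg_cong[OF pv, of adj] vb in_bounded[OF pM] herm by (simp add: adj_times)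
    then have "y \<cdot> p = y" by (simp add: a(2) op_times_assoc)
    then have "ip y y \<le> (norm y)\<^sup>2 * ip p p" using ip_times_le(1)[OF yM pM] by simp
    also have "\<dots> \<le> 1 * ip p p"
      using y(2) ip.B_nonneg[OF pM] by (intro mult_right_mono) (auto simp: power_le_one)
    finally have "norm2 \<tau> y \<le> norm2 \<tau> q" by (simp add: norm2_eq ip_pq)
    then show ?thesis using E_diff_norm2_le[OF yM] by linarith
  qed
  define D where "D = popa_distance M \<tau> (conjugate v A) A"
  have ball0: "0 \<in> {y \<in> conjugate v A. norm y \<le> 1}"
    using N.zero_in by (auto simp: conjugate_def intro!: image_eqI[of _ _ 0])
  have bdd: "bdd_above ((\<lambda>y. norm2 \<tau> (y - E y)) ` {y \<in> conjugate v A. norm y \<le> 1})"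
    using le by (intro bdd_aboveI2[of _ _ "norm2 \<tau> q"]) auto
  have "D \<le> norm2 \<tau> q"
    unfolding D_def popa_distance_def using le ball0 by (intro cSUP_least) auto
  moreover have "norm2 \<tau> q \<le> D"
  proof -
    have D_ge: "norm2 \<tau> (y - E y) \<le> D" if "y \<in> conjugate v A" "norm y \<le> 1" for y
      unfolding D_def popa_distance_def using that by (intro cSUP_upper bdd) auto
    have "E v = 0"
    proof -
      have "E v = E (p \<cdot> (v \<cdot> q))" by (simp add: vq pv)
      also have "\<dots> = p \<cdot> (E v \<cdot> q)"
        using vM qM pq by (simp add: E_times_left E_times_right closed_in)
      also have "\<dots> = (p \<cdot> q) \<cdot> E v" using N_commute[OF E_in[OF vM] pq(2)] by (simp add: op_times_assoc)
      finally show ?thesis by (simp add: pq(3))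
    qed
    have "ip q q - ip (E v \<cdot> E (v\<^sup>\<dagger>)) (E v \<cdot> E (v\<^sup>\<dagger>)) \<le> D\<^sup>2"
    proof (rule residual_le_limit[OF vM v'M])
      fix n
      have Ub: "U n \<in> bounded_operators" by (rule N.in_bounded[OF U_in])
      have UU: "(U n)\<^sup>\<dagger> \<cdot> U n = \<one>" using U_unitary by (simp add: unitary_def)
      define x where "x = v \<cdot> U n \<cdot> v\<^sup>\<dagger>"
      have "x\<^sup>\<dagger> \<cdot> x = v \<cdot> ((U n)\<^sup>\<dagger> \<cdot> ((q \<cdot> U n) \<cdot> v\<^sup>\<dagger>))"
        using vb Ub by (simp add: x_def adj_simps q_def op_times_assoc)
      also have "q \<cdot> U n = U n \<cdot> q" by (rule N_commute[OF pq(2) U_in])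
      also have "v \<cdot> ((U n)\<^sup>\<dagger> \<cdot> ((U n \<cdot> q) \<cdot> v\<^sup>\<dagger>)) = v \<cdot> (((U n)\<^sup>\<dagger> \<cdot> U n) \<cdot> (q \<cdot> v\<^sup>\<dagger>))"
        by (simp only: op_times_assoc)
      also have "\<dots> = p" using vq by (simp add: UU p_def flip: op_times_assoc)
      finally have "ip x x = ip p p" by (simp add: ip_def herm pp)
      then show "ip (v \<cdot> U n \<cdot> v\<^sup>\<dagger>) (v \<cdot> U n \<cdot> v\<^sup>\<dagger>) = ip q q" by (simp add: x_def ip_pq)
      have "norm (v \<cdot> U n) \<le> 1"
        using norm_blinfun_compose[of v "U n"] mult_le_one[of "norm v" "norm (U n)"] nv
          norm_unitary_le[OF U_unitary] by simp
      then have "norm x \<le> 1"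
        using norm_blinfun_compose[of "v \<cdot> U n" "v\<^sup>\<dagger>"] mult_le_one[of "norm (v \<cdot> U n)" "norm (v\<^sup>\<dagger>)"] nv'
        by (simp add: x_def)
      moreover have "x \<in> conjugate v A" using U_in by (auto simp: x_def conjugate_def)
      ultimately show "norm2 \<tau> (v \<cdot> U n \<cdot> v\<^sup>\<dagger> - E (v \<cdot> U n \<cdot> v\<^sup>\<dagger>)) \<le> D"
        using D_ge[of x] by (simp add: x_def)
    qed
    then have "ip q q \<le> D\<^sup>2" by (simp add: \<open>E v = 0\<close> ip_def trace_zero)
    moreover have "0 \<le> D"
      using D_ge[of 0] ball0 E_self[OF N.zero_in] by (simp add: norm2_eq ip_def trace_zero)
    ultimately show ?thesis unfolding norm2_eq by (intro real_le_lsqrt)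
  qed
  ultimately show ?thesis by (simp add: D_def q_def)
qed

text \<open>At l = 1 the defining inequality is an equality for every admissible v; a single v with
  positive trace norm, here with range projection p and source projection 1 - p, excludes all l >
  1.\<close>

lemma popa_invariant_eq_1:
  assumes cont: "\<And>e. e \<in> M \<Longrightarrow> projection e \<Longrightarrow> abelian ((\<lambda>x. e \<cdot> x \<cdot> e) ` M) \<Longrightarrow> e = 0"
  shows "popa_invariant M \<tau> A = 1"
  unfolding popa_invariant_def
proof (rule Greatest_equality)
  show "\<forall>v\<in>popa_partial_isometries M A.
      1 * norm2 \<tau> (v\<^sup>\<dagger> \<cdot> v) \<le> popa_distance M \<tau> (conjugate v A) A"
    by (simp add: popa_distance_eq)
  obtain p where p: "p \<in> A" "hermitian p" "p \<cdot> p = p" "Re (\<tau> p) = 1/2"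
  proof (rule half_projection_exists)
    show "x \<in> A" if "x \<in> M" "\<And>a. a \<in> A \<Longrightarrow> x \<cdot> a = a \<cdot> x" for x
      using that by (rule relative_commutant)
    show "e = 0" if "e \<in> M" "projection e" "abelian ((\<lambda>x. e \<cdot> x \<cdot> e) ` M)" for e
      using that by (rule cont)
  qed (rule that)
  obtain v where v: "v \<in> M" "v \<cdot> v\<^sup>\<dagger> = p" "v\<^sup>\<dagger> \<cdot> v = \<one> - p"
    by (rule half_projections_equivalent[OF in_M[OF p(1)] p(2-4)]) (rule that)
  have tr: "Re (\<tau> (v\<^sup>\<dagger> \<cdot> v)) = 1/2" using p in_M[OF p(1)] by (simp add: v trace_simps)
  have "v \<noteq> 0" using tr by (auto simp: trace_zero)
  moreover have "projection (\<one> - p)"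
    using p by (simp add: projection_def hermitian_def adj_simps op_times.diff_left op_times.diff_right)
  ultimately have vp: "v \<in> popa_partial_isometries M A"
    using v p in_bounded[OF v(1)]
    by (simp add: popa_partial_isometries_def partial_isometry_def N.closed_in op_times.diff_right)
  have pos: "norm2 \<tau> (v\<^sup>\<dagger> \<cdot> v) > 0"
  proof -
    have "v\<^sup>\<dagger> \<cdot> v \<noteq> 0" using tr by (auto simp: trace_zero)
    then have "ip (v\<^sup>\<dagger> \<cdot> v) (v\<^sup>\<dagger> \<cdot> v) \<noteq> 0" using ip_faithful[of "v\<^sup>\<dagger> \<cdot> v"] v(1) by (auto simp: closed_in)
    then show ?thesis
      using ip.B_nonneg[of "v\<^sup>\<dagger> \<cdot> v"] v(1) by (simp add: norm2_eq closed_in order_less_le)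
  qed
  fix l assume "\<forall>v\<in>popa_partial_isometries M A.
      l * norm2 \<tau> (v\<^sup>\<dagger> \<cdot> v) \<le> popa_distance M \<tau> (conjugate v A) A"
  then have "l * norm2 \<tau> (v\<^sup>\<dagger> \<cdot> v) \<le> 1 * norm2 \<tau> (v\<^sup>\<dagger> \<cdot> v)" using vp popa_distance_eq by force
  then show "l \<le> 1" using pos by (simp only: mult_le_cancel_right_pos)
qed

end

lemma unitary_power_int:
  assumes A: "von_neumann_algebra A" and u: "u \<in> A" "unitary u"
  shows "unitary_power u (int n) \<in> A \<and> unitary (unitary_power u (int n))"
proof (induction n)
  case 0
  interpret von_neumann A by standard (rule A)
  show ?case by (simp add: unitary_power_def one_in unitary_def bounded_operators_closed)
next
  case (Suc n)
  interpret von_neumann A by standard (rule A)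
  define w where "w = unitary_power u (int n)"
  have w: "w \<in> A" "unitary w" using Suc by (auto simp: w_def)
  have S: "unitary_power u (int (Suc n)) = u \<cdot> w" by (simp add: unitary_power_def w_def del: of_nat_Suc)
  have b: "u \<in> bounded_operators" "w \<in> bounded_operators" using u w in_bounded by auto
  have "u\<^sup>\<dagger> \<cdot> (u \<cdot> z) = z" "w \<cdot> (w\<^sup>\<dagger> \<cdot> z) = z" for z
    using u(2) w(2) by (simp_all add: unitary_def flip: op_times_assoc)
  then have "unitary (u \<cdot> w)"
    using u(2) w(2) b by (simp add: unitary_def adj_simps op_times_assoc)
  then show ?case unfolding S using u w by (simp add: closed_in)
qed

theorem theorem4p7:
  fixes M A :: "('h::complex_hilbert_space) op set"
    and \<tau> :: "'h op \<Rightarrow> complex"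
  assumes "type_II1_factor M"
    and "normalized_trace M \<tau>"
    and "von_neumann_algebra A"
    and "A \<subseteq> M"
    and "abelian A"
    and "asymptotic_homomorphism M \<tau> A"
  shows "strongly_singular_masa M \<tau> A \<and> popa_invariant M \<tau> A = 1"
proof -
  obtain u where u: "u \<in> A" "unitary u"
    and lim: "\<And>x y. x \<in> M \<Longrightarrow> y \<in> M \<Longrightarrow>
      ((\<lambda>k::int. norm2 \<tau> (cond_exp M \<tau> A (x \<cdot> unitary_power u k \<cdot> y) -
          (cond_exp M \<tau> A x \<cdot> cond_exp M \<tau> A y \<cdot> unitary_power u k))) \<longlongrightarrow> 0) (filtercomap abs at_top)"
    using assms(6) unfolding asymptotic_homomorphism_def by blast
  \<comment> \<open>The absolute value of \<open>int n\<close> tends to infinity, so the naturals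
    run into the two-sided filter of the definition.\<close>
  have fl: "filterlim int (filtercomap abs at_top) sequentially"
    unfolding filterlim_filtercomap_iff filterlim_at_top eventually_sequentially comp_def
  proof
    fix Z :: int
    show "\<exists>N. \<forall>n\<ge>N. Z \<le> \<bar>int n\<bar>" by (intro exI[of _ "nat Z"]) auto
  qed
  interpret asymptotic M \<tau> A "\<lambda>n. unitary_power u (int n)"
  proof unfold_locales
    show "von_neumann_algebra M" "M \<inter> commutant M = range (\<lambda>c. scaleC_op c \<one>)"
      using assms(1) by (auto simp: type_II1_factor_def factor_def)
    show "unitary_power u (int n) \<in> A" "unitary (unitary_power u (int n))" for n
      using unitary_power_int[OF assms(3) u] by auto
    show "(\<lambda>n. norm2 \<tau> (cond_exp M \<tau> A (x \<cdot> unitary_power u (int n) \<cdot> y) -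
          cond_exp M \<tau> A x \<cdot> cond_exp M \<tau> A y \<cdot> unitary_power u (int n))) \<longlonglongrightarrow> 0"
      if "x \<in> M" "y \<in> M" for x y
      using filterlim_compose[OF lim[OF that] fl] .
  qed (use assms in auto)
  have "strongly_singular_masa M \<tau> A"
    unfolding strongly_singular_masa_def using masa strong_singularity by auto
  moreover have "popa_invariant M \<tau> A = 1"
    using assms(1) by (intro popa_invariant_eq_1) (auto simp: type_II1_factor_def)
  ultimately show ?thesis ..
qed

end
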